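(* Let $n\ge 3$, let $\mathbb{M}^n$ be a noncompact model manifold associated to a function $\psi$ (not necessarily Cartan-Hadamard), and let $p,q>0$ satisfy $\frac{1}{p+1}+\frac{1}{q+1}\le\frac{n-2}{n}$. Suppose that the function $$\mathcal{V}(r):=\left(\int_0^r\psi^{n-1}\,ds\right)^{\frac{pq-1}{2(p+1)(q+1)}},\qquad r\in[0,+\infty),$$ is convex. Then the following four assertions hold. (1) If $\Theta\notin L^1(\mathbb{R}^+)$, then for each $\xi>0$ there exists one and only one $\eta\equiv\eta(\xi)>0$ such that $CP(\xi,\eta)$ has a globally positive solution $(u,v)$, which satisfies $\ell_u=\ell_v=0$; moreover $\xi\mapsto\eta(\xi)$ is a continuous and strictly increasing bijection of $(0,+\infty)$ into itself. (2) If $\Theta\in L^1(\mathbb{R}^+)$, then there exist two functions $\eta_m,\eta_M$, continuous and strictly increasing bijections of $(0,+\infty)$ into itself, with $\eta_m(\xi)<\eta_M(\xi)$ for all $\xi>0$ and $\limsup_{\xi\to+\infty}[\eta_M(\xi)-\eta_m(\xi)]<+\infty$, such that for each $\xi>0$ the problem $CP(\xi,\eta)$ admits a globally positive solution $(u,v)$ if and only if $\eta_m(\xi)\le\eta\le\eta_M(\xi)$. In addition: $\ell_u>0,\ \ell_v=0$ if $\eta=\eta_m(\xi)$; $\ell_u>0,\ \ell_v>0$ if $\eta_m(\xi)<\eta<\eta_M(\xi)$; $\ell_u=0,\ \ell_v>0$ if $\eta=\eta_M(\xi)$. (3) If for some $(\xi,\eta)\in(0,+\infty)^2$ there exists a globally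 positive solution $(u,v)$ of $CP(\xi,\eta)$ such that at least one of the integrals $\int_0^{+\infty}u'v'\psi^{n-1}\,ds$, $\int_0^{+\infty}u^{p+1}\psi^{n-1}\,ds$, $\int_0^{+\infty}v^{q+1}\psi^{n-1}\,ds$ is finite, then $\mathbb{M}^n$ is isometric to $\mathbb{R}^n$ (i.e. $\psi(r)=r$), $\frac{1}{p+1}+\frac{1}{q+1}=\frac{n-2}{n}$, and all three integrals are finite. (4) For any $(\xi,\eta)\in(0,+\infty)^2$ and any $R>0$, there is no solution $(u,v)$ of $CP(\xi,\eta)$ with $u,v>0$ on $(0,R)$ and $u(R)=v(R)=0$.
   Context: A noncompact model manifold $\mathbb{M}^n$ associated to $\psi$ is a Riemannian manifold whose metric, in global polar coordinates $(r,\vartheta)\in\mathbb{R}^+\times\mathbb{S}^{n-1}$ about a pole $o$, is $g=dr\otimes dr+\psi^2(r)\,g_{\mathbb{S}^{n-1}}$, where $\psi\in C^1([0,+\infty))\cap C^\infty((0,+\infty))$, $\psi>0$ on $(0,+\infty)$, $\psi(0)=0$, $\psi'(0)=1$. (It is Cartan-Hadamard if and only if $\psi$ is convex, which is not assumed here.) Set $\Theta(r):=\frac{1}{\psi^{n-1}(r)}\int_0^r\psi^{n-1}\,ds$ for $r>0$. For $(\xi,\eta)\in(0,+\infty)^2$, $CP(\xi,\eta)$ denotes the Cauchy problem for functions $u,v$ of $r$ (of class $C^1$ up to $r=0$ and $C^2$ for $r>0$) $$(\psi^{n-1}u')'+\psi^{n-1}|v|^{q-1}v=0,\quad (\psi^{n-1}v')'+\psi^{n-1}|u|^{p-1}u=0\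 \ (r>0),\quad u'(0)=v'(0)=0,\ u(0)=\xi,\ v(0)=\eta.$$ A globally positive solution is a solution defined for every $r>0$ with $u,v>0$ on $[0,+\infty)$; its components are decreasing, so the limits $\ell_u:=\lim_{r\to+\infty}u(r)$, $\ell_v:=\lim_{r\to+\infty}v(r)$ exist. *)

theory Defs
  imports "HOL-Analysis.Analysis"
begin

text \<open>Derivatives are taken relative to \<open>I\<close>, hence one-sided at end points belonging to \<open>I\<close>.\<close>
definition C1_on :: "(real \<Rightarrow> real) \<Rightarrow> real set \<Rightarrow> bool" where
  "C1_on f I \<longleftrightarrow>
     (\<exists>f'. (\<forall>x\<in>I. (f has_real_derivative f' x) (at x within I)) \<and> continuous_on I f')"

text \<open>Only the values of \<open>\<psi>\<close> on \<open>[0,\<infinity>)\<close> are relevant.\<close>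
definition model_function :: "(real \<Rightarrow> real) \<Rightarrow> bool" where
  "model_function \<psi> \<longleftrightarrow>
     C1_on \<psi> {0..} \<and>
     (\<forall>k. (deriv ^^ k) \<psi> differentiable_on {0<..}) \<and>
     (\<forall>r>0. \<psi> r > 0) \<and>
     \<psi> 0 = 0 \<and>
     (\<psi> has_real_derivative 1) (at 0 within {0..})"

text \<open>
  The metric \<open>dr \<otimes> dr + \<psi>\<^sup>2(r) g\<close>, with \<open>g\<close> the round metric of the unit sphere, transported
  to Euclidean space by \<open>(r,\<theta>) \<mapsto> r \<theta>\<close>, the pole being the origin.  At \<open>x \<noteq> 0\<close> with
  \<open>e = x / |x|\<close> one has \<open>dr(v) = v \<bullet> e\<close> and \<open>d\<theta>(v) = (v - (v \<bullet> e) e) / |x|\<close>.  The value at the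
  pole is the continuous extension, because \<open>\<psi>(r) / r\<close> tends to \<open>\<psi>'(0) = 1\<close>.
\<close>
definition model_metric :: "(real \<Rightarrow> real) \<Rightarrow> 'a::euclidean_space \<Rightarrow> 'a \<Rightarrow> 'a \<Rightarrow> real" where
  "model_metric \<psi> x v w =
     (if x = 0 then v \<bullet> w
      else (let e = x /\<^sub>R norm x in
        (v \<bullet> e) * (w \<bullet> e) +
        (\<psi> (norm x))\<^sup>2 *
          (((v - (v \<bullet> e) *\<^sub>R e) /\<^sub>R norm x) \<bullet> ((w - (w \<bullet> e) *\<^sub>R e) /\<^sub>R norm x))))"

text \<open>
  Isometry of two Riemannian metrics \<open>g\<close>, \<open>h\<close> given on the whole space.  Since \<open>g\<close> and \<open>h\<close> are
  positive definite, the derivatives \<open>f' x\<close> are invertible, so that \<open>f\<close> is a \<open>C\<^sup>1\<close> diffeomorphism.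
\<close>
definition riemannian_isometric ::
    "('a::euclidean_space \<Rightarrow> 'a \<Rightarrow> 'a \<Rightarrow> real) \<Rightarrow> ('a \<Rightarrow> 'a \<Rightarrow> 'a \<Rightarrow> real) \<Rightarrow> bool" where
  "riemannian_isometric g h \<longleftrightarrow>
     (\<exists>f f'. bij f \<and>
        (\<forall>x. (f has_derivative f' x) (at x)) \<and>
        (\<forall>v. continuous_on UNIV (\<lambda>x. f' x v)) \<and>
        (\<forall>x v w. h (f x) (f' x v) (f' x w) = g x v w))"

definition flat_metric :: "'a::euclidean_space \<Rightarrow> 'a \<Rightarrow> 'a \<Rightarrow> real" where
  "flat_metric x v w = v \<bullet> w"

definition vol :: "nat \<Rightarrow> (real \<Rightarrow> real) \<Rightarrow> real \<Rightarrow> real" where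
  "vol n \<psi> r = integral {0..r} (\<lambda>s. \<psi> s ^ (n - 1))"

definition Theta :: "nat \<Rightarrow> (real \<Rightarrow> real) \<Rightarrow> real \<Rightarrow> real" where
  "Theta n \<psi> r = vol n \<psi> r / \<psi> r ^ (n - 1)"

text \<open>Under the condition on \<open>p\<close>, \<open>q\<close> one has \<open>p q > 1\<close>, and \<open>0 powr a = 0\<close> gives the right value at \<open>r = 0\<close>.\<close>
definition V_fun :: "nat \<Rightarrow> (real \<Rightarrow> real) \<Rightarrow> real \<Rightarrow> real \<Rightarrow> real \<Rightarrow> real" where
  "V_fun n \<psi> p q r = vol n \<psi> r powr ((p * q - 1) / (2 * (p + 1) * (q + 1)))"

text \<open>
  Solutions of the Cauchy problem on a nondegenerate interval \<open>I\<close> with least element \<open>0\<close>: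
  \<open>C\<^sup>1\<close> on \<open>I\<close>, and \<open>C\<^sup>2\<close> with the equations holding in the interior of \<open>I\<close>.
\<close>
definition CP_solution ::
    "nat \<Rightarrow> (real \<Rightarrow> real) \<Rightarrow> real \<Rightarrow> real \<Rightarrow> real set \<Rightarrow> real \<Rightarrow> real
      \<Rightarrow> (real \<Rightarrow> real) \<Rightarrow> (real \<Rightarrow> real) \<Rightarrow> bool" where
  "CP_solution n \<psi> p q I \<xi> \<eta> u v \<longleftrightarrow>
     C1_on u I \<and> C1_on v I \<and>
     C1_on (deriv u) (interior I) \<and> C1_on (deriv v) (interior I) \<and>
     (\<forall>r\<in>interior I.
        deriv (\<lambda>s. \<psi> s ^ (n - 1) * deriv u s) r
          + \<psi> r ^ (n - 1) * (\<bar>v r\<bar> powr (q - 1) * v r) = 0 \<and>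
        deriv (\<lambda>s. \<psi> s ^ (n - 1) * deriv v s) r
          + \<psi> r ^ (n - 1) * (\<bar>u r\<bar> powr (p - 1) * u r) = 0) \<and>
     (u has_real_derivative 0) (at 0 within I) \<and>
     (v has_real_derivative 0) (at 0 within I) \<and>
     u 0 = \<xi> \<and> v 0 = \<eta>"

definition globally_positive_solution ::
    "nat \<Rightarrow> (real \<Rightarrow> real) \<Rightarrow> real \<Rightarrow> real \<Rightarrow> real \<Rightarrow> real
      \<Rightarrow> (real \<Rightarrow> real) \<Rightarrow> (real \<Rightarrow> real) \<Rightarrow> bool" where
  "globally_positive_solution n \<psi> p q \<xi> \<eta> u v \<longleftrightarrow>
     CP_solution n \<psi> p q {0..} \<xi> \<eta> u v \<and> (\<forall>r\<ge>0. u r > 0 \<and> v r > 0)"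

definition increasing_bijection :: "(real \<Rightarrow> real) \<Rightarrow> bool" where
  "increasing_bijection f \<longleftrightarrow>
     continuous_on {0<..} f \<and> strict_mono_on {0<..} f \<and> bij_betw f {0<..} {0<..}"

definition tends_to_positive :: "(real \<Rightarrow> real) \<Rightarrow> bool" where
  "tends_to_positive f \<longleftrightarrow> (\<exists>l>0. (f \<longlongrightarrow> l) at_top)"

text \<open>
  Along globally positive solutions \<open>u\<close> and \<open>v\<close> are positive and decreasing, so the integrands
  below are nonnegative and integrability means exactly that the integral is finite.
\<close>
definition finite_gradient_integral ::
    "nat \<Rightarrow> (real \<Rightarrow> real) \<Rightarrow> (real \<Rightarrow> real) \<Rightarrow> (real \<Rightarrow> real) \<Rightarrow> bool" where
  "finite_gradient_integral n \<psi> u v \<longleftrightarrow>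
     (\<lambda>s. deriv u s * deriv v s * \<psi> s ^ (n - 1)) absolutely_integrable_on {0<..}"

definition finite_power_integral ::
    "nat \<Rightarrow> (real \<Rightarrow> real) \<Rightarrow> real \<Rightarrow> (real \<Rightarrow> real) \<Rightarrow> bool" where
  "finite_power_integral n \<psi> a w \<longleftrightarrow>
     (\<lambda>s. w s powr a * \<psi> s ^ (n - 1)) absolutely_integrable_on {0<..}"

end

theory Submission
  imports Defs
begin

text \<open>
  Put \<open>w = \<psi>\<^sup>n\<^sup>-\<^sup>1\<close>, \<open>W = \<integral>w\<close>, \<open>\<Theta> = W/w\<close>, \<open>x = -u'\<close>, \<open>y = -v'\<close>.  Convexity of \<open>V\<close> means
  \<open>(1 + 1/(p+1) + 1/(q+1)) w\<^sup>2 \<le> 2 W w'\<close>, which is exactly what makes the Pohozaev functional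
  \<open>P = W (x y + v\<^sup>q\<^sup>+\<^sup>1/(q+1) + u\<^sup>p\<^sup>+\<^sup>1/(p+1)) - w (x v/(q+1) + y u/(p+1))\<close> nonincreasing.  As \<open>P(0) = 0\<close>, the
  two components cannot vanish simultaneously.

  The system with \<open>v\<close>, \<open>u\<close> replaced by their positive parts on the right is order preserving for the order
  ``\<open>u\<close> up, \<open>v\<close> down''.  Hence global solutions exist by monotone iteration, without any Lipschitz
  condition, solutions depend monotonically on \<open>(\<xi>, \<eta>)\<close>, and monotone limits of solutions are solutions.
  The data for which \<open>u\<close> vanishes first form an open, monotone region; so do those for which \<open>v\<close> vanishes
  first.  The boundaries of these regions are the graphs of \<open>\<eta>\<^sub>M\<close> and \<open>\<eta>\<^sub>m\<close>, on which \<open>u\<close>, respectively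
  \<open>v\<close>, tends to zero.

  If both components tend to zero and \<open>\<Theta>\<close> is integrable, or if one of the energies is finite, then
  \<open>w x v\<close> and \<open>w y u\<close> tend to zero, so \<open>P\<close> vanishes identically; then \<open>V'' = 0\<close>, which forces \<open>\<psi>(r) = r\<close>.
  The gap \<open>\<eta>\<^sub>M - \<eta>\<^sub>m\<close> is bounded because \<open>z = u v\<close> satisfies \<open>z' \<le> - \<Theta> z\<^sup>\<kappa>\<close> with \<open>\<kappa> > 1\<close>.
\<close>

section \<open>Weighted primitives\<close>

text \<open>Although \<open>p * q > 1\<close>, one exponent may be below 1. The source is then not
  Lipschitz where a component vanishes, and uniqueness is available only as long as one of two
  solutions is positive. Order therefore replaces continuous dependence: data are approached along
  strictly monotone sequences, whose solutions converge monotonically at each radius, and uniqueness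
  identifies the limit up to its first zero. The coefficient \<open>1 + 1/(p+1) + 1/(q+1)\<close> is
  \<open>2 (1 - \<theta>)\<close>, where \<open>\<theta>\<close> is the exponent of
  \<open>V\<close>: convexity of \<open>W powr \<theta>\<close> reads
  \<open>(1 - \<theta>) w^2 \<le> W w'\<close>. In particular \<open>w' > 0\<close>, hence
  \<open>\<Theta>(r) \<le> r\<close>, which tames the singularity at the pole. The delicate point of
  rigidity is the decay of the boundary terms of \<open>P\<close>. For integrable
  \<open>\<Theta>\<close> it comes from comparing \<open>u\<close> and \<open>v\<close> with the
  ball averages of \<open>v^q\<close> and \<open>u^p\<close>; for finite energy it comes from
  testing each equation with the other component and excluding positive limits by the
  arithmetic-geometric mean inequality.\<close>

definition flux :: "(real \<Rightarrow> real) \<Rightarrow> (real \<Rightarrow> real) \<Rightarrow> real \<Rightarrow> real" where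
  "flux w f r = integral {0..r} (\<lambda>t. w t * f t)"

definition slope :: "(real \<Rightarrow> real) \<Rightarrow> (real \<Rightarrow> real) \<Rightarrow> real \<Rightarrow> real" where
  "slope w f r = flux w f r / w r"

text \<open>Since \<open>0 powr a = 0\<close>, nonpositive arguments give 0; for
  \<open>a > 0\<close> this makes the function continuous and monotone on the whole line.\<close>

definition ppow :: "real \<Rightarrow> real \<Rightarrow> real" where
  "ppow a x = max x 0 powr a"

text \<open>
  The right-hand sides involve the positive parts of \<open>u\<close> and \<open>v\<close>, so that solutions continue past a zero.
  At \<open>r = 0\<close> the slope is \<open>0 / 0 = 0\<close>, which encodes \<open>u'(0) = v'(0) = 0\<close>.
\<close>
definition lane_sol ::
    "(real \<Rightarrow> real) \<Rightarrow> real \<Rightarrow> real \<Rightarrow> real set \<Rightarrow> real \<Rightarrow> real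
      \<Rightarrow> (real \<Rightarrow> real) \<Rightarrow> (real \<Rightarrow> real) \<Rightarrow> bool" where
  "lane_sol w p q I \<xi> \<eta> u v \<longleftrightarrow>
     u 0 = \<xi> \<and> v 0 = \<eta> \<and>
     (\<forall>r\<in>I. (u has_real_derivative - slope w (\<lambda>t. ppow q (v t)) r) (at r within I)) \<and>
     (\<forall>r\<in>I. (v has_real_derivative - slope w (\<lambda>t. ppow p (u t)) r) (at r within I))"

lemma lane_sol_swap: "lane_sol w p q I \<xi> \<eta> u v \<Longrightarrow> lane_sol w q p I \<eta> \<xi> v u"
  by (auto simp: lane_sol_def)

lemma lane_sol_subset: "lane_sol w p q I \<xi> \<eta> u v \<Longrightarrow> J \<subseteq> I \<Longrightarrow> lane_sol w p q J \<xi> \<eta> u v"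
  unfolding lane_sol_def by (meson DERIV_subset subsetD)

lemma ppow_nonneg [simp]: "0 \<le> ppow a x"
  by (simp add: ppow_def)

lemma ppow_eq: "0 \<le> x \<Longrightarrow> ppow a x = x powr a"
  by (simp add: ppow_def max_absorb1)

lemma ppow_pos: "0 < x \<Longrightarrow> 0 < ppow a x"
  by (simp add: ppow_def)

lemma ppow_mono: "0 < a \<Longrightarrow> x \<le> y \<Longrightarrow> ppow a x \<le> ppow a y"
  unfolding ppow_def by (intro powr_mono2) auto

lemma continuous_on_ppow: "0 < a \<Longrightarrow> continuous_on S f \<Longrightarrow> continuous_on S (\<lambda>x. ppow a (f x))"
  unfolding ppow_def by (intro continuous_on_powr' continuous_intros) auto

lemma isCont_ppow: "0 < a \<Longrightarrow> isCont (ppow a) x"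
  using continuous_on_ppow[of a UNIV "\<lambda>x. x"] by (simp add: continuous_on_eq_continuous_at)

lemma deriv_nonneg_imp_mono_real:
  fixes f :: "real \<Rightarrow> real"
  assumes "a \<le> b" "continuous_on {a..b} f"
    and "\<And>x. a < x \<Longrightarrow> x < b \<Longrightarrow> \<exists>D. (f has_real_derivative D) (at x) \<and> 0 \<le> D"
  shows "f a \<le> f b"
  by (rule DERIV_nonneg_imp_increasing_open) (use assms in auto)

lemma deriv_nonpos_imp_antimono_real:
  fixes f :: "real \<Rightarrow> real"
  assumes "a \<le> b" "continuous_on {a..b} f"
    and "\<And>x. a < x \<Longrightarrow> x < b \<Longrightarrow> \<exists>D. (f has_real_derivative D) (at x) \<and> D \<le> 0"
  shows "f b \<le> f a"
  by (rule DERIV_nonpos_imp_decreasing_open) (use assms in auto)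

locale lane_emden =
  fixes w w' :: "real \<Rightarrow> real" and p q :: real
  assumes w_cont: "continuous_on {0..} w"
    and w_zero: "w 0 = 0"
    and w_pos: "\<And>r. 0 < r \<Longrightarrow> 0 < w r"
    and w_deriv: "\<And>r. 0 < r \<Longrightarrow> (w has_real_derivative w' r) (at r)"
    and p_pos: "0 < p" and q_pos: "0 < q" and pq: "1 < p * q"
    and key: "\<And>r. 0 < r \<Longrightarrow>
      (1 + 1 / (p + 1) + 1 / (q + 1)) * (w r)\<^sup>2 \<le> 2 * integral {0..r} w * w' r"
begin

text \<open>The weight enters both equations alike and \<open>key\<close> is symmetric in the
  exponents. Together with \<open>lane_sol_swap\<close> this instance transfers each fact about one
  component to the other, so most arguments are carried out only once.\<close>

lemma swap: "lane_emden w w' q p"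
proof
  show "1 < q * p" using pq by (simp add: mult.commute)
  show "(1 + 1 / (q + 1) + 1 / (p + 1)) * (w r)\<^sup>2 \<le> 2 * integral {0..r} w * w' r" if "0 < r" for r
    using key[OF that] by (simp only: add.assoc add.commute[of "1 / (q + 1)"])
qed (use w_cont w_zero w_pos w_deriv p_pos q_pos in auto)

abbreviation W :: "real \<Rightarrow> real" where "W r \<equiv> integral {0..r} w"
abbreviation \<Theta> :: "real \<Rightarrow> real" where "\<Theta> r \<equiv> W r / w r"

lemma w_nonneg: "0 \<le> r \<Longrightarrow> 0 \<le> w r"
  using w_pos[of r] w_zero by (cases "r = 0") auto

lemma w_cont': "0 \<le> a \<Longrightarrow> continuous_on {a..b} w"
  by (rule continuous_on_subset[OF w_cont]) auto

lemma wf_cont: "continuous_on {0..R} f \<Longrightarrow> continuous_on {0..R} (\<lambda>t. w t * f t)"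
  by (intro continuous_intros w_cont') auto

lemma flux_deriv_within:
  assumes "continuous_on {0..R} f" "0 \<le> r" "r \<le> R"
  shows "(flux w f has_real_derivative w r * f r) (at r within {0..R})"
  using integral_has_real_derivative[OF wf_cont[OF assms(1)], of r] assms(2,3)
  unfolding flux_def[abs_def] by auto

lemma at_within_Icc: "0 < r \<Longrightarrow> r < R \<Longrightarrow> at r within {0..R} = at (r::real)"
  by (rule at_within_interior) auto

lemma flux_deriv:
  assumes "continuous_on {0..R} f" "0 < r" "r < R"
  shows "(flux w f has_real_derivative w r * f r) (at r)"
  using flux_deriv_within[OF assms(1), of r] assms at_within_Icc by auto

lemma W_flux: "W = flux w (\<lambda>_. 1)"
  by (auto simp: flux_def)

lemma W_deriv: "0 < r \<Longrightarrow> (W has_real_derivative w r) (at r)"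
  using flux_deriv[of "r + 1" "\<lambda>_. 1" r] unfolding W_flux by auto

lemma flux_cont: "continuous_on {0..R} f \<Longrightarrow> continuous_on {0..R} (flux w f)"
  by (rule DERIV_continuous_on[where D = "\<lambda>r. w r * f r"]) (auto intro: flux_deriv_within)

lemma W_cont: "continuous_on {0..} W"
proof -
  have "continuous (at r within {0..}) W" if "0 \<le> r" for r
  proof -
    have "continuous (at r within {0..r+1}) W"
      using flux_cont[of "r+1" "\<lambda>_. 1"] that unfolding W_flux[symmetric]
      by (auto simp: continuous_on_eq_continuous_within)
    moreover have "at r within {0..r+1} = at r within {0..}"
      by (rule at_within_nhd[of _ "{..<r+1}"]) auto
    ultimately show ?thesis by simp
  qed
  then show ?thesis by (auto simp: continuous_on_eq_continuous_within)
qed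

lemma W_pos: "0 < r \<Longrightarrow> 0 < W r"
proof -
  assume r: "0 < r"
  have "W 0 < W r"
    by (rule DERIV_pos_imp_increasing_open[OF r])
      (use W_deriv w_pos continuous_on_subset[OF W_cont] in auto)
  then show "0 < W r" by simp
qed

lemma W_nonneg: "0 \<le> r \<Longrightarrow> 0 \<le> W r"
  using W_pos[of r] by (cases "r = 0") auto

text \<open>The left side of \<open>key\<close> is positive, and so is \<open>W r\<close>. This is
  the source of the monotonicity of the weight, which gives \<open>\<Theta> r \<le> r\<close> and
  thereby control of the slopes at the pole.\<close>

lemma w'_pos: "0 < r \<Longrightarrow> 0 < w' r"
proof -
  assume r: "0 < r"
  have "0 < (1 + 1 / (p + 1) + 1 / (q + 1)) * (w r)\<^sup>2"
    using w_pos[OF r] p_pos q_pos by (intro mult_pos_pos) (auto intro!: add_pos_pos)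
  then have "0 < 2 * W r * w' r" using key[OF r] by linarith
  then show ?thesis using W_pos[OF r] by (simp add: zero_less_mult_iff)
qed

lemma w_mono:
  assumes "0 \<le> r" "r \<le> s"
  shows "w r \<le> w s"
proof (rule deriv_nonneg_imp_mono_real[where f = w])
  fix x assume "r < x"
  then show "\<exists>D. (w has_real_derivative D) (at x) \<and> 0 \<le> D"
    using w_deriv[of x] w'_pos[of x] assms by (intro exI[of _ "w' x"]) auto
qed (use w_cont'[of r s] assms in auto)

lemma Theta_pos: "0 < r \<Longrightarrow> 0 < \<Theta> r"
  using W_pos w_pos by simp

lemma flux_mono:
  assumes "continuous_on {0..r} f" "continuous_on {0..r} g" "\<And>t. 0 \<le> t \<Longrightarrow> t \<le> r \<Longrightarrow> f t \<le> g t"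
  shows "flux w f r \<le> flux w g r"
  unfolding flux_def
  by (intro integral_le integrable_continuous_real wf_cont assms(1,2) mult_left_mono w_nonneg)
    (use assms(3) in auto)

lemma flux_const: "flux w (\<lambda>_. c) r = c * W r"
  by (simp add: flux_def mult.commute)

lemma flux_le:
  assumes "continuous_on {0..r} f" "\<And>t. 0 \<le> t \<Longrightarrow> t \<le> r \<Longrightarrow> f t \<le> c"
  shows "flux w f r \<le> c * W r"
  using flux_mono[OF assms(1) continuous_on_const assms(2)] by (simp add: flux_const)

lemma flux_ge:
  assumes "continuous_on {0..r} f" "\<And>t. 0 \<le> t \<Longrightarrow> t \<le> r \<Longrightarrow> c \<le> f t"
  shows "c * W r \<le> flux w f r"
  using flux_mono[OF continuous_on_const assms(1,2)] by (simp add: flux_const)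

lemma flux_nonneg:
  assumes "continuous_on {0..r} f" "\<And>t. 0 \<le> t \<Longrightarrow> t \<le> r \<Longrightarrow> 0 \<le> f t"
  shows "0 \<le> flux w f r"
  using flux_ge[OF assms] by simp

lemma flux_diff:
  assumes "continuous_on {0..r} f" "continuous_on {0..r} g"
  shows "flux w (\<lambda>t. f t - g t) r = flux w f r - flux w g r"
  unfolding flux_def right_diff_distrib
  by (intro integral_diff integrable_continuous_real wf_cont assms)

lemma Theta_le: "0 \<le> r \<Longrightarrow> \<Theta> r \<le> r"
proof (cases "r = 0")
  case False
  assume "0 \<le> r"
  then have r: "0 < r" using False by simp
  have "W r \<le> integral {0..r} (\<lambda>_. w r)"
    by (intro integral_le integrable_continuous_real w_cont') (use w_mono r in auto)
  then show ?thesis using r w_pos[OF r] by (simp add: divide_simps mult.commute)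
qed auto

lemma Theta_nonneg: "0 \<le> r \<Longrightarrow> 0 \<le> \<Theta> r"
  using W_nonneg w_nonneg by simp

lemma slope_zero: "slope w f 0 = 0" by (simp add: slope_def w_zero)

lemma slope_mono:
  assumes "continuous_on {0..r} f" "continuous_on {0..r} g" "\<And>t. 0 \<le> t \<Longrightarrow> t \<le> r \<Longrightarrow> f t \<le> g t" "0 \<le> r"
  shows "slope w f r \<le> slope w g r"
  unfolding slope_def using flux_mono[OF assms(1,2,3)] w_nonneg[OF assms(4)] by (rule divide_right_mono)

lemma slope_le:
  assumes "continuous_on {0..r} f" "\<And>t. 0 \<le> t \<Longrightarrow> t \<le> r \<Longrightarrow> f t \<le> c" "0 \<le> r"
  shows "slope w f r \<le> c * \<Theta> r"
  using divide_right_mono[OF flux_le[OF assms(1,2)] w_nonneg[OF assms(3)]] by (simp add: slope_def)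

lemma slope_ge:
  assumes "continuous_on {0..r} f" "\<And>t. 0 \<le> t \<Longrightarrow> t \<le> r \<Longrightarrow> c \<le> f t" "0 \<le> r"
  shows "c * \<Theta> r \<le> slope w f r"
  using divide_right_mono[OF flux_ge[OF assms(1,2)] w_nonneg[OF assms(3)]] by (simp add: slope_def)

lemma slope_nonneg:
  assumes "continuous_on {0..r} f" "\<And>t. 0 \<le> t \<Longrightarrow> t \<le> r \<Longrightarrow> 0 \<le> f t" "0 \<le> r"
  shows "0 \<le> slope w f r"
  using slope_ge[OF assms] by simp

text \<open>The radial Laplacian: for \<open>x = -u'\<close> and source \<open>f\<close> this is
  \<open>x' + (w'/w) x = f\<close>.\<close>

lemma slope_deriv:
  assumes "continuous_on {0..R} f" "0 < r" "r < R"
  shows "(slope w f has_real_derivative f r - w' r / w r * slope w f r) (at r)"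
proof -
  have "((\<lambda>r. flux w f r / w r) has_real_derivative
      (w r * f r * w r - flux w f r * w' r) / (w r * w r)) (at r)"
    using w_pos[of r] assms by (intro DERIV_divide flux_deriv[OF assms] w_deriv) auto
  moreover have "(w r * f r * w r - flux w f r * w' r) / (w r * w r) = f r - w' r / w r * slope w f r"
    using w_pos[of r] assms by (simp add: slope_def field_simps)
  ultimately show ?thesis by (simp add: slope_def[abs_def])
qed

lemma slope_cont:
  assumes f: "continuous_on {0..R} f"
  shows "continuous_on {0..R} (slope w f)"
proof (cases "0 \<le> R")
  case True
  have "continuous (at r within {0..R}) (slope w f)" if r: "0 \<le> r" "r \<le> R" for r
  proof (cases "r = 0")
    case False
    have "continuous (at r within {0..R}) (flux w f)" "continuous (at r within {0..R}) w"
      using flux_cont[OF f] w_cont'[of 0 R] r by (auto simp: continuous_on_eq_continuous_within)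
    then show ?thesis unfolding slope_def[abs_def]
      by (intro continuous_intros) (use w_pos[of r] r False in auto)
  next
    case True
    obtain M where M: "\<And>t. t \<in> {0..R} \<Longrightarrow> \<bar>f t\<bar> \<le> M"
      using compact_imp_bounded[OF compact_continuous_image[OF f compact_Icc]]
      unfolding bounded_iff by (metis imageI real_norm_def)
    \<comment> \<open>The quotient is \<open>0 / 0\<close> here; a bound \<open>M\<close> for
      \<open>f\<close> gives at most \<open>M * \<Theta> s \<le> M * s\<close> nearby, so the
      default value 0 is the limit.\<close>
    have "(slope w f \<longlongrightarrow> 0) (at 0 within {0..R})"
    proof (rule Lim_null_comparison)
      show "((\<lambda>s. M * s) \<longlongrightarrow> 0) (at 0 within {0..R})"
        by (auto intro!: tendsto_eq_intros)
      show "\<forall>\<^sub>F s in at 0 within {0..R}. norm (slope w f s) \<le> M * s"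
      proof (rule eventually_at_topological[THEN iffD2], intro exI[of _ UNIV] conjI ballI impI open_UNIV UNIV_I)
        fix s assume "s \<in> UNIV" "s \<noteq> 0" and s: "s \<in> {0..R}"
        have c: "continuous_on {0..s} f" by (rule continuous_on_subset[OF f]) (use s in auto)
        have "slope w f s \<le> M * \<Theta> s" by (rule slope_le[OF c]) (use M s in \<open>force simp: abs_le_iff\<close>)+
        moreover have "- M * \<Theta> s \<le> slope w f s" by (rule slope_ge[OF c]) (use M s in \<open>force simp: abs_le_iff\<close>)+
        moreover have "0 \<le> M" using M[OF s] by linarith
        moreover have "M * \<Theta> s \<le> M * s" using Theta_le[of s] s \<open>0 \<le> M\<close> by (intro mult_left_mono) auto
        ultimately show "norm (slope w f s) \<le> M * s" by auto
      qed
    qed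
    then show ?thesis unfolding True continuous_within slope_zero .
  qed
  then show ?thesis by (auto simp: continuous_on_eq_continuous_within)
qed auto

end

section \<open>Comparison and uniqueness\<close>

lemma continuous_on_atLeast:
  fixes f :: "real \<Rightarrow> real"
  assumes "\<And>R. 0 \<le> R \<Longrightarrow> continuous_on {0..R} f"
  shows "continuous_on {0..} f"
proof -
  have "continuous (at r within {0..}) f" if "0 \<le> r" for r
  proof -
    have "continuous (at r within {0..r+1}) f"
      using assms[of "r+1"] that by (auto simp: continuous_on_eq_continuous_within)
    moreover have "at r within {0..r+1} = at r within {0..}"
      by (rule at_within_nhd[of _ "{..<r+1}"]) auto
    ultimately show ?thesis by simp
  qed
  then show ?thesis by (auto simp: continuous_on_eq_continuous_within)
qed

text \<open>For \<open>a < 1\<close> the power is not Lipschitz at 0, so \<open>x\<close> is kept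
  away from 0. If \<open>y \<ge> d / 2\<close>, the mean value theorem applies on
  \<open>{d/2..M}\<close>; otherwise \<open>x\<close> and \<open>y\<close> are at least
  \<open>d / 2\<close> apart, while the powers differ by at most \<open>M powr a\<close>.\<close>

lemma ppow_one_sided_Lipschitz:
  assumes "0 < a" "0 < d" "d \<le> M"
  obtains L where "0 \<le> L"
    "\<And>x y. d \<le> x \<Longrightarrow> x \<le> M \<Longrightarrow> y \<le> M \<Longrightarrow> \<bar>ppow a x - ppow a y\<bar> \<le> L * \<bar>x - y\<bar>"
proof -
  have "continuous_on {d/2..M} (\<lambda>z. a * z powr (a - 1))"
    using assms by (intro continuous_intros) auto
  then have "bounded ((\<lambda>z. a * z powr (a - 1)) ` {d/2..M})"
    by (intro compact_imp_bounded compact_continuous_image) auto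
  then obtain B where B: "\<And>z. z \<in> {d/2..M} \<Longrightarrow> \<bar>a * z powr (a - 1)\<bar> \<le> B"
    unfolding bounded_iff by (metis imageI real_norm_def)
  have B0: "0 \<le> B" using order_trans[OF abs_ge_zero B[of M]] assms by simp
  define L where "L = max B (2 * M powr a / d)"
  have main: "\<bar>ppow a x - ppow a y\<bar> \<le> L * \<bar>x - y\<bar>" if x: "d \<le> x" "x \<le> M" and y: "y \<le> M" for x y
  proof (cases "d / 2 \<le> y")
    case True
    have "norm (x powr a - y powr a) \<le> B * norm (x - y)"
    proof (rule field_differentiable_bound[where S = "{d/2..M}" and f' = "\<lambda>z. a * z powr (a - 1)"])
      show "((\<lambda>z. z powr a) has_real_derivative a * z powr (a - 1)) (at z within {d/2..M})"
        if "z \<in> {d/2..M}" for z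
        using has_real_derivative_powr[of z a] that assms by (auto intro: DERIV_subset)
    qed (use B x y True assms in auto)
    also have "\<dots> \<le> L * norm (x - y)" unfolding L_def by (intro mult_right_mono) auto
    finally show ?thesis using x True assms by (simp add: ppow_eq)
  next
    case False
    have x0: "ppow a x \<le> M powr a" using x assms by (auto simp: ppow_eq intro!: powr_mono2)
    have "ppow a y \<le> ppow a x" using False x assms by (intro ppow_mono) auto
    then have "\<bar>ppow a x - ppow a y\<bar> \<le> ppow a x" by simp
    also have "\<dots> \<le> M powr a" by (fact x0)
    also have "\<dots> = (2 * M powr a / d) * (d / 2)" using assms by simp
    also have "\<dots> \<le> (2 * M powr a / d) * \<bar>x - y\<bar>" using False x assms by (intro mult_left_mono) auto
    also have "\<dots> \<le> L * \<bar>x - y\<bar>" unfolding L_def by (intro mult_right_mono) auto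
    finally show ?thesis .
  qed
  show thesis by (rule that[of L]) (use main B0 in \<open>auto simp: L_def\<close>)
qed

context lane_emden
begin

abbreviation psol where "psol \<equiv> lane_sol w p q {0..}"
abbreviation slope_u where "slope_u v \<equiv> slope w (\<lambda>t. ppow q (v t))"
abbreviation slope_v where "slope_v u \<equiv> slope w (\<lambda>t. ppow p (u t))"
abbreviation flux_u where "flux_u v \<equiv> flux w (\<lambda>t. ppow q (v t))"
abbreviation flux_v where "flux_v u \<equiv> flux w (\<lambda>t. ppow p (u t))"

lemma lane_sol_cont:
  assumes "lane_sol w p q I \<xi> \<eta> u v"
  shows "continuous_on I u"
  using assms unfolding lane_sol_def
  by (intro DERIV_continuous_on[where D = "\<lambda>r. - slope_u v r"]) auto

lemma lane_sol_cont_source: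
  assumes "lane_sol w p q {0..R} \<xi> \<eta> u v" "r \<le> R"
  shows "continuous_on {0..r} (\<lambda>t. ppow p (u t))"
  by (rule continuous_on_ppow[OF p_pos continuous_on_subset[OF lane_sol_cont[OF assms(1)]]])
    (use assms(2) in auto)

lemma psol_Icc: "psol \<xi> \<eta> u v \<Longrightarrow> lane_sol w p q {0..R} \<xi> \<eta> u v"
  by (erule lane_sol_subset) auto

lemma psol_cont_source: "psol \<xi> \<eta> u v \<Longrightarrow> continuous_on {0..r} (\<lambda>t. ppow p (u t))"
  using lane_sol_cont_source[OF psol_Icc[of _ _ _ _ r]] by auto

lemma psol_cont: "psol \<xi> \<eta> u v \<Longrightarrow> 0 \<le> a \<Longrightarrow> continuous_on {a..b} u"
  by (rule continuous_on_subset[OF lane_sol_cont]) auto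

lemma lane_sol_deriv:
  assumes "lane_sol w p q {0..R} \<xi> \<eta> u v" "0 < r" "r < R"
  shows "(v has_real_derivative - slope_v u r) (at r)"
proof -
  have "(v has_real_derivative - slope_v u r) (at r within {0..R})"
    using assms by (auto simp: lane_sol_def)
  then show ?thesis using at_within_Icc assms by simp
qed

lemma psol_deriv:
  "psol \<xi> \<eta> u v \<Longrightarrow> 0 < r \<Longrightarrow> (v has_real_derivative - slope_v u r) (at r)"
  using lane_sol_deriv[OF psol_Icc[of _ _ _ _ "r+1"]] by auto

lemma psol_source_nonneg:
  "psol \<xi> \<eta> u v \<Longrightarrow> 0 \<le> r \<Longrightarrow> 0 \<le> slope_v u r"
  by (intro slope_nonneg psol_cont_source) auto

lemma psol_antimono:
  assumes "psol \<xi> \<eta> u v" "0 \<le> r" "r \<le> s"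
  shows "v s \<le> v r"
proof (rule deriv_nonpos_imp_antimono_real[where f = v])
  fix x assume "r < x"
  then show "\<exists>D. (v has_real_derivative D) (at x) \<and> D \<le> 0"
    using psol_deriv[OF assms(1), of x] psol_source_nonneg[OF assms(1), of x] assms
    by (intro exI[of _ "- slope_v u x"]) auto
qed (use lane_emden.psol_cont[OF swap lane_sol_swap[OF assms(1)]] assms in auto)

lemma psol_init: "psol \<xi> \<eta> u v \<Longrightarrow> u 0 = \<xi>" "psol \<xi> \<eta> u v \<Longrightarrow> v 0 = \<eta>"
  by (auto simp: lane_sol_def)

lemma psol_le: "psol \<xi> \<eta> u v \<Longrightarrow> 0 \<le> r \<Longrightarrow> v r \<le> \<eta>"
  using psol_antimono[of \<xi> \<eta> u v 0 r] psol_init[of \<xi> \<eta> u v] by auto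

lemma psol_le': "psol \<xi> \<eta> u v \<Longrightarrow> 0 \<le> r \<Longrightarrow> u r \<le> \<xi>"
  using lane_emden.psol_le[OF swap lane_sol_swap] .

text \<open>Together with \<open>psol_le\<close> this bounds solutions at a fixed radius in terms of
  a bound for the data alone, as required for limits of solutions.\<close>

lemma psol_lower:
  assumes s: "psol \<xi> \<eta> u v" and M: "\<xi> \<le> M" and r: "0 \<le> r"
  shows "\<eta> - ppow p M * r * r \<le> v r"
proof -
  let ?c = "ppow p M * r"
  have "v 0 + ?c * 0 \<le> v r + ?c * r"
  proof (rule deriv_nonneg_imp_mono_real[where f = "\<lambda>t. v t + ?c * t"])
    fix x assume x: "0 < x" "x < r"
    have "slope_v u x \<le> ppow p M * \<Theta> x"
      by (rule slope_le[OF psol_cont_source[OF s]])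
        (use x psol_le'[OF s] M in \<open>auto intro!: ppow_mono p_pos intro: order_trans\<close>)
    also have "\<dots> \<le> ppow p M * r" using Theta_le[of x] x by (intro mult_left_mono) auto
    finally have "0 \<le> - slope_v u x + ?c" by simp
    moreover have "((\<lambda>t. v t + ?c * t) has_real_derivative - slope_v u x + ?c) (at x)"
      using psol_deriv[OF s x(1)] by (auto intro!: derivative_eq_intros)
    ultimately show "\<exists>D. ((\<lambda>t. v t + ?c * t) has_real_derivative D) (at x) \<and> 0 \<le> D" by blast
  qed (use r lane_emden.psol_cont[OF swap lane_sol_swap[OF s]] in \<open>auto intro!: continuous_intros\<close>)
  then show ?thesis using psol_init[OF s] by simp
qed

lemma psol_lower':
  "psol \<xi> \<eta> u v \<Longrightarrow> \<eta> \<le> M \<Longrightarrow> 0 \<le> r \<Longrightarrow> \<xi> - ppow q M * r * r \<le> u r"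
  using lane_emden.psol_lower[OF swap lane_sol_swap] .

text \<open>A larger \<open>u\<close> makes \<open>v\<close> fall faster, so \<open>v1 - v2\<close>
  can only grow.\<close>

lemma psol_diff_mono:
  assumes s1: "psol \<xi>1 \<eta>1 u1 v1" and s2: "psol \<xi>2 \<eta>2 u2 v2"
    and le: "\<And>t. 0 \<le> t \<Longrightarrow> t \<le> R \<Longrightarrow> u1 t \<le> u2 t"
    and rs: "0 \<le> r" "r \<le> s" "s \<le> R"
  shows "v1 r - v2 r \<le> v1 s - v2 s"
proof (rule deriv_nonneg_imp_mono_real[where f = "\<lambda>t. v1 t - v2 t"])
  fix x assume x: "r < x" "x < s"
  have "slope_v u1 x \<le> slope_v u2 x"
    by (rule slope_mono[OF psol_cont_source[OF s1] psol_cont_source[OF s2]])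
      (use x rs le in \<open>auto intro!: ppow_mono p_pos\<close>)
  moreover have "((\<lambda>t. v1 t - v2 t) has_real_derivative
      - slope_v u1 x - - slope_v u2 x) (at x)"
    by (intro DERIV_diff psol_deriv[OF s1] psol_deriv[OF s2]) (use x rs in auto)
  ultimately show "\<exists>D. ((\<lambda>t. v1 t - v2 t) has_real_derivative D) (at x) \<and> 0 \<le> D"
    by (metis diff_ge_0_iff_ge minus_diff_minus neg_0_le_iff_le minus_diff_eq)
qed (use rs lane_emden.psol_cont[OF swap lane_sol_swap[OF s1]] lane_emden.psol_cont[OF swap lane_sol_swap[OF s2]]
      in \<open>auto intro!: continuous_intros\<close>)

lemma psol_diff_mono':
  assumes s1: "psol \<xi>1 \<eta>1 u1 v1" and s2: "psol \<xi>2 \<eta>2 u2 v2"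
    and le: "\<And>t. 0 \<le> t \<Longrightarrow> t \<le> R \<Longrightarrow> v2 t \<le> v1 t"
    and rs: "0 \<le> r" "r \<le> s" "s \<le> R"
  shows "u2 r - u1 r \<le> u2 s - u1 s"
  using lane_emden.psol_diff_mono[OF swap lane_sol_swap[OF s2] lane_sol_swap[OF s1], of R r s] le rs by blast

text \<open>As long as \<open>v2 \<le> v1\<close> holds, both gaps are nondecreasing. At the first
  radius where it could fail, the gap in \<open>v\<close> is therefore still at least
  \<open>\<eta>1 - \<eta>2 > 0\<close>; the strict inequality is what starts the argument.\<close>

lemma psol_compare:
  assumes s1: "psol \<xi>1 \<eta>1 u1 v1" and s2: "psol \<xi>2 \<eta>2 u2 v2"
    and \<xi>: "\<xi>1 \<le> \<xi>2" and \<eta>: "\<eta>2 < \<eta>1" and r: "0 \<le> r"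
  shows "u1 r + (\<xi>2 - \<xi>1) \<le> u2 r" "v2 r + (\<eta>1 - \<eta>2) \<le> v1 r"
proof -
  note init = psol_init[OF s1] psol_init[OF s2]
  have step_u: "u1 t + (\<xi>2 - \<xi>1) \<le> u2 t"
    if "\<And>t. 0 \<le> t \<Longrightarrow> t \<le> R \<Longrightarrow> v2 t \<le> v1 t" "0 \<le> t" "t \<le> R" for t R
    using psol_diff_mono'[OF s1 s2 that(1), of R 0 t] that init by auto
  have step_v: "v2 t + (\<eta>1 - \<eta>2) \<le> v1 t"
    if "\<And>t. 0 \<le> t \<Longrightarrow> t \<le> R \<Longrightarrow> v2 t \<le> v1 t" "0 \<le> t" "t \<le> R" for t R
  proof -
    have "u1 t \<le> u2 t" if "0 \<le> t" "t \<le> R" for t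
      using step_u[OF \<open>\<And>t. 0 \<le> t \<Longrightarrow> t \<le> R \<Longrightarrow> v2 t \<le> v1 t\<close> that] \<xi> by auto
    from psol_diff_mono[OF s1 s2 this, of R 0 t] that show ?thesis using init by auto
  qed
  define Z where "Z = {t \<in> {0..}. v1 t \<le> v2 t}"
  have c: "continuous_on {0..} v1" "continuous_on {0..} v2"
    using lane_emden.lane_sol_cont[OF swap lane_sol_swap] s1 s2 by blast+
  have "Z = {}"
  proof (rule ccontr)
    assume ne: "Z \<noteq> {}"
    have "closed Z" unfolding Z_def by (intro continuous_on_closed_Collect_le c) auto
    moreover have bdd: "bdd_below Z" by (rule bdd_belowI[of _ 0]) (auto simp: Z_def)
    ultimately have R: "Inf Z \<in> Z" using ne by (intro closed_contains_Inf) auto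
    define R where "R = Inf Z"
    have R0: "0 \<le> R" "v1 R \<le> v2 R" using R by (auto simp: Z_def R_def)
    have lt: "v2 t < v1 t" if "0 \<le> t" "t < R" for t
      using cInf_lower[OF _ bdd, of t] that by (force simp: Z_def R_def)
    have "v2 R + (\<eta>1 - \<eta>2) \<le> v1 R"
    proof (cases "R = 0")
      case False
      \<comment> \<open>Before \<open>R\<close> the gap is at least its initial value; continuity
        carries the bound to \<open>R\<close> itself.\<close>
      have cR: "continuous_on {0..R} (\<lambda>t. v1 t - v2 t)"
        by (intro continuous_intros continuous_on_subset[OF c(1)] continuous_on_subset[OF c(2)]) auto
      have "\<eta>1 - \<eta>2 \<le> v1 t - v2 t" if "t \<in> {0..<R}" for t
        using step_v[of t t] lt that by force
      moreover have "closure {0..<R} = {0..R}" using R0 False by simp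
      ultimately have "\<eta>1 - \<eta>2 \<le> v1 R - v2 R"
        using continuous_ge_on_closure[of "{0..<R}" "\<lambda>t. v1 t - v2 t" R "\<eta>1 - \<eta>2"] cR R0 by auto
      then show ?thesis by simp
    qed (use init in simp)
    with R0 \<eta> show False by simp
  qed
  then have "\<And>t. 0 \<le> t \<Longrightarrow> v2 t \<le> v1 t" by (force simp: Z_def)
  then show "u1 r + (\<xi>2 - \<xi>1) \<le> u2 r" "v2 r + (\<eta>1 - \<eta>2) \<le> v1 r"
    using step_u[of r r] step_v[of r r] r by auto
qed

text \<open>If only the inequality for \<open>\<xi>\<close> is strict, the swapped comparison
  applies with the two solutions exchanged. Equal data are a matter of uniqueness and are treated
  separately.\<close>

lemma psol_compare':
  assumes s1: "psol \<xi>1 \<eta>1 u1 v1" and s2: "psol \<xi>2 \<eta>2 u2 v2"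
    and \<xi>: "\<xi>1 \<le> \<xi>2" and \<eta>: "\<eta>2 \<le> \<eta>1" and ne: "\<xi>1 < \<xi>2 \<or> \<eta>2 < \<eta>1" and r: "0 \<le> r"
  shows "u1 r + (\<xi>2 - \<xi>1) \<le> u2 r" "v2 r + (\<eta>1 - \<eta>2) \<le> v1 r"
  using ne psol_compare[OF s1 s2 \<xi> _ r]
    lane_emden.psol_compare[OF swap lane_sol_swap[OF s2] lane_sol_swap[OF s1] \<eta> _ r] by auto

text \<open>Integrating a bound \<open>c * exp (k * t)\<close> for the difference of the sources
  gains the factor \<open>1 / k\<close>, and \<open>R\<close> bounds \<open>\<Theta>\<close>. For
  large \<open>k\<close> this is a contraction in the weighted norm.\<close>

lemma psol_diff_exp:
  assumes s1: "psol \<xi> \<eta> u1 v1" and s2: "psol \<xi> \<eta> u2 v2"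
    and le: "\<And>t. 0 \<le> t \<Longrightarrow> t \<le> R \<Longrightarrow> \<bar>ppow p (u1 t) - ppow p (u2 t)\<bar> \<le> c * exp (k * t)"
    and k: "0 < k" and r: "0 \<le> r" "r \<le> R" and c: "0 \<le> c"
  shows "v2 r - v1 r \<le> c * R / k * exp (k * r)"
proof -
  let ?f = "\<lambda>t. v2 t - v1 t - c * R / k * exp (k * t)"
  have "?f r \<le> ?f 0"
  proof (rule deriv_nonpos_imp_antimono_real[where f = ?f])
    fix x assume x: "0 < x" "x < r"
    have "slope_v u1 x - slope_v u2 x
        = slope w (\<lambda>t. ppow p (u1 t) - ppow p (u2 t)) x"
      unfolding slope_def flux_diff[OF psol_cont_source[OF s1] psol_cont_source[OF s2]]
      by (simp add: diff_divide_distrib)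
    also have "\<dots> \<le> c * exp (k * x) * \<Theta> x"
    proof (rule slope_le)
      fix t assume t: "0 \<le> t" "t \<le> x"
      have "ppow p (u1 t) - ppow p (u2 t) \<le> c * exp (k * t)" using le[of t] t x r by auto
      also have "\<dots> \<le> c * exp (k * x)" using t k c by (intro mult_left_mono) auto
      finally show "ppow p (u1 t) - ppow p (u2 t) \<le> c * exp (k * x)" .
    qed (use x in \<open>auto intro!: continuous_intros psol_cont_source[OF s1] psol_cont_source[OF s2]\<close>)
    also have "\<dots> \<le> c * exp (k * x) * R" using Theta_le[of x] x r c by (intro mult_left_mono) auto
    finally have le0: "- slope_v u2 x - - slope_v u1 x
        - c * R / k * (exp (k * x) * k) \<le> 0"
      using k by (simp add: field_simps)
    have "(?f has_real_derivative (- slope_v u2 x - - slope_v u1 x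
        - c * R / k * (exp (k * x) * k))) (at x)"
      by (intro DERIV_diff psol_deriv[OF s1] psol_deriv[OF s2] DERIV_cmult DERIV_fun_exp)
        (use x in \<open>auto intro!: derivative_eq_intros\<close>)
    with le0 show "\<exists>D. (?f has_real_derivative D) (at x) \<and> D \<le> 0" by blast
  qed (use r k lane_emden.psol_cont[OF swap lane_sol_swap[OF s1]] lane_emden.psol_cont[OF swap lane_sol_swap[OF s2]]
      in \<open>auto intro!: continuous_intros\<close>)
  moreover have "0 \<le> c * R / k" using c r k by auto
  ultimately show ?thesis using psol_init[OF s1] psol_init[OF s2] by simp
qed

text \<open>
  Only the first solution has to be positive, because the nonlinearity satisfies a one-sided Lipschitz
  estimate at positive base points.  The norm \<open>sup e(t) exp (- k t)\<close> replaces Gronwall's inequality.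
\<close>
lemma psol_unique:
  assumes s1: "psol \<xi> \<eta> u1 v1" and s2: "psol \<xi> \<eta> u2 v2"
    and pos: "\<And>t. 0 \<le> t \<Longrightarrow> t \<le> R \<Longrightarrow> 0 < u1 t \<and> 0 < v1 t" and r: "0 \<le> r" "r \<le> R"
  shows "u2 r = u1 r \<and> v2 r = v1 r"
proof -
  have R: "0 \<le> R" using r by simp
  \<comment> \<open>Both components of the first solution decrease, so their values at
    \<open>R\<close> are their minima on \<open>{0..R}\<close>.\<close>
  define d where "d = min (u1 R) (v1 R)"
  define M where "M = max \<xi> \<eta>"
  have d: "0 < d" using pos[of R] R by (auto simp: d_def)
  have bd: "d \<le> u1 t" "d \<le> v1 t" "u1 t \<le> M" "v1 t \<le> M" "u2 t \<le> M" "v2 t \<le> M" if "0 \<le> t" "t \<le> R" for t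
    using psol_antimono[OF s1 that] lane_emden.psol_antimono[OF swap lane_sol_swap[OF s1] that]
      psol_le[OF s1 that(1)] psol_le'[OF s1 that(1)] psol_le[OF s2 that(1)] psol_le'[OF s2 that(1)]
    by (auto simp: d_def M_def)
  have dM: "d \<le> M" using bd(1)[of 0] bd(3)[of 0] R by simp
  obtain L1 where L1: "0 \<le> L1" "\<And>x y. d \<le> x \<Longrightarrow> x \<le> M \<Longrightarrow> y \<le> M \<Longrightarrow> \<bar>ppow p x - ppow p y\<bar> \<le> L1 * \<bar>x - y\<bar>"
    using ppow_one_sided_Lipschitz[OF p_pos d dM] by blast
  obtain L2 where L2: "0 \<le> L2" "\<And>x y. d \<le> x \<Longrightarrow> x \<le> M \<Longrightarrow> y \<le> M \<Longrightarrow> \<bar>ppow q x - ppow q y\<bar> \<le> L2 * \<bar>x - y\<bar>"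
    using ppow_one_sided_Lipschitz[OF q_pos d dM] by blast
  define L where "L = L1 + L2"
  \<comment> \<open>The two components together contribute at most
    \<open>2 * L * R / k \<le> 1 / 2\<close> times \<open>S\<close>; the summand 1 keeps
    \<open>k\<close> positive.\<close>
  define k where "k = 4 * L * R + 1"
  have L: "0 \<le> L" and k: "0 < k" using L1 L2 R by (auto simp: L_def k_def intro: add_nonneg_pos)
  define e where "e t = \<bar>u1 t - u2 t\<bar> + \<bar>v1 t - v2 t\<bar>" for t
  have "continuous_on {0..R} (\<lambda>t. e t * exp (- k * t))" unfolding e_def
    by (intro continuous_intros psol_cont[OF s1] psol_cont[OF s2]
        lane_emden.psol_cont[OF swap lane_sol_swap[OF s1]] lane_emden.psol_cont[OF swap lane_sol_swap[OF s2]]) auto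
  then obtain t0 where t0: "t0 \<in> {0..R}" "\<And>t. t \<in> {0..R} \<Longrightarrow> e t * exp (- k * t) \<le> e t0 * exp (- k * t0)"
    using continuous_attains_sup[of "{0..R}" "\<lambda>t. e t * exp (- k * t)"] R by auto
  define S where "S = e t0 * exp (- k * t0)"
  have S0: "0 \<le> S" by (auto simp: S_def e_def)
  have eS: "e t \<le> S * exp (k * t)" if "0 \<le> t" "t \<le> R" for t
    using t0(2)[of t] that by (auto simp: S_def exp_minus field_simps)
  have srcp: "\<bar>ppow p (u1 t) - ppow p (u2 t)\<bar> \<le> (L * S) * exp (k * t)"
    and srcq: "\<bar>ppow q (v1 t) - ppow q (v2 t)\<bar> \<le> (L * S) * exp (k * t)" if "0 \<le> t" "t \<le> R" for t
  proof -
    have "L * e t \<le> L * (S * exp (k * t))" using eS[OF that] L by (rule mult_left_mono)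
    moreover have "\<bar>ppow p (u1 t) - ppow p (u2 t)\<bar> \<le> L1 * \<bar>u1 t - u2 t\<bar>"
        "\<bar>ppow q (v1 t) - ppow q (v2 t)\<bar> \<le> L2 * \<bar>v1 t - v2 t\<bar>"
      using L1(2) L2(2) bd[OF that] by auto
    moreover have "L1 * \<bar>u1 t - u2 t\<bar> \<le> L * e t" "L2 * \<bar>v1 t - v2 t\<bar> \<le> L * e t"
      unfolding L_def e_def by (intro mult_mono; use L1 L2 in auto)+
    ultimately show "\<bar>ppow p (u1 t) - ppow p (u2 t)\<bar> \<le> (L * S) * exp (k * t)"
      "\<bar>ppow q (v1 t) - ppow q (v2 t)\<bar> \<le> (L * S) * exp (k * t)" by (auto simp: mult.assoc)
  qed
  have srcp': "\<bar>ppow p (u2 t) - ppow p (u1 t)\<bar> \<le> (L * S) * exp (k * t)"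
    and srcq': "\<bar>ppow q (v2 t) - ppow q (v1 t)\<bar> \<le> (L * S) * exp (k * t)" if "0 \<le> t" "t \<le> R" for t
    using srcp[OF that] srcq[OF that] by (auto simp: abs_minus_commute)
  have LS: "0 \<le> L * S" using L S0 by simp
  have e_le: "e t \<le> 2 * (L * S * R / k * exp (k * t))" if t: "0 \<le> t" "t \<le> R" for t
  proof -
    define K where "K = L * S * R / k * exp (k * t)"
    have "v2 t - v1 t \<le> K" unfolding K_def by (rule psol_diff_exp[OF s1 s2 srcp k t LS])
    moreover have "v1 t - v2 t \<le> K" unfolding K_def by (rule psol_diff_exp[OF s2 s1 srcp' k t LS])
    moreover have "u2 t - u1 t \<le> K" unfolding K_def
      by (rule lane_emden.psol_diff_exp[OF swap lane_sol_swap[OF s1] lane_sol_swap[OF s2] srcq k t LS])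
    moreover have "u1 t - u2 t \<le> K" unfolding K_def
      by (rule lane_emden.psol_diff_exp[OF swap lane_sol_swap[OF s2] lane_sol_swap[OF s1] srcq' k t LS])
    ultimately have "e t \<le> 2 * K" unfolding e_def by linarith
    then show ?thesis by (simp add: K_def)
  qed
  have "S \<le> 2 * (L * S * R / k * exp (k * t0)) * exp (- k * t0)"
    by (subst (1) S_def) (intro mult_right_mono e_le, use t0(1) in auto)
  also have "\<dots> = (2 * L * R / k) * S" by (simp add: exp_minus field_simps)
  also have "\<dots> \<le> (1 / 2) * S" by (intro mult_right_mono S0) (use k in \<open>simp add: k_def field_simps\<close>)
  finally have "S = 0" using S0 by simp
  then have "e r \<le> 0" using eS[OF r] by simp
  then show ?thesis by (auto simp: e_def)
qed

section \<open>Existence and monotone limits\<close>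

text \<open>Dominated convergence twice, first for the flux and then for the slope, where the
  constant \<open>M * r\<close> comes from \<open>\<Theta> t \<le> r\<close>. The limit
  \<open>g\<close> is merely pointwise; the second claim is what makes limits of solutions
  continuous.\<close>

lemma slope_integral_tendsto:
  assumes f: "\<And>k. continuous_on {0..} (f k)"
    and bd: "\<And>k t. 0 \<le> t \<Longrightarrow> 0 \<le> f k t \<and> f k t \<le> M"
    and lim: "\<And>t. 0 \<le> t \<Longrightarrow> (\<lambda>k. f k t) \<longlonglongrightarrow> g t"
  shows "0 \<le> r \<Longrightarrow> (\<lambda>k. integral {0..r} (slope w (f k))) \<longlonglongrightarrow> integral {0..r} (slope w g)"
    and "continuous_on {0..} (\<lambda>r. integral {0..r} (slope w g))"
proof -
  have fc: "continuous_on {0..r} (f k)" for k r by (rule continuous_on_subset[OF f]) auto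
  have flux_lim: "(\<lambda>k. flux w (f k) s) \<longlonglongrightarrow> flux w g s" if "0 \<le> s" for s
    unfolding flux_def
  proof (rule dominated_convergence(2))
    show "(\<lambda>t. w t * f k t) integrable_on {0..s}" for k
      by (intro integrable_continuous_real wf_cont fc)
    show "(\<lambda>t. w t * M) integrable_on {0..s}"
      by (intro integrable_continuous_real wf_cont) auto
    show "norm (w t * f k t) \<le> w t * M" if "t \<in> {0..s}" for k t
      using bd[of t k] w_nonneg[of t] that by (auto simp: abs_mult intro!: mult_left_mono)
    show "(\<lambda>k. w t * f k t) \<longlonglongrightarrow> w t * g t" if "t \<in> {0..s}" for t
      using lim[of t] that by (intro tendsto_mult) auto
  qed
  have slope_lim: "(\<lambda>k. slope w (f k) s) \<longlonglongrightarrow> slope w g s" if "0 \<le> s" for s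
    unfolding slope_def divide_inverse by (intro tendsto_mult flux_lim that tendsto_const)
  have M: "0 \<le> M" using bd[of 0 0] by auto
  have dom: "slope w g integrable_on {0..r} \<and>
      (\<lambda>k. integral {0..r} (slope w (f k))) \<longlonglongrightarrow> integral {0..r} (slope w g)" for r
  proof -
    have i: "slope w (f k) integrable_on {0..r}" for k
      by (intro integrable_continuous_real slope_cont fc)
    have ii: "(\<lambda>t. M * r) integrable_on {0..r}" by (intro integrable_continuous_real) auto
    have iii: "norm (slope w (f k) t) \<le> M * r" if "t \<in> {0..r}" for k t
    proof -
      have "slope w (f k) t \<le> M * \<Theta> t" by (rule slope_le[OF fc]) (use bd that in auto)
      also have "\<dots> \<le> M * r" using Theta_le[of t] that M by (intro mult_left_mono) auto
      finally show ?thesis using slope_nonneg[OF fc, of t k] bd that by auto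
    qed
    have iv: "(\<lambda>k. slope w (f k) t) \<longlonglongrightarrow> slope w g t" if "t \<in> {0..r}" for t
      using slope_lim[of t] that by auto
    show ?thesis using dominated_convergence[OF i ii iii iv] by blast
  qed
  then show "0 \<le> r \<Longrightarrow> (\<lambda>k. integral {0..r} (slope w (f k))) \<longlonglongrightarrow> integral {0..r} (slope w g)"
    by blast
  show "continuous_on {0..} (\<lambda>r. integral {0..r} (slope w g))"
    by (rule continuous_on_atLeast) (use dom in \<open>blast intro: indefinite_integral_continuous_1\<close>)
qed

lemma psol_integral:
  assumes s: "psol \<xi> \<eta> u v" and r: "0 \<le> r"
  shows "v r = \<eta> - integral {0..r} (slope_v u)"
proof -
  have "((\<lambda>t. - slope_v u t) has_integral v r - v 0) {0..r}"
  proof (rule fundamental_theorem_of_calculus[OF r])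
    fix x assume "x \<in> {0..r}"
    then show "(v has_vector_derivative - slope_v u x) (at x within {0..r})"
      using psol_Icc[OF s, of r] unfolding lane_sol_def has_real_derivative_iff_has_vector_derivative by blast
  qed
  then have "- integral {0..r} (slope_v u) = v r - v 0"
    by (metis integral_neg integral_unique)
  then show ?thesis using psol_init[OF s] by simp
qed

lemma slope_integral_deriv:
  assumes "continuous_on {0..} f" "0 \<le> r"
  shows "((\<lambda>r. c - integral {0..r} (slope w f)) has_real_derivative - slope w f r) (at r within {0..})"
proof -
  have "continuous_on {0..r+1} f" by (rule continuous_on_subset[OF assms(1)]) auto
  then have "((\<lambda>r. c - integral {0..r} (slope w f)) has_real_derivative 0 - slope w f r) (at r within {0..r+1})"
    by (intro DERIV_diff DERIV_const integral_has_real_derivative slope_cont) (use assms in auto)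
  moreover have "at r within {0..r+1} = at r within {0..}"
    by (rule at_within_nhd[of _ "{..<r+1}"]) (use assms in auto)
  ultimately show ?thesis by simp
qed

lemma psol_intro:
  assumes "continuous_on {0..} u" "continuous_on {0..} v"
    and u: "\<And>r. 0 \<le> r \<Longrightarrow> u r = \<xi> - integral {0..r} (slope_u v)"
    and v: "\<And>r. 0 \<le> r \<Longrightarrow> v r = \<eta> - integral {0..r} (slope_v u)"
  shows "psol \<xi> \<eta> u v"
  unfolding lane_sol_def
proof (intro conjI ballI)
  fix r :: real assume r: "r \<in> {0..}"
  show "(u has_real_derivative - slope_u v r) (at r within {0..})"
    by (rule has_field_derivative_transform_within[OF slope_integral_deriv[of _ r \<xi>] zero_less_one r])
      (use r u continuous_on_ppow[OF q_pos assms(2)] in auto)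
  show "(v has_real_derivative - slope_v u r) (at r within {0..})"
    by (rule has_field_derivative_transform_within[OF slope_integral_deriv[of _ r \<eta>] zero_less_one r])
      (use r v continuous_on_ppow[OF p_pos assms(1)] in auto)
qed (use u[of 0] v[of 0] in auto)

text \<open>\<open>U\<close> is tied to \<open>V\<close> by one integral equation only, not by the
  full system. So the lemma serves both the iterates of \<open>psol_exists\<close>, where the index
  is shifted, and genuine sequences of solutions.\<close>

lemma psol_limit_component:
  assumes V: "\<And>k. continuous_on {0..} (V k)" and bd: "\<And>k t. 0 \<le> t \<Longrightarrow> V k t \<le> M"
    and lim: "\<And>t. 0 \<le> t \<Longrightarrow> (\<lambda>k. V k t) \<longlonglongrightarrow> v t" and X: "X \<longlonglongrightarrow> \<xi>"
    and U: "\<And>k t. 0 \<le> t \<Longrightarrow> U k t = X k - integral {0..t} (slope w (\<lambda>s. ppow q (V k s)))"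
    and limU: "\<And>t. 0 \<le> t \<Longrightarrow> (\<lambda>k. U k t) \<longlonglongrightarrow> u t"
  shows "continuous_on {0..} u" "\<And>r. 0 \<le> r \<Longrightarrow> u r = \<xi> - integral {0..r} (slope_u v)"
proof -
  have c: "continuous_on {0..} (\<lambda>t. ppow q (V k t))" for k by (intro continuous_on_ppow q_pos V)
  have b: "0 \<le> ppow q (V k t) \<and> ppow q (V k t) \<le> ppow q M" if "0 \<le> t" for k t
    using bd[OF that] q_pos by (auto intro: ppow_mono)
  have l: "(\<lambda>k. ppow q (V k t)) \<longlonglongrightarrow> ppow q (v t)" if "0 \<le> t" for t
    by (rule isCont_tendsto_compose[OF isCont_ppow[OF q_pos] lim[OF that]])
  note L = slope_integral_tendsto[OF c b l]
  show eq: "u r = \<xi> - integral {0..r} (slope_u v)" if "0 \<le> r" for r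
  proof (rule LIMSEQ_unique[OF limU[OF that]])
    show "(\<lambda>k. U k r) \<longlonglongrightarrow> \<xi> - integral {0..r} (slope_u v)"
      unfolding U[OF that] by (intro tendsto_diff X L(1) that)
  qed
  have "continuous_on {0..} (\<lambda>r. \<xi> - integral {0..r} (slope_u v))"
    by (intro continuous_on_diff continuous_on_const L(2))
  then show "continuous_on {0..} u" by (rule continuous_on_eq) (use eq in auto)
qed

lemma psol_limit:
  assumes s: "\<And>k. psol (X k) (Y k) (U k) (V k)" and X: "X \<longlonglongrightarrow> \<xi>" and Y: "Y \<longlonglongrightarrow> \<eta>"
    and XM: "\<And>k. X k \<le> M" and YM: "\<And>k. Y k \<le> M"
    and limU: "\<And>t. 0 \<le> t \<Longrightarrow> (\<lambda>k. U k t) \<longlonglongrightarrow> u t"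
    and limV: "\<And>t. 0 \<le> t \<Longrightarrow> (\<lambda>k. V k t) \<longlonglongrightarrow> v t"
  shows "psol \<xi> \<eta> u v"
proof -
  note sw = lane_sol_swap[OF s]
  have bd: "U k t \<le> M" "V k t \<le> M" if "0 \<le> t" for k t
    using psol_le[OF s that, of k] psol_le'[OF s that, of k] XM[of k] YM[of k] by auto
  note c = lane_sol_cont[OF s] lane_emden.lane_sol_cont[OF swap sw]
  note cu = psol_limit_component[OF c(2) bd(2) limV X lane_emden.psol_integral[OF swap sw] limU]
  note cv = lane_emden.psol_limit_component[OF swap c(1) bd(1) limU Y psol_integral[OF s] limV]
  show ?thesis by (rule psol_intro[OF cu(1) cv(1) cu(2) cv(2)])
qed

text \<open>Each half step \<open>Gu\<close>, \<open>Gv\<close> reverses order, because a larger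
  source means a faster decrease; the full step preserves it. Starting from the constant
  \<open>\<xi>\<close>, which lies above every image, \<open>U\<close> decreases and
  \<open>V\<close> increases.\<close>

lemma psol_exists: "\<exists>u v. psol \<xi> \<eta> u v"
proof -
  define Gv where "Gv u r = \<eta> - integral {0..r} (slope_v u)" for u r
  define Gu where "Gu v r = \<xi> - integral {0..r} (slope_u v)" for v r
  define U where "U = rec_nat (\<lambda>_. \<xi>) (\<lambda>_ u. Gu (Gv u))"
  have U0: "U 0 = (\<lambda>_. \<xi>)" and US: "U (Suc k) = Gu (Gv (U k))" for k by (simp_all add: U_def)
  have cp: "continuous_on {0..} u \<Longrightarrow> continuous_on {0..r} (\<lambda>t. ppow p (u t))" for u r
    by (intro continuous_on_ppow p_pos) (auto intro: continuous_on_subset)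
  have cq: "continuous_on {0..} u \<Longrightarrow> continuous_on {0..r} (\<lambda>t. ppow q (u t))" for u r
    by (intro continuous_on_ppow q_pos) (auto intro: continuous_on_subset)
  have cGv: "continuous_on {0..} (Gv u)" if "continuous_on {0..} u" for u
    unfolding Gv_def
    by (intro continuous_on_atLeast continuous_on_diff continuous_on_const indefinite_integral_continuous_1
        integrable_continuous_real slope_cont cp that)
  have cGu: "continuous_on {0..} (Gu u)" if "continuous_on {0..} u" for u
    unfolding Gu_def
    by (intro continuous_on_atLeast continuous_on_diff continuous_on_const indefinite_integral_continuous_1
        integrable_continuous_real slope_cont cq that)
  have mGv: "Gv u2 r \<le> Gv u1 r" if "continuous_on {0..} u1" "continuous_on {0..} u2"
    "\<And>t. 0 \<le> t \<Longrightarrow> u1 t \<le> u2 t" "0 \<le> r" for u1 u2 r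
  proof -
    have "integral {0..r} (slope_v u1) \<le> integral {0..r} (slope_v u2)"
      by (intro integral_le integrable_continuous_real slope_cont slope_mono cp ppow_mono p_pos that) auto
    then show ?thesis by (simp add: Gv_def)
  qed
  have mGu: "Gu u2 r \<le> Gu u1 r" if "continuous_on {0..} u1" "continuous_on {0..} u2"
    "\<And>t. 0 \<le> t \<Longrightarrow> u1 t \<le> u2 t" "0 \<le> r" for u1 u2 r
  proof -
    have "integral {0..r} (slope_u u1) \<le> integral {0..r} (slope_u u2)"
      by (intro integral_le integrable_continuous_real slope_cont slope_mono cq ppow_mono q_pos that) auto
    then show ?thesis by (simp add: Gu_def)
  qed
  have Gv_le: "Gv u r \<le> \<eta>" if "continuous_on {0..} u" "0 \<le> r" for u r
  proof -
    have "0 \<le> integral {0..r} (slope_v u)"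
      by (intro integral_nonneg integrable_continuous_real slope_cont slope_nonneg cp that) auto
    then show ?thesis by (simp add: Gv_def)
  qed
  have Gu_le: "Gu u r \<le> \<xi>" if "continuous_on {0..} u" "0 \<le> r" for u r
  proof -
    have "0 \<le> integral {0..r} (slope_u u)"
      by (intro integral_nonneg integrable_continuous_real slope_cont slope_nonneg cq that) auto
    then show ?thesis by (simp add: Gu_def)
  qed
  have cU: "continuous_on {0..} (U k)" for k
    by (induction k) (auto simp: U0 US intro: cGu cGv)
  have dec: "U (Suc k) r \<le> U k r" if "0 \<le> r" for k r
    using that
  proof (induction k arbitrary: r)
    case 0
    then show ?case using Gu_le[OF cGv[OF cU[of 0]], of r] by (simp add: US) (simp add: U0)
  next
    case (Suc k)
    have "Gu (Gv (U (Suc k))) r \<le> Gu (Gv (U k)) r"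
      by (intro mGu mGv cGv cU Suc)
    then show ?case by (simp only: US)
  qed
  define V where "V k = Gv (U k)" for k
  have cV: "continuous_on {0..} (V k)" for k unfolding V_def by (intro cGv cU)
  have inc: "V k r \<le> V (Suc k) r" if "0 \<le> r" for k r
    unfolding V_def by (intro mGv cU dec that) auto
  have Vle: "V k r \<le> \<eta>" if "0 \<le> r" for k r unfolding V_def by (intro Gv_le cU that)
  have Ule: "U k r \<le> \<xi>" if "0 \<le> r" for k r
    by (cases k) (auto simp: U0 US intro!: Gu_le cGv cU that)
  \<comment> \<open>Every \<open>V k\<close> lies below \<open>\<eta>\<close>, so one half step from
    the constant \<open>\<eta>\<close> is a lower barrier.\<close>
  have Uge: "Gu (\<lambda>_. \<eta>) r \<le> U k r" if "0 \<le> r" for k r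
  proof (cases k)
    case 0
    then show ?thesis using Gu_le[of "\<lambda>_. \<eta>" r] that by (simp add: U0)
  next
    case (Suc l)
    show ?thesis unfolding Suc US by (rule mGu) (use that cGv cU Gv_le in auto)
  qed
  have "\<exists>l. (\<lambda>k. U k r) \<longlonglongrightarrow> l" if "0 \<le> r" for r
    by (rule decseq_convergent[of "\<lambda>k. U k r" "Gu (\<lambda>_. \<eta>) r"]) (use dec Uge that in \<open>auto intro!: decseq_SucI\<close>)
  then obtain u where u: "\<And>r. 0 \<le> r \<Longrightarrow> (\<lambda>k. U k r) \<longlonglongrightarrow> u r" by metis
  have "\<exists>l. (\<lambda>k. V k r) \<longlonglongrightarrow> l" if "0 \<le> r" for r
    by (rule incseq_convergent[of "\<lambda>k. V k r" \<eta>]) (use inc Vle that in \<open>auto intro!: incseq_SucI\<close>)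
  then obtain v where v: "\<And>r. 0 \<le> r \<Longrightarrow> (\<lambda>k. V k r) \<longlonglongrightarrow> v r" by metis
  have u': "(\<lambda>k. U (Suc k) r) \<longlonglongrightarrow> u r" if "0 \<le> r" for r using u[OF that] by (rule LIMSEQ_Suc)
  have eU: "U (Suc k) t = \<xi> - integral {0..t} (slope w (\<lambda>s. ppow q (V k s)))" for k t
    by (simp add: US V_def Gu_def)
  have eV: "V k t = \<eta> - integral {0..t} (slope w (\<lambda>s. ppow p (U k s)))" for k t
    by (simp add: V_def Gv_def)
  note cu = psol_limit_component[where U = "\<lambda>k. U (Suc k)", OF cV Vle v tendsto_const[of \<xi>] eU u']
  note cv = lane_emden.psol_limit_component[where U = V, OF swap cU Ule u tendsto_const[of \<eta>] eV v]
  have "psol \<xi> \<eta> u v" by (rule psol_intro[OF cu(1) cv(1) cu(2) cv(2)])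
  then show ?thesis by blast
qed

text \<open>Sequences of data that are strictly monotone for the order ``\<open>\<xi>\<close> up, \<open>\<eta>\<close> down''.\<close>
definition approach :: "real \<Rightarrow> real \<Rightarrow> (nat \<Rightarrow> real) \<Rightarrow> (nat \<Rightarrow> real) \<Rightarrow> bool" where
  "approach \<xi> \<eta> X Y \<longleftrightarrow> X \<longlonglongrightarrow> \<xi> \<and> Y \<longlonglongrightarrow> \<eta> \<and>
    ((\<forall>i j. i < j \<longrightarrow> X i \<le> X j \<and> Y j \<le> Y i \<and> (X i < X j \<or> Y j < Y i)) \<or>
     (\<forall>i j. i < j \<longrightarrow> X j \<le> X i \<and> Y i \<le> Y j \<and> (X j < X i \<or> Y i < Y j)))"

text \<open>Strictly ordered data make \<open>psol_compare'\<close> applicable to any two members,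
  so at each radius the values form monotone bounded sequences.\<close>

lemma psol_approach:
  assumes a: "approach \<xi> \<eta> X Y" and s: "\<And>k. psol (X k) (Y k) (U k) (V k)"
  obtains u v where "psol \<xi> \<eta> u v" "\<And>t. 0 \<le> t \<Longrightarrow> (\<lambda>k. U k t) \<longlonglongrightarrow> u t"
    "\<And>t. 0 \<le> t \<Longrightarrow> (\<lambda>k. V k t) \<longlonglongrightarrow> v t"
proof -
  have X: "X \<longlonglongrightarrow> \<xi>" and Y: "Y \<longlonglongrightarrow> \<eta>" using a by (auto simp: approach_def)
  obtain B where B: "\<And>k. \<bar>X k\<bar> \<le> B" "\<And>k. \<bar>Y k\<bar> \<le> B"
  proof -
    from convergent_imp_Bseq[OF convergentI[OF X]] convergent_imp_Bseq[OF convergentI[OF Y]]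
    obtain B1 B2 where "\<And>k. \<bar>X k\<bar> \<le> B1" "\<And>k. \<bar>Y k\<bar> \<le> B2"
      unfolding Bseq_def by auto
    then show thesis by (intro that[of "max B1 B2"]) (auto intro: max.coboundedI1 max.coboundedI2)
  qed
  have cmp: "(\<forall>i j. i \<le> j \<longrightarrow> U i t \<le> U j t \<and> V j t \<le> V i t) \<or>
      (\<forall>i j. i \<le> j \<longrightarrow> U j t \<le> U i t \<and> V i t \<le> V j t)" if t: "0 \<le> t" for t
  proof -
    have one: "U i t \<le> U j t \<and> V j t \<le> V i t"
      if "X i \<le> X j" "Y j \<le> Y i" "X i < X j \<or> Y j < Y i" for i j
      using psol_compare'[OF s[of i] s[of j] that t] that by auto
    from a consider
        "\<And>i j. i < j \<Longrightarrow> X i \<le> X j \<and> Y j \<le> Y i \<and> (X i < X j \<or> Y j < Y i)"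
      | "\<And>i j. i < j \<Longrightarrow> X j \<le> X i \<and> Y i \<le> Y j \<and> (X j < X i \<or> Y i < Y j)"
      unfolding approach_def by blast
    then show ?thesis
    proof cases
      case 1
      have "U i t \<le> U j t \<and> V j t \<le> V i t" if "i \<le> j" for i j
        using 1[of i j] one[of i j] that by (cases "i = j") auto
      then show ?thesis by blast
    next
      case 2
      have "U j t \<le> U i t \<and> V i t \<le> V j t" if "i \<le> j" for i j
        using 2[of i j] one[of j i] that by (cases "i = j") auto
      then show ?thesis by blast
    qed
  qed
  have bU: "\<bar>U k t\<bar> \<le> B + ppow q B * t * t" and bV: "\<bar>V k t\<bar> \<le> B + ppow p B * t * t" if t: "0 \<le> t" for k t
  proof -
    have "0 \<le> ppow q B * t * t" "0 \<le> ppow p B * t * t" using t by auto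
    moreover have "Y k \<le> B" "X k \<le> B" "- B \<le> X k" "- B \<le> Y k" using B[of k] by (auto simp: abs_le_iff)
    moreover have "X k - ppow q B * t * t \<le> U k t" "Y k - ppow p B * t * t \<le> V k t"
      using psol_lower'[OF s[of k] \<open>Y k \<le> B\<close> t] psol_lower[OF s[of k] \<open>X k \<le> B\<close> t] by auto
    moreover have "U k t \<le> X k" "V k t \<le> Y k" using psol_le[OF s t] psol_le'[OF s t] by auto
    ultimately show "\<bar>U k t\<bar> \<le> B + ppow q B * t * t" "\<bar>V k t\<bar> \<le> B + ppow p B * t * t" by linarith+
  qed
  have "convergent (\<lambda>k. U k t)" "convergent (\<lambda>k. V k t)" if t: "0 \<le> t" for t
  proof -
    have "monoseq (\<lambda>k. U k t)" "monoseq (\<lambda>k. V k t)" using cmp[OF t] by (auto simp: monoseq_def)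
    moreover have "Bseq (\<lambda>k. U k t)" "Bseq (\<lambda>k. V k t)"
      using bU[OF t] bV[OF t] by (auto intro!: BseqI')
    ultimately show "convergent (\<lambda>k. U k t)" "convergent (\<lambda>k. V k t)"
      by (auto intro: Bseq_monoseq_convergent)
  qed
  then obtain u v where l: "\<And>t. 0 \<le> t \<Longrightarrow> (\<lambda>k. U k t) \<longlonglongrightarrow> u t" "\<And>t. 0 \<le> t \<Longrightarrow> (\<lambda>k. V k t) \<longlonglongrightarrow> v t"
    unfolding convergent_def by metis
  have "psol \<xi> \<eta> u v"
    by (rule psol_limit[OF s X Y _ _ l, of B]) (use B in \<open>auto simp: abs_le_iff\<close>)
  with l that show thesis by blast
qed

end

section \<open>Pohozaev functional and first zeros\<close>

text \<open>Existential in the solution, because uniqueness is established only up to the first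
  zero; \<open>first_vanishes_all\<close> shows that for positive data the choice does not matter.
  With exponents and data exchanged it says that \<open>v\<close> vanishes first.\<close>

definition first_vanishes :: "(real \<Rightarrow> real) \<Rightarrow> real \<Rightarrow> real \<Rightarrow> real \<Rightarrow> real \<Rightarrow> bool" where
  "first_vanishes w p q \<xi> \<eta> \<longleftrightarrow> (\<exists>u v r. lane_sol w p q {0..} \<xi> \<eta> u v \<and> 0 \<le> r \<and> u r \<le> 0 \<and> 0 < v r)"

lemma antimono_bounded_tendsto:
  fixes u :: "real \<Rightarrow> real"
  assumes mono: "\<And>r s. 0 \<le> r \<Longrightarrow> r \<le> s \<Longrightarrow> u s \<le> u r" and ge: "\<And>r. 0 \<le> r \<Longrightarrow> c \<le> u r"
  obtains l where "(u \<longlongrightarrow> l) at_top" "\<And>r. 0 \<le> r \<Longrightarrow> l \<le> u r" "c \<le> l"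
proof -
  define l where "l = Inf (u ` {0..})"
  have bdd: "bdd_below (u ` {0..})" using ge by (auto intro!: bdd_belowI)
  have le: "l \<le> u r" if "0 \<le> r" for r unfolding l_def by (rule cInf_lower[OF _ bdd]) (use that in auto)
  have "c \<le> l" unfolding l_def by (rule cInf_greatest) (use ge in auto)
  moreover have "(u \<longlongrightarrow> l) at_top"
  proof (rule order_tendstoI)
    fix a assume "a < l"
    then show "\<forall>\<^sub>F x in at_top. a < u x"
      using le by (intro eventually_at_top_linorderI[of 0]) (auto intro: less_le_trans)
  next
    fix a assume "l < a"
    then obtain r where r: "0 \<le> r" "u r < a"
      using cInf_lessD[of "u ` {0..}" a] by (auto simp: l_def)
    then show "\<forall>\<^sub>F x in at_top. u x < a"
      using mono[OF r(1)] by (intro eventually_at_top_linorderI[of r]) (auto intro: le_less_trans)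
  qed
  ultimately show thesis using that le by blast
qed

lemma mono_bounded_tail:
  fixes f :: "real \<Rightarrow> real"
  assumes mono: "\<And>r s. 0 \<le> r \<Longrightarrow> r \<le> s \<Longrightarrow> f r \<le> f s" and C: "\<And>r. 0 \<le> r \<Longrightarrow> f r \<le> C" and e: "0 < e"
  obtains R where "0 \<le> R" "\<And>r s. R \<le> r \<Longrightarrow> r \<le> s \<Longrightarrow> f s - f r < e"
proof -
  obtain l where l: "((\<lambda>r. - f r) \<longlongrightarrow> l) at_top" "\<And>r. 0 \<le> r \<Longrightarrow> l \<le> - f r"
    by (rule antimono_bounded_tendsto[of "\<lambda>r. - f r" "- C"]) (use C mono in auto)
  have "\<forall>\<^sub>F r in at_top. - f r < l + e" using l(1) e by (auto intro: order_tendstoD)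
  then obtain R where R: "\<And>r. R \<le> r \<Longrightarrow> - f r < l + e" by (auto simp: eventually_at_top_linorder)
  have "f s - f r < e" if "max R 0 \<le> r" "r \<le> s" for r s
    using R[of r] l(2)[of s] that by auto
  then show thesis by (intro that[of "max R 0"]) auto
qed

context lane_emden
begin

text \<open>Continuity at 0 already yields mass near the pole, and the rest of the integrand only
  adds to it.\<close>

lemma flux_pos:
  assumes c: "continuous_on {0..r} f" and nn: "\<And>t. 0 \<le> t \<Longrightarrow> t \<le> r \<Longrightarrow> 0 \<le> f t"
    and f0: "0 < f 0" and r: "0 < r"
  shows "0 < flux w f r"
proof -
  have "continuous (at 0 within {0..r}) f" using c r by (auto simp: continuous_on_eq_continuous_within)
  then have "\<forall>\<^sub>F t in at 0 within {0..r}. f 0 / 2 < f t"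
    using f0 by (intro order_tendstoD(1)[where y = "f 0"]) (auto simp: continuous_within)
  then obtain d where d: "0 < d" "\<And>t. t \<in> {0..r} \<Longrightarrow> t \<noteq> 0 \<Longrightarrow> dist t 0 < d \<Longrightarrow> f 0 / 2 < f t"
    unfolding eventually_at by auto
  define e where "e = min (d / 2) r"
  have e: "0 < e" "e \<le> r" "e < d" using d r by (auto simp: e_def)
  have "0 < f 0 / 2 * W e" using f0 W_pos[OF e(1)] by simp
  also have "\<dots> \<le> flux w f e"
  proof (rule flux_ge)
    show "continuous_on {0..e} f" by (rule continuous_on_subset[OF c]) (use e in auto)
    fix t assume "0 \<le> t" "t \<le> e"
    then show "f 0 / 2 \<le> f t" using d(2)[of t] e f0 by (cases "t = 0") auto
  qed
  also have "flux w f e \<le> flux w f r"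
  proof (rule deriv_nonneg_imp_mono_real[where f = "flux w f"])
    fix x assume x: "e < x" "x < r"
    show "\<exists>D. (flux w f has_real_derivative D) (at x) \<and> 0 \<le> D"
      using flux_deriv[OF c, of x] w_nonneg[of x] nn[of x] x e by (intro exI[of _ "w x * f x"]) auto
  qed (use e continuous_on_subset[OF flux_cont[OF c]] in auto)
  finally show ?thesis .
qed

lemma slope_pos:
  assumes "continuous_on {0..r} f" "\<And>t. 0 \<le> t \<Longrightarrow> t \<le> r \<Longrightarrow> 0 \<le> f t" "0 < f 0" "0 < r"
  shows "0 < slope w f r"
  unfolding slope_def using flux_pos[OF assms] w_pos[OF assms(4)] by simp

definition pohozaev :: "(real \<Rightarrow> real) \<Rightarrow> (real \<Rightarrow> real) \<Rightarrow> real \<Rightarrow> real" where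
  "pohozaev u v r =
    W r * (slope_u v r * slope_v u r
      + ppow (q + 1) (v r) / (q + 1) + ppow (p + 1) (u r) / (p + 1))
    - w r * (slope_u v r * v r / (q + 1) + slope_v u r * u r / (p + 1))"

text \<open>The divisors \<open>q + 1\<close> and \<open>p + 1\<close> in the boundary terms match
  the primitives of the powers, so all terms with the sources cancel. What survives is
  \<open>x y\<close> times a factor that \<open>key\<close> makes nonpositive.\<close>

lemma pohozaev_deriv:
  assumes s: "lane_sol w p q {0..R} \<xi> \<eta> u v" and r: "0 < r" "r < R" and pos: "0 < u r" "0 < v r"
  shows "(pohozaev u v has_real_derivative
    slope_u v r * slope_v u r *
      ((1 + 1 / (p + 1) + 1 / (q + 1)) * w r - 2 * W r * w' r / w r)) (at r)"
proof -
  note s' = lane_sol_swap[OF s]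
  define x where "x = slope_u v"
  define y where "y = slope_v u"
  have y: "(y has_real_derivative ppow p (u r) - w' r / w r * y r) (at r)" unfolding y_def
    by (rule slope_deriv[OF lane_sol_cont_source[OF s order_refl] r])
  have x: "(x has_real_derivative ppow q (v r) - w' r / w r * x r) (at r)" unfolding x_def
    by (rule slope_deriv[OF lane_emden.lane_sol_cont_source[OF swap s' order_refl] r])
  have v: "(v has_real_derivative - y r) (at r)" unfolding y_def by (rule lane_sol_deriv[OF s r])
  have u: "(u has_real_derivative - x r) (at r)" unfolding x_def by (rule lane_emden.lane_sol_deriv[OF swap s' r])
  have pow: "((\<lambda>t. ppow (a + 1) (f t)) has_real_derivative (a + 1) * ppow a (f r) * D) (at r)"
    if f: "(f has_real_derivative D) (at r)" "0 < f r" for f :: "real \<Rightarrow> real" and D a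
  proof -
    have "((\<lambda>t. f t powr (a + 1)) has_real_derivative ((a + 1) * f r powr (a + 1 - 1)) * D) (at r)"
      by (rule DERIV_chain2[OF has_real_derivative_powr f(1)]) (rule f(2))
    then have D: "((\<lambda>t. f t powr (a + 1)) has_real_derivative (a + 1) * ppow a (f r) * D) (at r)"
      using f(2) by (simp add: ppow_eq)
    have "\<forall>\<^sub>F t in nhds r. 0 < f t"
      using DERIV_isCont[OF f(1)] f(2) by (auto simp: isCont_def tendsto_at_iff_tendsto_nhds intro: order_tendstoD)
    then have ev: "\<forall>\<^sub>F t in nhds r. f t powr (a + 1) = ppow (a + 1) (f t)"
      by eventually_elim (simp add: ppow_eq)
    show ?thesis using DERIV_cong_ev[OF refl ev refl] D by blast
  qed
  have wn: "w r \<noteq> 0" using w_pos[OF r(1)] by simp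
  have pn: "p + 1 \<noteq> 0" "q + 1 \<noteq> 0" using p_pos q_pos by auto
  have up: "ppow (p + 1) (u r) = ppow p (u r) * u r" "ppow (q + 1) (v r) = ppow q (v r) * v r"
    using pos by (simp_all add: ppow_eq powr_add)
  have "(pohozaev u v has_real_derivative
     w r * (x r * y r + ppow (q + 1) (v r) / (q + 1) + ppow (p + 1) (u r) / (p + 1))
     + (((ppow q (v r) - w' r / w r * x r) * y r + (ppow p (u r) - w' r / w r * y r) * x r)
        + ((q + 1) * ppow q (v r) * (- y r)) / (q + 1) + ((p + 1) * ppow p (u r) * (- x r)) / (p + 1)) * W r
     - (w' r * (x r * v r / (q + 1) + y r * u r / (p + 1))
        + (((ppow q (v r) - w' r / w r * x r) * v r + (- y r) * x r) / (q + 1)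
          + ((ppow p (u r) - w' r / w r * y r) * u r + (- x r) * y r) / (p + 1)) * w r)) (at r)"
    unfolding pohozaev_def[abs_def] x_def[symmetric] y_def[symmetric]
    by (intro DERIV_diff DERIV_mult DERIV_add DERIV_cdivide W_deriv w_deriv x y u v pow pos r)
  moreover have "w r * (x r * y r + ppow (q + 1) (v r) / (q + 1) + ppow (p + 1) (u r) / (p + 1))
     + (((ppow q (v r) - w' r / w r * x r) * y r + (ppow p (u r) - w' r / w r * y r) * x r)
        + ((q + 1) * ppow q (v r) * (- y r)) / (q + 1) + ((p + 1) * ppow p (u r) * (- x r)) / (p + 1)) * W r
     - (w' r * (x r * v r / (q + 1) + y r * u r / (p + 1))
        + (((ppow q (v r) - w' r / w r * x r) * v r + (- y r) * x r) / (q + 1)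
          + ((ppow p (u r) - w' r / w r * y r) * u r + (- x r) * y r) / (p + 1)) * w r)
     = x r * y r * ((1 + 1 / (p + 1) + 1 / (q + 1)) * w r - 2 * W r * w' r / w r)"
    unfolding up using wn pn by (simp add: divide_simps) (simp add: algebra_simps)
  ultimately show ?thesis unfolding x_def[symmetric] y_def[symmetric] by simp
qed

lemma pohozaev_cont:
  assumes s: "lane_sol w p q {0..R} \<xi> \<eta> u v"
  shows "continuous_on {0..R} (pohozaev u v)"
proof -
  note s' = lane_sol_swap[OF s]
  have c: "continuous_on {0..R} W" by (rule continuous_on_subset[OF W_cont]) auto
  show ?thesis unfolding pohozaev_def
    by (intro continuous_on_diff continuous_on_mult continuous_on_add continuous_on_divide continuous_on_const
        c w_cont' slope_cont lane_sol_cont_source[OF s order_refl] lane_emden.lane_sol_cont_source[OF swap s' order_refl]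
        lane_sol_cont[OF s] lane_emden.lane_sol_cont[OF swap s'] continuous_on_ppow)
      (use p_pos q_pos in auto)
qed

lemma pohozaev_zero: "pohozaev u v 0 = 0"
  by (simp add: pohozaev_def w_zero)

lemma pohozaev_antimono:
  assumes s: "lane_sol w p q {0..R} \<xi> \<eta> u v"
    and pos: "\<And>t. 0 < t \<Longrightarrow> t < R \<Longrightarrow> 0 < u t \<and> 0 < v t" and rs: "0 \<le> r" "r \<le> t" "t \<le> R"
  shows "pohozaev u v t \<le> pohozaev u v r"
proof (rule deriv_nonpos_imp_antimono_real[where f = "pohozaev u v"])
  fix x assume x: "r < x" "x < t"
  then have x': "0 < x" "x < R" using rs by auto
  have nn: "0 \<le> slope_u v x" "0 \<le> slope_v u x"
    by (intro slope_nonneg lane_sol_cont_source[OF s] lane_emden.lane_sol_cont_source[OF swap lane_sol_swap[OF s]];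
        use x' in auto)+
  have "(1 + 1 / (p + 1) + 1 / (q + 1)) * w x - 2 * W x * w' x / w x \<le> 0"
    using key[OF x'(1)] w_pos[OF x'(1)] by (simp add: field_simps power2_eq_square)
  then have "slope_u v x * slope_v u x *
      ((1 + 1 / (p + 1) + 1 / (q + 1)) * w x - 2 * W x * w' x / w x) \<le> 0"
    using nn by (intro mult_nonneg_nonpos mult_nonneg_nonneg)
  then show "\<exists>D. (pohozaev u v has_real_derivative D) (at x) \<and> D \<le> 0"
    using pohozaev_deriv[OF s x'] pos[OF x'] by blast
qed (use rs continuous_on_subset[OF pohozaev_cont[OF s]] in auto)

text \<open>At a common zero only \<open>W x y\<close> remains of the functional. It is positive,
  whereas monotonicity from the value 0 at the pole makes it nonpositive.\<close>

lemma no_common_zero: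
  assumes s: "lane_sol w p q {0..R} \<xi> \<eta> u v" and init: "0 < \<xi>" "0 < \<eta>" and R: "0 < R"
    and pos: "\<And>t. 0 < t \<Longrightarrow> t < R \<Longrightarrow> 0 < u t \<and> 0 < v t" and zero: "u R = 0" "v R = 0"
  shows False
proof -
  have i: "u 0 = \<xi>" "v 0 = \<eta>" using s by (auto simp: lane_sol_def)
  have "0 < slope_u v R" "0 < slope_v u R"
    by (intro slope_pos lane_sol_cont_source[OF s] lane_emden.lane_sol_cont_source[OF swap lane_sol_swap[OF s]];
        use i init R in \<open>auto intro: ppow_pos\<close>)+
  then have "0 < pohozaev u v R" using W_pos[OF R] zero by (simp add: pohozaev_def ppow_def)
  moreover have "pohozaev u v R \<le> pohozaev u v 0" by (rule pohozaev_antimono[OF s pos]) (use R in auto)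
  ultimately show False by (simp add: pohozaev_zero)
qed

section \<open>Strict decrease, and which component vanishes first\<close>

lemma psol_slope_pos:
  assumes "psol \<xi> \<eta> u v" "0 < \<xi>" "0 < r"
  shows "0 < slope_v u r"
  by (rule slope_pos[OF psol_cont_source[OF assms(1)]])
    (use assms psol_init[OF assms(1)] in \<open>auto intro: ppow_pos\<close>)

lemma psol_strict:
  assumes s: "psol \<xi> \<eta> u v" and "0 < \<xi>" "0 \<le> r" "r < t"
  shows "v t < v r"
proof (rule DERIV_neg_imp_decreasing_open[OF assms(4)])
  fix x assume "r < x" "x < t"
  then show "\<exists>y. (v has_real_derivative y) (at x) \<and> y < 0"
    using psol_deriv[OF s, of x] psol_slope_pos[OF s, of x] assms by (intro exI[of _ "- slope_v u x"]) auto
qed (rule lane_emden.psol_cont[OF swap lane_sol_swap[OF s] assms(3)])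

lemma psol_strict':
  "psol \<xi> \<eta> u v \<Longrightarrow> 0 < \<eta> \<Longrightarrow> 0 \<le> r \<Longrightarrow> r < t \<Longrightarrow> u t < u r"
  using lane_emden.psol_strict[OF swap lane_sol_swap] .

lemma psol_antimono':
  "psol \<xi> \<eta> u v \<Longrightarrow> 0 \<le> r \<Longrightarrow> r \<le> t \<Longrightarrow> u t \<le> u r"
  using lane_emden.psol_antimono[OF swap lane_sol_swap] .

lemma psol_cont_v: "psol \<xi> \<eta> u v \<Longrightarrow> 0 \<le> a \<Longrightarrow> continuous_on {a..b} v"
  using lane_emden.psol_cont[OF swap lane_sol_swap] .

text \<open>If all three alternatives fail, \<open>u\<close> and \<open>v\<close> are nonpositive at
  exactly the same radii. The first zero of \<open>u\<close> is then a common zero, which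
  \<open>no_common_zero\<close> excludes.\<close>

lemma psol_trichotomy:
  assumes s: "psol \<xi> \<eta> u v" and init: "0 < \<xi>" "0 < \<eta>"
  shows "(\<forall>r\<ge>0. 0 < u r \<and> 0 < v r) \<or> (\<exists>r\<ge>0. u r \<le> 0 \<and> 0 < v r) \<or> (\<exists>r\<ge>0. v r \<le> 0 \<and> 0 < u r)"
proof (rule ccontr)
  assume neg: "\<not> ?thesis"
  then obtain r where r: "0 \<le> r" "u r \<le> 0" "v r \<le> 0" by force
  have iff: "u t \<le> 0 \<longleftrightarrow> v t \<le> 0" if "0 \<le> t" for t using neg that by force
  have "\<exists>x\<ge>0. x \<le> r \<and> u x = 0"
    using IVT2'[of u r 0 0] psol_cont[OF s, of 0 r] r init psol_init[OF s] by auto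
  then obtain R where R: "0 \<le> R" "u R = 0" by blast
  then have R0: "0 < R" using psol_init[OF s] init by (cases "R = 0") auto
  have pos: "0 < u t \<and> 0 < v t" if "0 \<le> t" "t < R" for t
    using psol_strict'[OF s init(2) that] R(2) iff[OF that(1)] by auto
  have "closure {0..<R} = {0..R}" using R0 by simp
  then have "0 \<le> v R"
    using continuous_ge_on_closure[of "{0..<R}" v R 0] psol_cont_v[OF s, of 0 R] pos R0 by force
  then have "v R = 0" using iff[of R] R by simp
  then show False using no_common_zero[OF psol_Icc[OF s] init R0 _ R(2)] pos by auto
qed

lemma psol_first_zero:
  assumes s: "psol \<xi> \<eta> u v" and init: "0 < \<xi>" "0 < \<eta>" and r: "0 \<le> r" "u r \<le> 0" "0 < v r"
  obtains R where "0 < R" "u R = 0" "0 < v R" "\<And>t. 0 \<le> t \<Longrightarrow> t < R \<Longrightarrow> 0 < u t \<and> 0 < v t"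
proof -
  have "\<exists>x\<ge>0. x \<le> r \<and> u x = 0"
    using IVT2'[of u r 0 0] psol_cont[OF s, of 0 r] r init psol_init[OF s] by auto
  then obtain R where R: "0 \<le> R" "R \<le> r" "u R = 0" by blast
  have v: "0 < v t" if "0 \<le> t" "t \<le> R" for t
    using psol_antimono[OF s that(1), of r] that R r by auto
  have u: "0 < u t" if "0 \<le> t" "t < R" for t
    using psol_strict'[OF s init(2) that] R(3) by auto
  show thesis
    by (rule that[of R]) (use R u v init psol_init[OF s] in \<open>auto simp: less_le\<close>)
qed

text \<open>Uniqueness before the first zero \<open>R\<close> of a given solution, extended to
  \<open>R\<close> by continuity, gives \<open>u2 R = 0 < v2 R\<close>. As \<open>u2\<close>
  decreases strictly, just beyond \<open>R\<close> it is negative with \<open>v2\<close> still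
  positive; this strict form survives small changes of the data.\<close>

lemma first_vanishes_all:
  assumes A: "first_vanishes w p q \<xi> \<eta>" and s2: "psol \<xi> \<eta> u2 v2" and init: "0 < \<xi>" "0 < \<eta>"
  obtains r where "0 \<le> r" "u2 r < 0" "0 < v2 r"
proof -
  obtain u1 v1 r1 where s1: "psol \<xi> \<eta> u1 v1" and r1: "0 \<le> r1" "u1 r1 \<le> 0" "0 < v1 r1"
    using A by (auto simp: first_vanishes_def)
  obtain R where R: "0 < R" "u1 R = 0" "0 < v1 R" and pos: "\<And>t. 0 \<le> t \<Longrightarrow> t < R \<Longrightarrow> 0 < u1 t \<and> 0 < v1 t"
    by (rule psol_first_zero[OF s1 init r1]) (rule that)
  have eq: "u2 t = u1 t \<and> v2 t = v1 t" if "0 \<le> t" "t < R" for t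
    by (rule psol_unique[OF s1 s2, of t]) (use that pos in auto)
  have cl: "closure {0..<R} = {0..R}" using R by simp
  have "u2 R - u1 R = 0" "v2 R - v1 R = 0"
    using continuous_constant_on_closure[of "{0..<R}" "\<lambda>t. u2 t - u1 t" 0 R]
      continuous_constant_on_closure[of "{0..<R}" "\<lambda>t. v2 t - v1 t" 0 R]
      continuous_on_diff[OF psol_cont[OF s2, of 0 R] psol_cont[OF s1, of 0 R]]
      continuous_on_diff[OF psol_cont_v[OF s2, of 0 R] psol_cont_v[OF s1, of 0 R]] eq R
    unfolding cl by auto
  then have uR: "u2 R = 0" and vR: "0 < v2 R" using R by auto
  have "isCont v2 R" using psol_deriv[OF s2 R(1)] by (rule DERIV_isCont)
  then have "\<forall>\<^sub>F x in at R. 0 < v2 x" using vR by (auto simp: isCont_def intro: order_tendstoD)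
  then obtain d where d: "0 < d" "\<And>x. x \<noteq> R \<Longrightarrow> dist x R < d \<Longrightarrow> 0 < v2 x"
    unfolding eventually_at by auto
  show thesis
  proof (rule that[of "R + d / 2"])
    show "u2 (R + d / 2) < 0" using psol_strict'[OF s2 init(2), of R "R + d/2"] R d uR by auto
  qed (use R d in \<open>auto simp: dist_real_def\<close>)
qed

text \<open>Both components decrease, so the one that is negative first stays negative and cannot be
  positive later.\<close>

lemma first_vanishes_exclusive:
  assumes "first_vanishes w p q \<xi> \<eta>" "first_vanishes w q p \<eta> \<xi>" "0 < \<xi>" "0 < \<eta>"
  shows False
proof -
  obtain u v where s: "psol \<xi> \<eta> u v" using psol_exists by blast
  obtain r where r: "0 \<le> r" "u r < 0" "0 < v r" using first_vanishes_all[OF assms(1) s assms(3,4)] .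
  obtain t where t: "0 \<le> t" "v t < 0" "0 < u t"
    using lane_emden.first_vanishes_all[OF swap assms(2) lane_sol_swap[OF s] assms(4,3)] .
  show False using psol_antimono'[OF s, of r t] psol_antimono[OF s, of t r] r t by (cases "r \<le> t") auto
qed

definition admits_positive :: "real \<Rightarrow> real \<Rightarrow> bool" where
  "admits_positive \<xi> \<eta> \<longleftrightarrow> (\<exists>u v. psol \<xi> \<eta> u v \<and> (\<forall>r\<ge>0. 0 < u r \<and> 0 < v r))"

lemma admits_positive_iff:
  assumes "0 < \<xi>" "0 < \<eta>"
  shows "admits_positive \<xi> \<eta> \<longleftrightarrow> \<not> first_vanishes w p q \<xi> \<eta> \<and> \<not> first_vanishes w q p \<eta> \<xi>"
proof
  assume "admits_positive \<xi> \<eta>"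
  then obtain u v where s: "psol \<xi> \<eta> u v" and pos: "\<And>r. 0 \<le> r \<Longrightarrow> 0 < u r \<and> 0 < v r"
    by (auto simp: admits_positive_def)
  show "\<not> first_vanishes w p q \<xi> \<eta> \<and> \<not> first_vanishes w q p \<eta> \<xi>"
    using first_vanishes_all[OF _ s assms] lane_emden.first_vanishes_all[OF swap _ lane_sol_swap[OF s] assms(2,1)] pos
    by (metis not_less_iff_gr_or_eq)
next
  assume n: "\<not> first_vanishes w p q \<xi> \<eta> \<and> \<not> first_vanishes w q p \<eta> \<xi>"
  obtain u v where s: "psol \<xi> \<eta> u v" using psol_exists by blast
  then show "admits_positive \<xi> \<eta>"
    using psol_trichotomy[OF s assms] n lane_sol_swap[OF s] unfolding admits_positive_def first_vanishes_def by blast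
qed

lemma psol_choice: "\<exists>U V. \<forall>k. psol (X k) (Y k) (U k) (V k)"
proof -
  have "\<forall>k. \<exists>z. psol (X k) (Y k) (fst z) (snd z)" using psol_exists by simp
  then obtain Z where "\<forall>k. psol (X k) (Y k) (fst (Z k)) (snd (Z k))" by metis
  then show ?thesis by (intro exI[of _ "\<lambda>k. fst (Z k)"] exI[of _ "\<lambda>k. snd (Z k)"])
qed

text \<open>Openness is tested along monotone sequences only, where the solutions are known to
  converge: two strict inequalities at one radius pass to an approximating solution.\<close>

lemma first_vanishes_open:
  assumes a: "approach \<xi> \<eta> X Y" and init: "0 < \<xi>" "0 < \<eta>" and A: "first_vanishes w p q \<xi> \<eta>"
  shows "\<exists>k. first_vanishes w p q (X k) (Y k)"
proof -
  obtain U V where UV: "\<And>k. psol (X k) (Y k) (U k) (V k)" using psol_choice by blast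
  obtain u v where s: "psol \<xi> \<eta> u v" and l: "\<And>t. 0 \<le> t \<Longrightarrow> (\<lambda>k. U k t) \<longlonglongrightarrow> u t"
    "\<And>t. 0 \<le> t \<Longrightarrow> (\<lambda>k. V k t) \<longlonglongrightarrow> v t"
    by (rule psol_approach[OF a UV]) (rule that)
  obtain r where r: "0 \<le> r" "u r < 0" "0 < v r" using first_vanishes_all[OF A s init] .
  have "\<forall>\<^sub>F k in sequentially. U k r < 0 \<and> 0 < V k r"
    using order_tendstoD(2)[OF l(1)[OF r(1)] r(2)] order_tendstoD(1)[OF l(2)[OF r(1)] r(3)]
    by (rule eventually_conj)
  then obtain k where "U k r < 0 \<and> 0 < V k r" by (auto dest: eventually_happens)
  then show ?thesis using UV[of k] r unfolding first_vanishes_def by (meson less_imp_le)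
qed

section \<open>The primitive of \<open>\<Theta>\<close> as a measure of decrease\<close>

abbreviation T :: "real \<Rightarrow> real" where "T r \<equiv> integral {0..r} \<Theta>"

lemma Theta_slope: "\<Theta> = slope w (\<lambda>_. 1)"
  by (simp add: slope_def[abs_def] flux_def)

lemma Theta_cont: "continuous_on {0..R} \<Theta>"
  unfolding Theta_slope by (intro slope_cont continuous_on_const)

lemma T_deriv: "0 < r \<Longrightarrow> (T has_real_derivative \<Theta> r) (at r)"
  using integral_has_real_derivative[OF Theta_cont, of r "r+1"] at_within_Icc[of r "r+1"] by auto

lemma T_cont: "0 \<le> a \<Longrightarrow> continuous_on {a..b} T"
  by (rule continuous_on_subset[OF indefinite_integral_continuous_1[OF integrable_continuous_real[OF Theta_cont], of b]]) auto

lemma T_strict_mono: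
  assumes "0 \<le> r" "r < t"
  shows "T r < T t"
proof (rule DERIV_pos_imp_increasing_open[where f = T, OF assms(2)])
  fix x assume "r < x"
  then show "\<exists>D. (T has_real_derivative D) (at x) \<and> 0 < D"
    using T_deriv[of x] Theta_pos[of x] assms by (intro exI[of _ "\<Theta> x"]) auto
qed (use T_cont assms in auto)

lemma T_mono: "0 \<le> r \<Longrightarrow> r \<le> t \<Longrightarrow> T r \<le> T t"
  using T_strict_mono[of r t] by (cases "r = t") auto

lemma psol_decrease_ge:
  assumes s: "psol \<xi> \<eta> u v" and l: "\<And>t. 0 \<le> t \<Longrightarrow> t \<le> R \<Longrightarrow> l \<le> u t" "0 \<le> l" and r: "0 \<le> r" "r \<le> R"
  shows "v R + l powr p * (T R - T r) \<le> v r"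
proof -
  let ?f = "\<lambda>t. v t + l powr p * T t"
  have "?f R \<le> ?f r"
  proof (rule deriv_nonpos_imp_antimono_real[where f = ?f])
    fix x assume x: "r < x" "x < R"
    have "l powr p * \<Theta> x \<le> slope_v u x"
    proof (rule slope_ge[OF psol_cont_source[OF s]])
      fix t assume "0 \<le> t" "t \<le> x"
      then show "l powr p \<le> ppow p (u t)"
        using ppow_mono[OF p_pos l(1)[of t]] x l(2) by (simp add: ppow_eq)
    qed (use r x in auto)
    moreover have "(?f has_real_derivative - slope_v u x + l powr p * \<Theta> x) (at x)"
      by (intro DERIV_add psol_deriv[OF s] DERIV_cmult T_deriv) (use r x in auto)
    ultimately show "\<exists>D. (?f has_real_derivative D) (at x) \<and> D \<le> 0" by force
  qed (use r in \<open>auto intro!: continuous_on_add continuous_on_mult continuous_on_const T_cont psol_cont_v[OF s]\<close>)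
  then show ?thesis by (simp add: algebra_simps)
qed

lemma psol_decrease_le:
  assumes s: "psol \<xi> \<eta> u v" and M: "\<xi> \<le> M" and r: "0 \<le> r" "r \<le> R"
  shows "v r \<le> v R + ppow p M * (T R - T r)"
proof -
  let ?f = "\<lambda>t. v t + ppow p M * T t"
  have "?f r \<le> ?f R"
  proof (rule deriv_nonneg_imp_mono_real[where f = ?f])
    fix x assume x: "r < x" "x < R"
    have "slope_v u x \<le> ppow p M * \<Theta> x"
      by (rule slope_le[OF psol_cont_source[OF s]])
        (use x r psol_le'[OF s] M in \<open>auto intro!: ppow_mono p_pos intro: order_trans\<close>)
    moreover have "(?f has_real_derivative - slope_v u x + ppow p M * \<Theta> x) (at x)"
      by (intro DERIV_add psol_deriv[OF s] DERIV_cmult T_deriv) (use r x in auto)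
    ultimately show "\<exists>D. (?f has_real_derivative D) (at x) \<and> 0 \<le> D" by force
  qed (use r in \<open>auto intro!: continuous_on_add continuous_on_mult continuous_on_const T_cont psol_cont_v[OF s]\<close>)
  then show ?thesis by (simp add: algebra_simps)
qed

lemma psol_decrease_le':
  assumes s: "psol \<xi> \<eta> u v" and M: "\<eta> \<le> M" and r: "0 \<le> r" "r \<le> R"
  shows "u r \<le> u R + ppow q M * (T R - T r)"
  using lane_emden.psol_decrease_le[OF swap lane_sol_swap[OF s] M r] .

lemma psol_decrease_ge':
  assumes s: "psol \<xi> \<eta> u v" and l: "\<And>t. 0 \<le> t \<Longrightarrow> t \<le> R \<Longrightarrow> l \<le> v t" "0 \<le> l" and r: "0 \<le> r" "r \<le> R"
  shows "u R + l powr q * (T R - T r) \<le> u r"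
  using lane_emden.psol_decrease_ge[OF swap lane_sol_swap[OF s] l r] .

text \<open>With \<open>u \<ge> l\<close>, the component \<open>v\<close> loses at least
  \<open>l powr p * T r\<close>, but it starts at \<open>\<eta>\<close> and stays positive.\<close>

lemma T_bounded_of_positive_limit:
  assumes s: "psol \<xi> \<eta> u v" and pos: "\<And>r. 0 \<le> r \<Longrightarrow> 0 < v r"
    and l: "0 < l" "\<And>r. 0 \<le> r \<Longrightarrow> l \<le> u r" and r: "0 \<le> r"
  shows "T r \<le> \<eta> / l powr p"
proof -
  have "v r + l powr p * (T r - T 0) \<le> v 0"
    by (rule psol_decrease_ge[OF s, of r l]) (use l r in auto)
  then have "l powr p * T r \<le> \<eta>" using pos[OF r] psol_init[OF s] by simp
  then show ?thesis using l(1) by (simp add: field_simps)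
qed

lemma T_tail:
  assumes C: "\<And>r. 0 \<le> r \<Longrightarrow> T r \<le> C" and e: "0 < e"
  obtains R where "0 \<le> R" "\<And>r. R \<le> r \<Longrightarrow> T r - T R < e"
proof -
  obtain R where "0 \<le> R" "\<And>r s. R \<le> r \<Longrightarrow> r \<le> s \<Longrightarrow> T s - T r < e"
    by (rule mono_bounded_tail[of T C e]) (use C e T_mono in auto)
  then show thesis by (intro that[of R]) auto
qed

text \<open>A positive limit \<open>l\<close> would make \<open>T\<close> bounded, so beyond some
  \<open>R\<close> the approximating solutions can lose at most \<open>l / 2\<close> of their first
  component. One of them still exceeds \<open>l / 2\<close> at \<open>R\<close> and hence never
  reaches zero, a contradiction.\<close>

lemma tendsto_zero_of_approach:
  assumes a: "approach \<xi> \<eta> X Y" and init: "0 < \<xi>" "0 < \<eta>"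
    and XY: "\<And>k. 0 < X k" "\<And>k. 0 < Y k" "\<And>k. first_vanishes w p q (X k) (Y k)"
    and s: "psol \<xi> \<eta> u v" and pos: "\<And>r. 0 \<le> r \<Longrightarrow> 0 < u r \<and> 0 < v r"
  shows "(u \<longlongrightarrow> 0) at_top"
proof -
  obtain l where l: "(u \<longlongrightarrow> l) at_top" "\<And>r. 0 \<le> r \<Longrightarrow> l \<le> u r" "0 \<le> l"
    by (rule antimono_bounded_tendsto[of u 0]) (use pos psol_antimono'[OF s] in \<open>auto simp: less_imp_le\<close>)
  have "l = 0"
  proof (rule ccontr)
    assume "l \<noteq> 0"
    with l have l0: "0 < l" by simp
    have Tb: "T r \<le> \<eta> / l powr p" if "0 \<le> r" for r
      by (rule T_bounded_of_positive_limit[OF s _ l0 l(2) that]) (use pos in auto)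
    obtain U V where UV: "\<And>k. psol (X k) (Y k) (U k) (V k)" using psol_choice by blast
    obtain u' v' where s': "psol \<xi> \<eta> u' v'" and lim: "\<And>t. 0 \<le> t \<Longrightarrow> (\<lambda>k. U k t) \<longlonglongrightarrow> u' t"
      by (rule psol_approach[OF a UV]) (rule that)
    have eq: "u' t = u t" if "0 \<le> t" for t
      using psol_unique[OF s s', of t t] pos that by auto
    have "bounded (range Y)" using a by (auto simp: approach_def intro: convergent_imp_bounded)
    then obtain B where B: "\<And>k. Y k \<le> B" unfolding bounded_iff by (metis abs_le_D1 rangeI real_norm_def)
    have B0: "0 < ppow q B" using XY(2)[of 0] B[of 0] by (intro ppow_pos) auto
    \<comment> \<open>Chosen so that the remaining loss \<open>ppow q B * e\<close> equals
      \<open>l / 2\<close>.\<close>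
    define e where "e = l / (2 * ppow q B)"
    have "0 < e" using l0 B0 by (simp add: e_def)
    then obtain R where R: "0 \<le> R" "\<And>r. R \<le> r \<Longrightarrow> T r - T R < e" using T_tail[OF Tb] by blast
    have "l / 2 < u' R" using l(2)[OF R(1)] eq[OF R(1)] l0 by auto
    from order_tendstoD(1)[OF lim[OF R(1)] this] obtain k where k: "l / 2 < U k R"
      by (auto dest: eventually_happens)
    have "0 < U k r" if "0 \<le> r" for r
    proof (cases "r \<le> R")
      case True
      then show ?thesis using psol_antimono'[OF UV[of k] that True] k l0 by auto
    next
      case False
      then have "ppow q B * (T r - T R) \<le> ppow q B * e" using R(2)[of r] B0 by (intro mult_left_mono) auto
      also have "\<dots> = l / 2" using B0 by (simp add: e_def)
      finally show ?thesis
        using psol_decrease_le'[OF UV[of k] B[of k] R(1), of r] False k by auto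
    qed
    moreover obtain r where "0 \<le> r" "U k r < 0" using first_vanishes_all[OF XY(3) UV XY(1) XY(2)] .
    ultimately show False by force
  qed
  then show ?thesis using l by simp
qed

end

section \<open>Threshold functions\<close>

text \<open>The shift by 2 keeps the factor of \<open>seq_dn\<close> at least one half, already at
  \<open>k = 0\<close>, so that the perturbed data stay positive.\<close>

definition seq_up :: "real \<Rightarrow> nat \<Rightarrow> real" where "seq_up s k = s * (1 + 1 / (real k + 2))"
definition seq_dn :: "real \<Rightarrow> nat \<Rightarrow> real" where "seq_dn s k = s * (1 - 1 / (real k + 2))"

lemma seq_tendsto: "seq_up s \<longlonglongrightarrow> s" "seq_dn s \<longlonglongrightarrow> s"
proof -
  have "(\<lambda>k. 1 / (real k + 2)) \<longlonglongrightarrow> 0"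
    using LIMSEQ_ignore_initial_segment[OF lim_1_over_n, of 2] by (simp add: add.commute)
  then have "(\<lambda>k. s * (1 + 1 / (real k + 2))) \<longlonglongrightarrow> s * (1 + 0)" "(\<lambda>k. s * (1 - 1 / (real k + 2))) \<longlonglongrightarrow> s * (1 - 0)"
    by (intro tendsto_intros; assumption)+
  then show "seq_up s \<longlonglongrightarrow> s" "seq_dn s \<longlonglongrightarrow> s" by (simp_all add: seq_up_def[abs_def] seq_dn_def[abs_def])
qed

lemma seq_bounds:
  assumes "0 < s"
  shows "s < seq_up s k" "seq_dn s k < s" "0 < seq_dn s k" "0 < seq_up s k"
    "i < j \<Longrightarrow> seq_up s j < seq_up s i" "i < j \<Longrightarrow> seq_dn s i < seq_dn s j"
proof -
  have "0 < 1 / (real k + 2)" "1 / (real k + 2) < 1" by (auto simp: field_simps)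
  then show "s < seq_up s k" "seq_dn s k < s" "0 < seq_dn s k" "0 < seq_up s k"
    unfolding seq_up_def seq_dn_def using assms
    by (auto simp: mult_less_cancel_left2 mult_less_cancel_left1 zero_less_mult_iff add_pos_pos)
  assume "i < j"
  then have "1 / (real j + 2) < 1 / (real i + 2)" by (intro divide_strict_left_mono) auto
  then show "seq_up s j < seq_up s i" "seq_dn s i < seq_dn s j"
    using assms by (auto simp: seq_up_def seq_dn_def)
qed

text \<open>Continuity follows from surjectivity: a monotone function with an open image has no
  jumps.\<close>

lemma increasing_bijectionI:
  assumes mono: "\<And>x y. 0 < x \<Longrightarrow> x < y \<Longrightarrow> f x < f y" and pos: "\<And>x. 0 < x \<Longrightarrow> 0 < f x"
    and surj: "\<And>y. 0 < y \<Longrightarrow> \<exists>x>0. f x = y"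
  shows "increasing_bijection f"
proof -
  have img: "f ` {0<..} = {0<..}"
  proof
    show "f ` {0<..} \<subseteq> {0<..}" using pos by auto
    show "{0<..} \<subseteq> f ` {0<..}" using surj by force
  qed
  have sm: "strict_mono_on {0<..} f" using mono by (auto simp: strict_mono_on_def)
  moreover have "continuous_on {0<..} f"
    by (rule continuous_onI_mono) (use img mono in \<open>auto simp: le_less\<close>)
  ultimately show ?thesis
    using img strict_mono_on_imp_inj_on[OF sm] by (auto simp: increasing_bijection_def bij_betw_def)
qed

context lane_emden
begin

section \<open>Monotone perturbations of the data, and data with an early zero of
  \<open>u\<close>\<close>

lemma approach_xi_up: "0 < \<xi> \<Longrightarrow> approach \<xi> \<eta> (seq_up \<xi>) (\<lambda>_. \<eta>)"
  using seq_bounds(5)[of \<xi>] by (auto simp: approach_def seq_tendsto less_imp_le)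

lemma approach_xi_dn: "0 < \<xi> \<Longrightarrow> approach \<xi> \<eta> (seq_dn \<xi>) (\<lambda>_. \<eta>)"
  using seq_bounds(6)[of \<xi>] by (auto simp: approach_def seq_tendsto less_imp_le)

lemma approach_eta_up: "0 < \<eta> \<Longrightarrow> approach \<xi> \<eta> (\<lambda>_. \<xi>) (seq_up \<eta>)"
  using seq_bounds(5)[of \<eta>] by (auto simp: approach_def seq_tendsto less_imp_le)

lemma approach_eta_dn: "0 < \<eta> \<Longrightarrow> approach \<xi> \<eta> (\<lambda>_. \<xi>) (seq_dn \<eta>)"
  using seq_bounds(6)[of \<eta>] by (auto simp: approach_def seq_tendsto less_imp_le)

lemma T_one_pos: "0 < T 1"
  using T_strict_mono[of 0 1] by simp

text \<open>Everything happens on \<open>{0..1}\<close>: by the first bound \<open>v\<close> keeps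
  at least half of \<open>\<eta>\<close> there, and by the second \<open>u\<close> then loses all of
  \<open>\<xi>\<close> by radius 1.\<close>

lemma first_vanishes_of_bounds:
  assumes init: "0 < \<xi>" "0 < \<eta>" and a: "\<xi> powr p * T 1 \<le> \<eta> / 2" and b: "\<xi> \<le> (\<eta> / 2) powr q * T 1"
  shows "first_vanishes w p q \<xi> \<eta>"
proof -
  obtain u v where s: "psol \<xi> \<eta> u v" using psol_exists by blast
  have v: "\<eta> / 2 \<le> v r" if "0 \<le> r" "r \<le> 1" for r
  proof -
    have "v 0 \<le> v r + ppow p \<xi> * (T r - T 0)" by (rule psol_decrease_le[OF s]) (use that in auto)
    then have "\<eta> \<le> v r + \<xi> powr p * T r" using psol_init[OF s] init by (simp add: ppow_eq)
    moreover have "\<xi> powr p * T r \<le> \<xi> powr p * T 1" by (intro mult_left_mono T_mono that) simp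
    ultimately show ?thesis using a by linarith
  qed
  have "u 1 + (\<eta> / 2) powr q * (T 1 - T 0) \<le> u 0"
    by (rule psol_decrease_ge'[OF s v]) (use init in auto)
  then have "u 1 \<le> 0" using b psol_init[OF s] by simp
  then show ?thesis using s v[of 1] init unfolding first_vanishes_def
    by (intro exI[of _ u] exI[of _ v] exI[of _ 1]) auto
qed

lemma first_vanishes_small:
  assumes "0 < \<eta>"
  obtains \<xi> where "0 < \<xi>" "first_vanishes w p q \<xi> \<eta>"
proof -
  \<comment> \<open>The arguments of \<open>min\<close> are the two conditions of
    \<open>first_vanishes_of_bounds\<close> solved for \<open>\<xi>\<close>.\<close>
  define \<xi> where "\<xi> = min ((\<eta> / 2) powr q * T 1) ((\<eta> / (2 * T 1)) powr (1 / p))"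
  have "0 < \<xi>" using assms T_one_pos by (auto simp: \<xi>_def)
  have "\<xi> powr p \<le> ((\<eta> / (2 * T 1)) powr (1 / p)) powr p"
    using \<open>0 < \<xi>\<close> p_pos by (intro powr_mono2) (auto simp: \<xi>_def)
  also have "\<dots> = \<eta> / (2 * T 1)" using p_pos assms T_one_pos by (simp add: powr_powr)
  finally have "\<xi> powr p * T 1 \<le> \<eta> / 2" using T_one_pos by (simp add: field_simps)
  then have "first_vanishes w p q \<xi> \<eta>" by (intro first_vanishes_of_bounds \<open>0 < \<xi>\<close> assms) (auto simp: \<xi>_def)
  with \<open>0 < \<xi>\<close> that show thesis by blast
qed

lemma first_vanishes_large:
  assumes "0 < \<xi>"
  obtains \<eta> where "0 < \<eta>" "first_vanishes w p q \<xi> \<eta>"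
proof -
  \<comment> \<open>The same two conditions, solved for \<open>\<eta>\<close>.\<close>
  define \<eta> where "\<eta> = max (2 * (\<xi> powr p * T 1)) (2 * (\<xi> / T 1) powr (1 / q))"
  have "0 < \<eta>" using assms T_one_pos by (auto simp: \<eta>_def less_max_iff_disj)
  have "\<xi> / T 1 = ((\<xi> / T 1) powr (1 / q)) powr q" using q_pos assms T_one_pos by (simp add: powr_powr)
  also have "\<dots> \<le> (\<eta> / 2) powr q" using q_pos by (intro powr_mono2) (auto simp: \<eta>_def)
  finally have "\<xi> \<le> (\<eta> / 2) powr q * T 1" using T_one_pos by (simp add: field_simps)
  then have "first_vanishes w p q \<xi> \<eta>" by (intro first_vanishes_of_bounds \<open>0 < \<eta>\<close> assms) (auto simp: \<eta>_def)
  with \<open>0 < \<eta>\<close> that show thesis by blast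
qed

lemma first_vanishes_mono:
  assumes A: "first_vanishes w p q \<xi> \<eta>" and \<xi>: "0 < \<xi>'" "\<xi>' \<le> \<xi>" and \<eta>: "0 < \<eta>" "\<eta> \<le> \<eta>'"
  shows "first_vanishes w p q \<xi>' \<eta>'"
proof (cases "\<xi>' = \<xi> \<and> \<eta>' = \<eta>")
  case False
  obtain u v r where s: "psol \<xi> \<eta> u v" and r: "0 \<le> r" "u r \<le> 0" "0 < v r"
    using A by (auto simp: first_vanishes_def)
  obtain u' v' where s': "psol \<xi>' \<eta>' u' v'" using psol_exists by blast
  have "\<xi>' < \<xi> \<or> \<eta> < \<eta>'" using False \<xi> \<eta> by auto
  from psol_compare'[OF s' s \<xi>(2) \<eta>(2) this r(1)] have "u' r \<le> 0" "0 < v' r" using r \<xi> \<eta> by auto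
  then show ?thesis using s' r(1) unfolding first_vanishes_def by blast
qed (use A in simp)

text \<open>A function of \<open>\<eta>\<close> rather than of \<open>\<xi>\<close>: its inverse
  becomes the upper bound \<open>M\<close> for positive solutions, and its swapped instance is the
  lower bound \<open>m\<close> directly.\<close>

definition threshold :: "real \<Rightarrow> real" where
  "threshold \<eta> = Sup {\<xi>. 0 < \<xi> \<and> first_vanishes w p q \<xi> \<eta>}"

text \<open>Boundedness holds because a large \<open>\<xi>\<close> makes \<open>v\<close> vanish
  first, and the two regions are disjoint.\<close>

lemma threshold_set:
  assumes "0 < \<eta>"
  shows "{\<xi>. 0 < \<xi> \<and> first_vanishes w p q \<xi> \<eta>} \<noteq> {}" "bdd_above {\<xi>. 0 < \<xi> \<and> first_vanishes w p q \<xi> \<eta>}"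
proof -
  show "{\<xi>. 0 < \<xi> \<and> first_vanishes w p q \<xi> \<eta>} \<noteq> {}" using first_vanishes_small[OF assms] by blast
  obtain x where x: "0 < x" "first_vanishes w q p \<eta> x" using lane_emden.first_vanishes_large[OF swap assms] .
  have "\<xi> \<le> x" if "0 < \<xi>" "first_vanishes w p q \<xi> \<eta>" for \<xi>
  proof (rule ccontr)
    assume "\<not> \<xi> \<le> x"
    then have "first_vanishes w q p \<eta> \<xi>" by (intro lane_emden.first_vanishes_mono[OF swap x(2) assms order_refl x(1)]) simp
    then show False using first_vanishes_exclusive that assms by blast
  qed
  then show "bdd_above {\<xi>. 0 < \<xi> \<and> first_vanishes w p q \<xi> \<eta>}" by (intro bdd_aboveI[of _ x]) auto
qed

text \<open>Openness makes the supremum unattained, and monotonicity fills in everything below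
  it.\<close>

lemma first_vanishes_iff_threshold:
  assumes "0 < \<xi>" "0 < \<eta>"
  shows "first_vanishes w p q \<xi> \<eta> \<longleftrightarrow> \<xi> < threshold \<eta>"
proof
  assume "first_vanishes w p q \<xi> \<eta>"
  then obtain k where k: "first_vanishes w p q (seq_up \<xi> k) \<eta>"
    using first_vanishes_open[OF approach_xi_up] assms by blast
  have "seq_up \<xi> k \<le> threshold \<eta>" unfolding threshold_def
    by (rule cSup_upper[OF _ threshold_set(2)]) (use k seq_bounds[of \<xi>] assms in auto)
  then show "\<xi> < threshold \<eta>" using seq_bounds(1)[OF assms(1), of k] by simp
next
  assume "\<xi> < threshold \<eta>"
  then obtain x where "0 < x" "first_vanishes w p q x \<eta>" "\<xi> < x"
    using less_cSupD[OF threshold_set(1)] assms unfolding threshold_def by blast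
  then show "first_vanishes w p q \<xi> \<eta>" using first_vanishes_mono assms by (meson less_imp_le order_refl)
qed

lemma threshold_pos: "0 < \<eta> \<Longrightarrow> 0 < threshold \<eta>"
  using first_vanishes_small[of \<eta>] first_vanishes_iff_threshold by (metis less_trans)

text \<open>Boundary data belong to neither open region: were \<open>v\<close> to vanish first at
  the threshold, it would do so for some slightly smaller \<open>\<xi>\<close> as well, where
  \<open>u\<close> vanishes first.\<close>

lemma admits_positive_threshold:
  assumes \<eta>: "0 < \<eta>"
  shows "admits_positive (threshold \<eta>) \<eta>"
  unfolding admits_positive_iff[OF threshold_pos[OF \<eta>] \<eta>]
proof
  note t = threshold_pos[OF \<eta>]
  show "\<not> first_vanishes w p q (threshold \<eta>) \<eta>" using first_vanishes_iff_threshold[OF t \<eta>] by simp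
  show "\<not> first_vanishes w q p \<eta> (threshold \<eta>)"
  proof
    assume "first_vanishes w q p \<eta> (threshold \<eta>)"
    then obtain k where k: "first_vanishes w q p \<eta> (seq_dn (threshold \<eta>) k)"
      using lane_emden.first_vanishes_open[OF swap lane_emden.approach_eta_dn[OF swap t] \<eta> t] by blast
    moreover have "first_vanishes w p q (seq_dn (threshold \<eta>) k) \<eta>"
      using first_vanishes_iff_threshold seq_bounds[OF t, of k] \<eta> by simp
    ultimately show False using first_vanishes_exclusive seq_bounds[OF t] \<eta> by blast
  qed
qed

lemma threshold_tendsto:
  assumes \<eta>: "0 < \<eta>" and s: "psol (threshold \<eta>) \<eta> u v" and pos: "\<And>r. 0 \<le> r \<Longrightarrow> 0 < u r \<and> 0 < v r"
  shows "(u \<longlongrightarrow> 0) at_top"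
proof (rule tendsto_zero_of_approach[OF approach_xi_dn[OF threshold_pos[OF \<eta>]] threshold_pos[OF \<eta>] \<eta> _ _ _ s pos])
  show "first_vanishes w p q (seq_dn (threshold \<eta>) k) \<eta>" for k
    using first_vanishes_iff_threshold seq_bounds[OF threshold_pos[OF \<eta>], of k] \<eta> by simp
qed (use seq_bounds[OF threshold_pos[OF \<eta>]] \<eta> in auto)

text \<open>\<open>psol_compare\<close> gives no gap for \<open>u\<close> when
  \<open>\<xi>1 = \<xi>2\<close>. The difference of the sources is positive at 0, so
  \<open>u2 - u1\<close> grows strictly on \<open>{0..1}\<close> and never shrinks afterwards; hence
  the radius 1 in the conclusion.\<close>

lemma psol_strict_compare:
  assumes s1: "psol \<xi>1 \<eta>1 u1 v1" and s2: "psol \<xi>2 \<eta>2 u2 v2"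
    and \<xi>: "\<xi>1 \<le> \<xi>2" and \<eta>: "0 < \<eta>2" "\<eta>2 < \<eta>1"
  obtains d where "0 < d" "\<And>r. 1 \<le> r \<Longrightarrow> u1 r + d \<le> u2 r"
proof -
  let ?D = "\<lambda>r. u2 r - u1 r"
  note c1 = lane_emden.psol_cont_source[OF swap lane_sol_swap[OF s1]]
  note c2 = lane_emden.psol_cont_source[OF swap lane_sol_swap[OF s2]]
  have le: "v2 r \<le> v1 r" if "0 \<le> r" for r using psol_compare(2)[OF s1 s2 \<xi> \<eta>(2) that] \<eta> by simp
  have "?D 0 < ?D 1"
  proof (rule DERIV_pos_imp_increasing_open[where f = ?D])
    fix x :: real assume x: "0 < x" "x < 1"
    have "0 < slope w (\<lambda>t. ppow q (v1 t) - ppow q (v2 t)) x"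
    proof (rule slope_pos)
      show "0 < ppow q (v1 0) - ppow q (v2 0)"
        using psol_init[OF s1] psol_init[OF s2] \<eta> q_pos by (simp add: ppow_eq powr_less_mono2)
    qed (use x le c1 c2 q_pos in \<open>auto intro!: continuous_on_diff ppow_mono\<close>)
    also have "\<dots> = slope_u v1 x - slope_u v2 x"
      unfolding slope_def flux_diff[OF c1 c2] by (simp add: diff_divide_distrib)
    finally have "0 < - slope_u v2 x - - slope_u v1 x" by simp
    moreover have "(?D has_real_derivative - slope_u v2 x - - slope_u v1 x) (at x)"
      by (intro DERIV_diff lane_emden.psol_deriv[OF swap lane_sol_swap[OF s1]]
          lane_emden.psol_deriv[OF swap lane_sol_swap[OF s2]] x)
    ultimately show "\<exists>y. (?D has_real_derivative y) (at x) \<and> 0 < y" by blast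
  qed (auto intro!: continuous_on_diff psol_cont[OF s1] psol_cont[OF s2])
  then have "0 < ?D 1" using psol_init[OF s1] psol_init[OF s2] \<xi> by simp
  moreover have "?D 1 \<le> ?D r" if "1 \<le> r" for r
    by (rule psol_diff_mono'[OF s1 s2, of r]) (use le that in auto)
  ultimately show thesis by (intro that[of "?D 1"]) (auto simp: algebra_simps)
qed

text \<open>At \<open>threshold \<eta>1\<close> the first component tends to 0. Raising the second
  datum lowers it by at least a fixed \<open>d\<close> from radius 1 on, so it becomes nonpositive
  while the second component stays positive.\<close>

lemma threshold_strict_mono:
  assumes \<eta>: "0 < \<eta>1" "\<eta>1 < \<eta>2"
  shows "threshold \<eta>1 < threshold \<eta>2"
proof -
  let ?x = "threshold \<eta>1"
  have x: "0 < ?x" by (rule threshold_pos[OF \<eta>(1)])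
  obtain u1 v1 where s1: "psol ?x \<eta>1 u1 v1" and pos: "\<And>r. 0 \<le> r \<Longrightarrow> 0 < u1 r \<and> 0 < v1 r"
    using admits_positive_threshold[OF \<eta>(1)] unfolding admits_positive_def by blast
  obtain u2 v2 where s2: "psol ?x \<eta>2 u2 v2" using psol_exists by blast
  obtain d where d: "0 < d" "\<And>r. 1 \<le> r \<Longrightarrow> u2 r + d \<le> u1 r"
    by (rule psol_strict_compare[OF s2 s1 order_refl \<eta>]) (rule that)
  have "\<forall>\<^sub>F r in at_top. u1 r < d"
    using threshold_tendsto[OF \<eta>(1) s1 pos] d(1) by (auto intro: order_tendstoD)
  then obtain R where R: "\<And>r. R \<le> r \<Longrightarrow> u1 r < d" by (auto simp: eventually_at_top_linorder)
  define r where "r = max R 1"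
  have "u2 r \<le> 0" and r: "0 \<le> r" using R[of r] d(2)[of r] by (auto simp: r_def)
  moreover have "0 < v2 r"
    using psol_compare(2)[OF s2 s1 order_refl \<eta>(2) r] pos[OF r] \<eta> by auto
  ultimately have "first_vanishes w p q ?x \<eta>2" using s2 unfolding first_vanishes_def by blast
  then show ?thesis using first_vanishes_iff_threshold[OF x, of \<eta>2] \<eta> by simp
qed

text \<open>Let \<open>e\<close> be the infimum of the \<open>\<eta>\<close> for which
  \<open>u\<close> vanishes first. By openness neither component vanishes at \<open>e\<close>, and
  approximation from above shows that \<open>u\<close> tends to 0. If
  \<open>threshold e < \<xi>\<close>, comparison with the positive solution at
  \<open>threshold e\<close> would keep \<open>u\<close> above the difference.\<close>

lemma threshold_surj:
  assumes \<xi>: "0 < \<xi>"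
  shows "\<exists>\<eta>>0. threshold \<eta> = \<xi>"
proof -
  define E where "E = {\<eta>. 0 < \<eta> \<and> first_vanishes w p q \<xi> \<eta>}"
  define e where "e = Inf E"
  have E: "E \<noteq> {}" using first_vanishes_large[OF \<xi>] by (auto simp: E_def)
  obtain e0 where e0: "0 < e0" "first_vanishes w q p e0 \<xi>" using lane_emden.first_vanishes_small[OF swap \<xi>] .
  have "e0 \<le> \<eta>" if "\<eta> \<in> E" for \<eta>
  proof (rule ccontr)
    assume "\<not> e0 \<le> \<eta>"
    then have "first_vanishes w q p \<eta> \<xi>" using that \<xi>
      by (intro lane_emden.first_vanishes_mono[OF swap e0(2)]) (auto simp: E_def)
    then show False using first_vanishes_exclusive that \<xi> by (auto simp: E_def)
  qed
  then have bdd: "bdd_below E" and "e0 \<le> e"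
    using E by (auto simp: e_def intro!: bdd_belowI[of E e0] cInf_greatest)
  then have e: "0 < e" using e0 by simp
  have nA: "\<not> first_vanishes w p q \<xi> e"
  proof
    assume "first_vanishes w p q \<xi> e"
    then obtain k where "first_vanishes w p q \<xi> (seq_dn e k)" using first_vanishes_open[OF approach_eta_dn[OF e] \<xi> e] by blast
    then have "e \<le> seq_dn e k" unfolding e_def[symmetric] using cInf_lower[OF _ bdd, of "seq_dn e k"] seq_bounds[OF e]
      by (auto simp: E_def e_def)
    then show False using seq_bounds(2)[OF e, of k] by simp
  qed
  have up: "first_vanishes w p q \<xi> (seq_up e k)" for k
  proof -
    obtain x where "x \<in> E" "x < seq_up e k"
      using cInf_lessD[OF E, of "seq_up e k"] seq_bounds(1)[OF e] by (auto simp: e_def)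
    then show ?thesis using first_vanishes_mono[of \<xi> x \<xi> "seq_up e k"] \<xi> by (auto simp: E_def)
  qed
  have nB: "\<not> first_vanishes w q p e \<xi>"
  proof
    assume "first_vanishes w q p e \<xi>"
    then obtain k where "first_vanishes w q p (seq_up e k) \<xi>"
      using lane_emden.first_vanishes_open[OF swap lane_emden.approach_xi_up[OF swap e] e \<xi>] by blast
    then show False using first_vanishes_exclusive[OF up] \<xi> seq_bounds[OF e] by blast
  qed
  obtain u v where s: "psol \<xi> e u v" and pos: "\<And>r. 0 \<le> r \<Longrightarrow> 0 < u r \<and> 0 < v r"
    using admits_positive_iff[OF \<xi> e] nA nB unfolding admits_positive_def by blast
  have lim: "(u \<longlongrightarrow> 0) at_top"
    by (rule tendsto_zero_of_approach[OF approach_eta_up[OF e] \<xi> e _ _ up s pos]) (use \<xi> seq_bounds[OF e] in auto)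
  have le: "threshold e \<le> \<xi>" using nA first_vanishes_iff_threshold[OF \<xi> e] by simp
  have "threshold e = \<xi>"
  proof (rule ccontr)
    assume "threshold e \<noteq> \<xi>"
    with le have lt: "threshold e < \<xi>" by simp
    obtain u' v' where s': "psol (threshold e) e u' v'" and pos': "\<And>r. 0 \<le> r \<Longrightarrow> 0 < u' r \<and> 0 < v' r"
      using admits_positive_threshold[OF e] unfolding admits_positive_def by blast
    have "\<forall>\<^sub>F r in at_top. u r < \<xi> - threshold e" using lim lt by (auto intro: order_tendstoD)
    then obtain R where R: "\<And>r. R \<le> r \<Longrightarrow> u r < \<xi> - threshold e" by (auto simp: eventually_at_top_linorder)
    have "u' (max R 0) + (\<xi> - threshold e) \<le> u (max R 0)"
      by (rule psol_compare'(1)[OF s' s le order_refl]) (use lt in auto)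
    then show False using R[of "max R 0"] pos'[of "max R 0"] by simp
  qed
  with e show ?thesis by blast
qed

lemma threshold_bij: "increasing_bijection threshold"
  by (intro increasing_bijectionI threshold_strict_mono threshold_pos threshold_surj)

text \<open>Only \<open>m \<xi> \<le> M \<xi>\<close> is claimed, because whether the interval is a
  single point depends on the integrability of \<open>\<Theta>\<close>.\<close>

lemma global_solutions_structure:
  obtains m M where "increasing_bijection m" "increasing_bijection M"
    "\<And>\<xi>. 0 < \<xi> \<Longrightarrow> 0 < m \<xi> \<and> m \<xi> \<le> M \<xi>"
    "\<And>\<xi> \<eta>. 0 < \<xi> \<Longrightarrow> 0 < \<eta> \<Longrightarrow> admits_positive \<xi> \<eta> \<longleftrightarrow> m \<xi> \<le> \<eta> \<and> \<eta> \<le> M \<xi>"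
    "\<And>\<xi> u v. 0 < \<xi> \<Longrightarrow> psol \<xi> (m \<xi>) u v \<Longrightarrow> (\<And>r. 0 \<le> r \<Longrightarrow> 0 < u r \<and> 0 < v r) \<Longrightarrow> (v \<longlongrightarrow> 0) at_top"
    "\<And>\<xi> u v. 0 < \<xi> \<Longrightarrow> psol \<xi> (M \<xi>) u v \<Longrightarrow> (\<And>r. 0 \<le> r \<Longrightarrow> 0 < u r \<and> 0 < v r) \<Longrightarrow> (u \<longlongrightarrow> 0) at_top"
proof -
  define m where "m = lane_emden.threshold w q p"
  define M where "M = inv_into {0<..} threshold"
  note m = lane_emden.threshold_bij[OF swap, folded m_def]
    lane_emden.threshold_pos[OF swap, folded m_def]
    lane_emden.first_vanishes_iff_threshold[OF swap, folded m_def]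
    lane_emden.admits_positive_threshold[OF swap, folded m_def]
  have img: "threshold ` {0<..} = {0<..}" and inj: "inj_on threshold {0<..}"
    using threshold_bij by (auto simp: increasing_bijection_def bij_betw_def)
  have M: "0 < M \<xi>" "threshold (M \<xi>) = \<xi>" if "0 < \<xi>" for \<xi>
    using inv_into_into[of \<xi> threshold "{0<..}"] f_inv_into_f[of \<xi> threshold "{0<..}"] that img
    by (auto simp: M_def)
  have MT: "M (threshold \<eta>) = \<eta>" if "0 < \<eta>" for \<eta>
    using inv_into_f_f[OF inj] that by (simp add: M_def)
  have tmono: "threshold x < threshold y \<longleftrightarrow> x < y" if "0 < x" "0 < y" for x y
    using threshold_strict_mono[of x y] threshold_strict_mono[of y x] that by (cases x y rule: linorder_cases) auto
  have bM: "increasing_bijection M"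
  proof (rule increasing_bijectionI)
    fix x y :: real assume "0 < x" "x < y"
    then show "M x < M y" using tmono[of "M x" "M y"] M[of x] M[of y] by simp
  next
    fix y :: real assume "0 < y"
    then show "\<exists>x>0. M x = y" using MT[of y] threshold_pos[of y] by blast
  qed (rule M)
  have iff: "admits_positive \<xi> \<eta> \<longleftrightarrow> m \<xi> \<le> \<eta> \<and> \<eta> \<le> M \<xi>" if "0 < \<xi>" "0 < \<eta>" for \<xi> \<eta>
    using admits_positive_iff[OF that] m(3)[OF that(2,1)] first_vanishes_iff_threshold[OF that] tmono[of "M \<xi>" \<eta>] M[OF that(1)] that
    by auto
  have mG: "admits_positive \<xi> (m \<xi>)" if "0 < \<xi>" for \<xi>
    using m(4)[OF that] unfolding admits_positive_def lane_emden.admits_positive_def[OF swap] by (meson lane_sol_swap)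
  show thesis
  proof (rule that[of m M])
    show "0 < m \<xi> \<and> m \<xi> \<le> M \<xi>" if "0 < \<xi>" for \<xi> using m(2)[OF that] mG[OF that] iff[of \<xi> "m \<xi>"] that by simp
    show "(v \<longlongrightarrow> 0) at_top"
      if "0 < \<xi>" "psol \<xi> (m \<xi>) u v" "\<And>r. 0 \<le> r \<Longrightarrow> 0 < u r \<and> 0 < v r" for \<xi> u v
      by (rule lane_emden.threshold_tendsto[OF swap that(1) lane_sol_swap[OF that(2)[unfolded m_def]]])
        (use that(3) in auto)
    show "(u \<longlongrightarrow> 0) at_top"
      if "0 < \<xi>" "psol \<xi> (M \<xi>) u v" "\<And>r. 0 \<le> r \<Longrightarrow> 0 < u r \<and> 0 < v r" for \<xi> u v
      by (rule threshold_tendsto[of "M \<xi>" u v]) (use that M in auto)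
  qed (use m bM iff in auto)
qed

section \<open>Asymptotics of positive solutions\<close>

abbreviation sigma :: real where "sigma \<equiv> 1 / (p + 1) + 1 / (q + 1)"

lemma sigma_bounds: "0 < sigma" "sigma < 1"
proof -
  show "0 < sigma" using p_pos q_pos by (intro add_pos_pos) auto
  have "p + q + 2 < (p + 1) * (q + 1)" using pq by (simp add: algebra_simps)
  then show "sigma < 1" using p_pos q_pos by (simp add: field_simps)
qed

text \<open>Equality in \<open>key\<close> at every radius, that is, the degenerate case in which
  \<open>V\<close> is affine.\<close>

definition rigid :: bool where
  "rigid \<longleftrightarrow> (\<forall>r>0. (1 + 1 / (p + 1) + 1 / (q + 1)) * (w r)\<^sup>2 = 2 * W r * w' r)"

lemma psol_slope_ge:
  assumes s: "psol \<xi> \<eta> u v" and r: "0 \<le> r"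
  shows "ppow p (u r) * \<Theta> r \<le> slope_v u r"
  by (rule slope_ge[OF psol_cont_source[OF s] _ r]) (auto intro!: ppow_mono p_pos psol_antimono'[OF s])

lemma psol_slope_ge':
  assumes s: "psol \<xi> \<eta> u v" and r: "0 \<le> r"
  shows "ppow q (v r) * \<Theta> r \<le> slope_u v r"
  using lane_emden.psol_slope_ge[OF swap lane_sol_swap[OF s] r] .

lemma psol_deriv': "psol \<xi> \<eta> u v \<Longrightarrow> 0 < r \<Longrightarrow> (u has_real_derivative - slope_u v r) (at r)"
  using lane_emden.psol_deriv[OF swap lane_sol_swap] .

lemma psol_cont_source': "psol \<xi> \<eta> u v \<Longrightarrow> continuous_on {0..r} (\<lambda>t. ppow q (v t))"
  using lane_emden.psol_cont_source[OF swap lane_sol_swap] .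

text \<open>The exponent is \<open>k = 1 / sigma\<close>: for \<open>S = v^(q+1) + u^(p+1)\<close>
  one has \<open>u \<le> S^(1/(p+1))\<close> and \<open>v \<le> S^(1/(q+1))\<close>, so
  \<open>z = u v\<close> satisfies \<open>z^k \<le> S\<close>. Integrating the resulting inequality,
  \<open>z^(1-k)\<close> grows by at least \<open>(k - 1) * T 1\<close> up to radius 1, whatever its
  initial value; so \<open>C\<close> can be chosen before the data.\<close>

lemma product_bound:
  "\<exists>C. \<forall>\<xi> \<eta> u v. psol \<xi> \<eta> u v \<longrightarrow> (\<forall>r\<ge>0. 0 < u r \<and> 0 < v r) \<longrightarrow> u 1 * v 1 \<le> C"
proof -
  define k where "k = 1 / sigma"
  have k: "1 < k" using sigma_bounds by (simp add: k_def)
  define K where "K = (k - 1) * T 1"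
  have K: "0 < K" using k T_one_pos by (simp add: K_def)
  have "u 1 * v 1 \<le> K powr (1 / (1 - k))"
    if s: "psol \<xi> \<eta> u v" and pos: "\<And>r. 0 \<le> r \<Longrightarrow> 0 < u r \<and> 0 < v r" for \<xi> \<eta> u v
  proof -
    let ?z = "\<lambda>r. u r * v r"
    let ?x = "slope_u v" and ?y = "slope_v u"
    let ?f = "\<lambda>r. ?z r powr (1 - k) - (k - 1) * T r"
    have zpos: "0 < ?z r" if "0 \<le> r" for r using pos[OF that] by simp
    have "?f 0 \<le> ?f 1"
    proof (rule deriv_nonneg_imp_mono_real[where f = ?f])
      fix r :: real assume r: "0 < r" "r < 1"
      have u: "0 < u r" and v: "0 < v r" using pos r by auto
      define S where "S = v r powr (q + 1) + u r powr (p + 1)"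
      have S: "0 < S" unfolding S_def using u v by (intro add_pos_pos) auto
      have "u r = (u r powr (p + 1)) powr (1 / (p + 1))" using p_pos u by (simp add: powr_powr)
      also have "\<dots> \<le> S powr (1 / (p + 1))" using p_pos by (intro powr_mono2) (auto simp: S_def)
      finally have uS: "u r \<le> S powr (1 / (p + 1))" .
      have "v r = (v r powr (q + 1)) powr (1 / (q + 1))" using q_pos v by (simp add: powr_powr)
      also have "\<dots> \<le> S powr (1 / (q + 1))" using q_pos by (intro powr_mono2) (auto simp: S_def)
      finally have vS: "v r \<le> S powr (1 / (q + 1))" .
      have "?z r \<le> S powr (1 / (p + 1)) * S powr (1 / (q + 1))" using uS vS u v by (intro mult_mono) auto
      also have "\<dots> = S powr sigma" by (simp add: powr_add)
      finally have "?z r powr k \<le> (S powr sigma) powr k" using k zpos[of r] r by (intro powr_mono2) auto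
      also have "\<dots> = S" using sigma_bounds S by (simp add: powr_powr k_def)
      finally have zk: "?z r powr k \<le> S" .
      have "\<Theta> r * ?z r powr k \<le> \<Theta> r * S" using zk Theta_nonneg[of r] r by (intro mult_left_mono) auto
      also have "\<dots> = (ppow q (v r) * \<Theta> r) * v r + (ppow p (u r) * \<Theta> r) * u r"
        using u v by (simp add: S_def ppow_eq powr_add algebra_simps)
      also have "\<dots> \<le> ?x r * v r + ?y r * u r"
        using psol_slope_ge[OF s, of r] psol_slope_ge'[OF s, of r] u v r by (intro add_mono mult_right_mono) auto
      finally have main: "\<Theta> r * ?z r powr k \<le> ?x r * v r + ?y r * u r" .
      have dz: "(?z has_real_derivative - ?x r * v r + - ?y r * u r) (at r)"
        by (rule DERIV_mult[OF psol_deriv'[OF s] psol_deriv[OF s]]) (use r in auto)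
      have dp: "((\<lambda>r. ?z r powr (1 - k)) has_real_derivative
          ((1 - k) * ?z r powr (1 - k - 1)) * (- ?x r * v r + - ?y r * u r)) (at r)"
        by (rule DERIV_chain2[OF has_real_derivative_powr dz]) (use zpos r in auto)
      have dT: "((\<lambda>r. (k - 1) * T r) has_real_derivative (k - 1) * \<Theta> r) (at r)"
        by (rule DERIV_cmult[OF T_deriv[OF r(1)]])
      have "a * b = 1 \<Longrightarrow> t = a * (t * b)" for a b t :: real by (simp add: mult.left_commute)
      moreover have "?z r powr (- k) * ?z r powr k = 1" using u v by (simp flip: powr_add)
      ultimately have "\<Theta> r = ?z r powr (- k) * (\<Theta> r * ?z r powr k)" by blast
      also have "\<dots> \<le> ?z r powr (- k) * (?x r * v r + ?y r * u r)" by (intro mult_left_mono main) auto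
      finally have "(k - 1) * \<Theta> r \<le> (k - 1) * (?z r powr (- k) * (?x r * v r + ?y r * u r))"
        using k by (intro mult_left_mono) auto
      then have "0 \<le> ((1 - k) * ?z r powr (1 - k - 1)) * (- ?x r * v r + - ?y r * u r) - (k - 1) * \<Theta> r"
        by (simp add: algebra_simps)
      then show "\<exists>D. (?f has_real_derivative D) (at r) \<and> 0 \<le> D"
        using DERIV_diff[OF dp dT] by blast
    next
      have "continuous_on {0..1} (\<lambda>r. ?z r powr (1 - k))"
      proof (rule continuous_on_powr)
        show "\<forall>x\<in>{0..1}. ?z x \<noteq> 0" using zpos by force
      qed (auto intro!: continuous_on_mult continuous_on_const psol_cont[OF s] psol_cont_v[OF s])
      then show "continuous_on {0..1} ?f"
        by (intro continuous_on_diff continuous_on_mult continuous_on_const T_cont) auto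
    qed auto
    then have "?z 0 powr (1 - k) \<le> ?z 1 powr (1 - k) - K" by (simp add: K_def)
    then have "K \<le> ?z 1 powr (1 - k)" using powr_ge_zero[of "?z 0" "1 - k"] by linarith
    then have "(?z 1 powr (1 - k)) powr (1 / (1 - k)) \<le> K powr (1 / (1 - k))"
      using k K by (intro powr_mono2') (auto simp: divide_nonpos_neg)
    then show ?thesis using k zpos[of 1] by (simp add: powr_powr)
  qed
  then show ?thesis by blast
qed

text \<open>If \<open>d > 1\<close>, the loss of \<open>u\<close> between radii 1 and 2 gives
  \<open>u 1 \<ge> d powr q * t \<ge> t\<close>, so \<open>d * t \<le> u 1 * v 1\<close>, which
  \<open>product_bound\<close> controls. Later \<open>d\<close> is the gap between the two
  thresholds.\<close>

lemma lower_bound_bounded: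
  "\<exists>C. \<forall>\<xi> \<eta> u v d. psol \<xi> \<eta> u v \<longrightarrow> (\<forall>r\<ge>0. 0 < u r \<and> 0 < v r) \<longrightarrow> (\<forall>r\<ge>0. d \<le> v r) \<longrightarrow> d \<le> C"
proof -
  obtain C where C: "\<And>\<xi> \<eta> u v. psol \<xi> \<eta> u v \<Longrightarrow> \<forall>r\<ge>0. 0 < u r \<and> 0 < v r \<Longrightarrow> u 1 * v 1 \<le> C"
    using product_bound by blast
  define t where "t = T 2 - T 1"
  have t: "0 < t" using T_strict_mono[of 1 2] by (simp add: t_def)
  have "d \<le> max 1 (C / t)"
    if s: "psol \<xi> \<eta> u v" and pos: "\<And>r. 0 \<le> r \<Longrightarrow> 0 < u r \<and> 0 < v r" and d: "\<And>r. 0 \<le> r \<Longrightarrow> d \<le> v r" for \<xi> \<eta> u v d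
  proof (cases "d \<le> 1")
    case False
    have "u 2 + d powr q * (T 2 - T 1) \<le> u 1" by (rule psol_decrease_ge'[OF s d]) (use False in auto)
    then have *: "d powr q * t \<le> u 1" using pos[of 2] by (simp add: t_def)
    have "d * t = 1 * t * d" by simp
    also have "\<dots> \<le> d powr q * t * d" using False t q_pos by (intro mult_right_mono ge_one_powr_ge_zero) auto
    also have "\<dots> \<le> u 1 * v 1" using * d[of 1] pos[of 1] False t by (intro mult_mono) auto
    also have "\<dots> \<le> C" using C[OF s] pos by blast
    finally show ?thesis using t by (simp add: field_simps less_max_iff_disj le_max_iff_disj)
  qed auto
  then show ?thesis by blast
qed

section \<open>Rigidity from vanishing boundary terms\<close>

lemma flux_slope: "0 \<le> r \<Longrightarrow> w r * slope w f r = flux w f r"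
  using w_pos[of r] by (cases "r = 0") (auto simp: slope_def flux_def w_zero)

text \<open>The functional starts at 0 and decreases, while it is bounded below by its boundary
  terms, which tend to 0. So it vanishes identically; as \<open>x\<close> and \<open>y\<close> are
  positive, its derivative can vanish only through equality in \<open>key\<close>.\<close>

lemma rigidI:
  assumes s: "psol \<xi> \<eta> u v" and init: "0 < \<xi>" "0 < \<eta>" and pos: "\<And>r. 0 \<le> r \<Longrightarrow> 0 < u r \<and> 0 < v r"
    and X: "((\<lambda>r. flux_u v r * v r) \<longlongrightarrow> 0) at_top"
    and Y: "((\<lambda>r. flux_v u r * u r) \<longlongrightarrow> 0) at_top"
  shows rigid
proof -
  let ?x = "slope_u v" and ?y = "slope_v u"
  have anti: "pohozaev u v t \<le> pohozaev u v r" if "0 \<le> r" "r \<le> t" for r t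
    by (rule pohozaev_antimono[OF psol_Icc[OF s, of t]]) (use pos that in auto)
  define g where "g r = - (flux_u v r * v r / (q + 1) + flux_v u r * u r / (p + 1))" for r
  have g0: "(g \<longlongrightarrow> 0) at_top"
  proof -
    have "(g \<longlongrightarrow> - (0 / (q + 1) + 0 / (p + 1))) at_top" unfolding g_def
      by (intro tendsto_minus tendsto_add tendsto_divide X Y tendsto_const) (use p_pos q_pos in auto)
    then show ?thesis by simp
  qed
  have ge: "g r \<le> pohozaev u v r" if r: "0 \<le> r" for r
  proof -
    have "0 \<le> ?x r" "0 \<le> ?y r"
      using psol_source_nonneg[OF s r] lane_emden.psol_source_nonneg[OF swap lane_sol_swap[OF s] r] by auto
    then have "0 \<le> W r * (?x r * ?y r + ppow (q + 1) (v r) / (q + 1) + ppow (p + 1) (u r) / (p + 1))"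
      using W_nonneg[OF r] p_pos q_pos by (intro mult_nonneg_nonneg add_nonneg_nonneg) auto
    moreover have "w r * (?x r * v r / (q + 1) + ?y r * u r / (p + 1)) = - g r"
      using flux_slope[OF r, of "\<lambda>t. ppow q (v t)"] flux_slope[OF r, of "\<lambda>t. ppow p (u t)"]
      by (simp add: g_def distrib_left flip: mult.assoc)
    ultimately show ?thesis unfolding pohozaev_def by linarith
  qed
  have zero: "pohozaev u v r = 0" if r: "0 \<le> r" for r
  proof -
    have "\<forall>\<^sub>F t in at_top. g t \<le> pohozaev u v r"
      using ge anti r by (intro eventually_at_top_linorderI[of r]) (meson order_trans)
    then have "0 \<le> pohozaev u v r" using tendsto_upperbound[OF g0] by simp
    moreover have "pohozaev u v r \<le> 0" using anti[of 0 r] r by (simp add: pohozaev_zero)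
    ultimately show ?thesis by simp
  qed
  show rigid unfolding rigid_def
  proof (intro allI impI)
    fix r :: real assume r: "0 < r"
    let ?e = "(1 + 1 / (p + 1) + 1 / (q + 1)) * w r - 2 * W r * w' r / w r"
    have "(pohozaev u v has_real_derivative ?x r * ?y r * ?e) (at r)"
      by (rule pohozaev_deriv[OF psol_Icc[OF s, of "r+1"]]) (use r pos in auto)
    moreover have "(pohozaev u v has_real_derivative 0) (at r)"
      by (rule has_field_derivative_transform_within[OF DERIV_const[of 0] r])
        (use zero in \<open>auto simp: dist_real_def\<close>)
    ultimately have "?x r * ?y r * ?e = 0" by (rule DERIV_unique)
    moreover have "0 < ?x r" "0 < ?y r"
      using psol_slope_pos[OF s init(1) r] lane_emden.psol_slope_pos[OF swap lane_sol_swap[OF s] init(2) r] by auto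
    ultimately have "?e = 0" by simp
    then show "(1 + 1 / (p + 1) + 1 / (q + 1)) * (w r)\<^sup>2 = 2 * W r * w' r"
      using w_pos[OF r] by (simp add: field_simps power2_eq_square)
  qed
qed

lemma rigid_Theta_deriv:
  assumes rigid and r: "0 < r"
  shows "(\<Theta> has_real_derivative (1 - sigma) / 2) (at r)"
proof -
  have "(\<Theta> has_real_derivative (w r * w r - W r * w' r) / (w r * w r)) (at r)"
    by (rule DERIV_divide[OF W_deriv[OF r] w_deriv[OF r]]) (use w_pos[OF r] in simp)
  moreover have "(w r * w r - W r * w' r) / (w r * w r) = (1 - sigma) / 2"
  proof -
    have "W r * w' r = (1 + sigma) / 2 * (w r * w r)"
      using assms unfolding rigid_def by (simp add: power2_eq_square add.assoc)
    then have "w r * w r - W r * w' r = (1 - (1 + sigma) / 2) * (w r * w r)" by (simp add: left_diff_distrib)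
    then show ?thesis using w_pos[OF r] by (simp add: field_simps)
  qed
  ultimately show ?thesis by simp
qed

text \<open>\<open>\<Theta>\<close> has a positive constant derivative, so \<open>T\<close> grows at
  least linearly.\<close>

lemma rigid_T_unbounded:
  assumes rigid and C: "\<And>r. 0 \<le> r \<Longrightarrow> T r \<le> C"
  shows False
proof -
  have Tm: "\<Theta> 1 \<le> \<Theta> r" if "1 \<le> r" for r
  proof (rule deriv_nonneg_imp_mono_real[where f = \<Theta>, OF that])
    fix x :: real assume "1 < x"
    then show "\<exists>D. (\<Theta> has_real_derivative D) (at x) \<and> 0 \<le> D"
      using rigid_Theta_deriv[OF assms(1), of x] sigma_bounds by (intro exI[of _ "(1 - sigma) / 2"]) auto
  qed (rule continuous_on_subset[OF Theta_cont[of r]], auto)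
  have lin: "T 1 - \<Theta> 1 * 1 \<le> T r - \<Theta> 1 * r" if "1 \<le> r" for r
  proof (rule deriv_nonneg_imp_mono_real[where f = "\<lambda>r. T r - \<Theta> 1 * r", OF that])
    fix x :: real assume x: "1 < x"
    have "((\<lambda>r. T r - \<Theta> 1 * r) has_real_derivative \<Theta> x - \<Theta> 1 * 1) (at x)"
      by (intro DERIV_diff DERIV_cmult T_deriv DERIV_ident) (use x in auto)
    then show "\<exists>D. ((\<lambda>r. T r - \<Theta> 1 * r) has_real_derivative D) (at x) \<and> 0 \<le> D"
      using Tm[of x] x by (intro exI[of _ "\<Theta> x - \<Theta> 1 * 1"]) auto
  qed (intro continuous_intros T_cont; simp)
  define c where "c = \<Theta> 1"
  have c: "0 < c" unfolding c_def by (rule Theta_pos) simp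
  define r where "r = max 1 ((C + c) / c)"
  have r: "(C + c) / c \<le> r" "1 \<le> r" by (auto simp: r_def)
  then have "C + c \<le> c * r" using c by (simp add: pos_divide_le_eq mult.commute)
  moreover have "T 1 - c * 1 \<le> T r - c * r" using lin[OF r(2)] by (simp add: c_def)
  ultimately show False using C[of r] T_one_pos r(2) by simp
qed

section \<open>Decay of vanishing solutions when \<open>\<Theta>\<close> is integrable\<close>

lemma psol_average_bound:
  assumes s: "psol \<xi> \<eta> u v" and r: "0 < r" "r \<le> t"
  shows "v r \<le> v t + flux_v u r / W r * (T t - T r)"
proof -
  let ?B = "\<lambda>r. flux_v u r / W r"
  \<comment> \<open>\<open>?B\<close> is the ball average of \<open>u^p\<close>; since
    \<open>u\<close> decreases, the average is at least the boundary value and hence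
    nonincreasing.\<close>
  have anti: "?B x \<le> ?B r" if x: "r \<le> x" for x
  proof (rule deriv_nonpos_imp_antimono_real[where f = ?B, OF x])
    fix y assume y: "r < y" "y < x"
    then have y0: "0 < y" using r by simp
    have "(?B has_real_derivative (w y * ppow p (u y) * W y - flux_v u y * w y) / (W y * W y)) (at y)"
      by (rule DERIV_divide[OF flux_deriv[OF psol_cont_source[OF s, of x] y0 y(2)] W_deriv[OF y0]])
        (use W_pos[OF y0] in simp)
    moreover have "ppow p (u y) * W y \<le> flux_v u y"
      by (rule flux_ge[OF psol_cont_source[OF s]]) (use y0 in \<open>auto intro!: ppow_mono p_pos psol_antimono'[OF s]\<close>)
    then have "w y * (ppow p (u y) * W y) \<le> w y * flux_v u y"
      using w_nonneg[of y] y0 by (intro mult_left_mono) auto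
    then have "(w y * ppow p (u y) * W y - flux_v u y * w y) / (W y * W y) \<le> 0"
      by (intro divide_nonpos_nonneg) (auto simp: algebra_simps)
    ultimately show "\<exists>D. (?B has_real_derivative D) (at y) \<and> D \<le> 0" by blast
  next
    show "continuous_on {r..x} ?B"
    proof (rule continuous_on_divide)
      show "continuous_on {r..x} (flux_v u)"
        by (rule continuous_on_subset[OF flux_cont[OF psol_cont_source[OF s, of x]]]) (use r in auto)
      show "continuous_on {r..x} W" by (rule continuous_on_subset[OF W_cont]) (use r in auto)
      show "\<forall>y\<in>{r..x}. W y \<noteq> 0"
      proof
        fix y assume "y \<in> {r..x}"
        then show "W y \<noteq> 0" using W_pos[of y] r by auto
      qed
    qed
  qed
  let ?f = "\<lambda>y. v y + ?B r * T y"
  have "?f r \<le> ?f t"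
  proof (rule deriv_nonneg_imp_mono_real[where f = ?f, OF r(2)])
    fix y assume y: "r < y" "y < t"
    then have y0: "0 < y" using r by simp
    have "slope_v u y = ?B y * \<Theta> y" using W_pos[OF y0] by (simp add: slope_def)
    also have "\<dots> \<le> ?B r * \<Theta> y" using anti[of y] y Theta_nonneg[of y] y0 by (intro mult_right_mono) auto
    finally have "0 \<le> - slope_v u y + ?B r * \<Theta> y" by simp
    moreover have "(?f has_real_derivative - slope_v u y + ?B r * \<Theta> y) (at y)"
      by (intro DERIV_add psol_deriv[OF s y0] DERIV_cmult T_deriv[OF y0])
    ultimately show "\<exists>D. (?f has_real_derivative D) (at y) \<and> 0 \<le> D" by blast
  next
    show "continuous_on {r..t} ?f"
      by (intro continuous_on_add continuous_on_mult continuous_on_const T_cont psol_cont_v[OF s]) (use r in auto)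
  qed
  then show ?thesis by (simp add: algebra_simps)
qed

text \<open>In \<open>psol_average_bound\<close> the factor \<open>T t - T r\<close> is the tail of
  a bounded primitive, hence at most \<open>e\<close>; letting \<open>t\<close> tend to infinity
  removes \<open>v t\<close>.\<close>

lemma eventually_small_average:
  assumes s: "psol \<xi> \<eta> u v" and v0: "(v \<longlongrightarrow> 0) at_top"
    and C: "\<And>r. 0 \<le> r \<Longrightarrow> T r \<le> C" and e: "0 < e"
  obtains R where "1 \<le> R" "\<And>r. R \<le> r \<Longrightarrow> v r \<le> e * (flux_v u r / W r)"
proof -
  obtain R where R: "0 \<le> R" "\<And>r. R \<le> r \<Longrightarrow> T r - T R < e" by (rule T_tail[OF C e]) (assumption | rule that)+
  have "v r \<le> e * (flux_v u r / W r)" if r: "max R 1 \<le> r" for r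
  proof -
    let ?B = "flux_v u r / W r"
    have B: "0 \<le> ?B" using W_nonneg[of r] r by (intro divide_nonneg_nonneg flux_nonneg psol_cont_source[OF s]) auto
    have "\<forall>\<^sub>F t in at_top. v r - ?B * e \<le> v t"
    proof (rule eventually_at_top_linorderI[of r])
      fix t assume t: "r \<le> t"
      have "T t - T r \<le> e" using R(2)[of t] T_mono[of R r] R(1) r t by auto
      then have "?B * (T t - T r) \<le> ?B * e" by (intro mult_left_mono B)
      then show "v r - ?B * e \<le> v t" using psol_average_bound[OF s, of r t] r t by auto
    qed
    then have "v r - ?B * e \<le> 0" by (intro tendsto_lowerbound[OF v0]) auto
    then show ?thesis by (simp add: mult.commute)
  qed
  then show thesis by (intro that[of "max R 1"]) auto
qed

text \<open>
  With the averages \<open>A\<close> of \<open>v\<^sup>q\<close> and \<open>B\<close> of \<open>u\<^sup>p\<close> over balls, \<open>u \<le> \<epsilon> A\<close> and \<open>v \<le> \<epsilon> B\<close> eventually.  Hence, for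
  \<open>Z = A\<^sup>p + B\<close>, the function \<open>Z W\<^bsup>p/(p+1)\<^esup>\<close> is eventually nonincreasing, which bounds \<open>W A B\<close> and
  makes the boundary terms of the Pohozaev functional vanish.
\<close>
lemma no_vanishing_solution_aux:
  assumes s: "psol \<xi> \<eta> u v" and init: "0 < \<xi>" "0 < \<eta>" and pos: "\<And>r. 0 \<le> r \<Longrightarrow> 0 < u r \<and> 0 < v r"
    and u0: "(u \<longlongrightarrow> 0) at_top" and v0: "(v \<longlongrightarrow> 0) at_top"
    and C: "\<And>r. 0 \<le> r \<Longrightarrow> T r \<le> C" and p1: "1 \<le> p"
  shows False
proof -
  note s' = lane_sol_swap[OF s]
  define A where "A r = flux_u v r / W r" for r
  define B where "B r = flux_v u r / W r" for r
  define Z where "Z r = A r powr p + B r" for r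
  note pc = psol_cont_source[OF s] psol_cont_source'[OF s]
  have Apos: "0 < A r" and Bpos: "0 < B r" if r: "0 < r" for r
    unfolding A_def B_def using W_pos[OF r]
    by (intro divide_pos_pos flux_pos pc; use r init psol_init[OF s] in \<open>auto intro: ppow_pos\<close>)+
  have Aub: "A r \<le> ppow q \<eta>" and Bub: "B r \<le> ppow p \<xi>" if r: "0 < r" for r
  proof -
    have "flux_u v r \<le> ppow q \<eta> * W r" "flux_v u r \<le> ppow p \<xi> * W r"
      by (intro flux_le pc ppow_mono q_pos p_pos psol_le[OF s] psol_le'[OF s]; simp)+
    then show "A r \<le> ppow q \<eta>" "B r \<le> ppow p \<xi>" using W_pos[OF r] by (auto simp: A_def B_def field_simps)
  qed
  define Zm where "Zm = ppow q \<eta> powr p + ppow p \<xi>"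
  \<comment> \<open>Bounds \<open>Z powr (q - 1 / p)\<close>, whose exponent is nonnegative because
    \<open>p * q > 1\<close>.\<close>
  define C1 where "C1 = Zm powr (q - 1 / p)"
  have Zpos: "0 < Z r" if "0 < r" for r using Apos[OF that] Bpos[OF that] by (auto simp: Z_def intro: add_pos_pos)
  have Zub: "Z r \<le> Zm" if "0 < r" for r
    unfolding Z_def Zm_def using Aub[OF that] Bub[OF that] Apos[OF that] p_pos by (intro add_mono powr_mono2) auto
  \<comment> \<open>With \<open>ppow\<close> the expression is continuous on both sides of 0, where
    it vanishes. Making it smaller than \<open>1 / (p + 1)\<close> leaves room for the decay
    exponent \<open>al = 1 - 1 / (p + 1)\<close>.\<close>
  have "isCont (\<lambda>e. ppow p e + p * C1 * ppow q e) 0"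
    by (intro continuous_intros isCont_ppow p_pos q_pos)
  then have "\<forall>\<^sub>F e in at 0. ppow p e + p * C1 * ppow q e < 1 / (p + 1)"
    unfolding isCont_def by (rule order_tendstoD) (use p_pos in \<open>simp add: ppow_def\<close>)
  then obtain d where d: "0 < d" "\<And>e. e \<noteq> 0 \<Longrightarrow> dist e 0 < d \<Longrightarrow> ppow p e + p * C1 * ppow q e < 1 / (p + 1)"
    unfolding eventually_at by auto
  define e where "e = d / 2"
  have e: "0 < e" "e powr p + p * C1 * e powr q < 1 / (p + 1)"
    using d(1) d(2)[of "d / 2"] by (auto simp: e_def ppow_eq)
  obtain R1 where R1: "1 \<le> R1" "\<And>r. R1 \<le> r \<Longrightarrow> v r \<le> e * B r"
    by (rule eventually_small_average[OF s v0 C e(1), folded B_def]) (assumption | rule that)+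
  obtain R2 where R2: "1 \<le> R2" "\<And>r. R2 \<le> r \<Longrightarrow> u r \<le> e * A r"
    by (rule lane_emden.eventually_small_average[OF swap s' u0 C e(1), folded A_def]) (assumption | rule that)+
  define R where "R = max R1 R2"
  \<comment> \<open>Matched to the target:
    \<open>(Z * W powr al) powr ((p + 1) / p) = W * Z powr (1 + 1 / p)\<close>, which dominates
    \<open>W * (A * B)\<close>.\<close>
  define al where "al = p / (p + 1)"
  \<comment> \<open>The left side is the derivative of \<open>Z\<close> divided by
    \<open>w / W\<close>.\<close>
  have Zstep: "p * A r powr (p - 1) * (ppow q (v r) - A r) + (ppow p (u r) - B r) \<le> - al * Z r" if r: "R \<le> r" for r
  proof -
    have r0: "0 < r" using r R1 by (simp add: R_def)
    note AB = Apos[OF r0] Bpos[OF r0]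
    have Z: "0 < Z r" "A r powr p \<le> Z r" "B r \<le> Z r" using Zpos[OF r0] AB by (auto simp: Z_def)
    have "A r = (A r powr p) powr (1 / p)" using AB p_pos by (simp add: powr_powr)
    also have "\<dots> \<le> Z r powr (1 / p)" using Z p_pos by (intro powr_mono2) auto
    finally have AZ: "A r \<le> Z r powr (1 / p)" .
    have "ppow p (u r) \<le> (e * A r) powr p"
      using R2(2)[of r] r pos[of r] r0 p_pos by (auto simp: ppow_eq R_def intro!: powr_mono2)
    also have "\<dots> = e powr p * A r powr p" using e AB by (simp add: powr_mult)
    also have "\<dots> \<le> e powr p * Z r" using Z by (intro mult_left_mono) auto
    finally have up: "ppow p (u r) \<le> e powr p * Z r" .
    have "ppow q (v r) \<le> (e * B r) powr q"
      using R1(2)[of r] r pos[of r] r0 q_pos by (auto simp: ppow_eq R_def intro!: powr_mono2)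
    also have "\<dots> = e powr q * B r powr q" using e AB by (simp add: powr_mult)
    also have "\<dots> \<le> e powr q * Z r powr q" using Z AB q_pos by (intro mult_left_mono powr_mono2) auto
    finally have vq: "ppow q (v r) \<le> e powr q * Z r powr q" .
    \<comment> \<open>Monotone in the base because \<open>1 \<le> p\<close>; smaller
      \<open>p\<close> is reduced to this case by exchanging the components.\<close>
    have "A r powr (p - 1) \<le> (Z r powr (1 / p)) powr (p - 1)" using AZ AB p1 by (intro powr_mono2) auto
    also have "\<dots> = Z r powr (1 - 1 / p)" using p_pos by (simp add: powr_powr field_simps)
    finally have "A r powr (p - 1) * ppow q (v r) \<le> Z r powr (1 - 1 / p) * (e powr q * Z r powr q)"
      using vq by (intro mult_mono) auto
    also have "\<dots> = e powr q * (Z r * Z r powr (q - 1 / p))"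
    proof -
      have "Z r powr (1 - 1 / p) * Z r powr q = Z r powr (1 + (q - 1 / p))"
        unfolding powr_add[symmetric] by (simp add: algebra_simps)
      also have "\<dots> = Z r * Z r powr (q - 1 / p)" using Z by (simp add: powr_add)
      finally show ?thesis by (simp add: algebra_simps)
    qed
    also have "\<dots> \<le> e powr q * (Z r * C1)"
    proof -
      have "0 \<le> q - 1 / p" using pq p_pos by (simp add: field_simps)
      then have "Z r powr (q - 1 / p) \<le> C1" unfolding C1_def using Z Zub[OF r0] by (intro powr_mono2) auto
      then show ?thesis using Z by (intro mult_left_mono) auto
    qed
    finally have Aq: "A r powr (p - 1) * ppow q (v r) \<le> e powr q * (Z r * C1)" .
    have App: "A r powr (p - 1) * A r = A r powr p" using AB powr_mult_base[of "A r" "p - 1"] by (simp add: mult.commute)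
    have "p * A r powr (p - 1) * (ppow q (v r) - A r) + (ppow p (u r) - B r)
      = p * (A r powr (p - 1) * ppow q (v r)) + ppow p (u r) - p * A r powr p - B r"
      by (simp add: algebra_simps flip: App)
    also have "\<dots> \<le> p * (e powr q * (Z r * C1)) + e powr p * Z r - A r powr p - B r"
    proof -
      have "p * (A r powr (p - 1) * ppow q (v r)) \<le> p * (e powr q * (Z r * C1))" using Aq p_pos by (intro mult_left_mono) auto
      moreover have "1 * A r powr p \<le> p * A r powr p" using p1 by (intro mult_right_mono) auto
      ultimately show ?thesis using up by simp
    qed
    also have "\<dots> = (e powr p + p * C1 * e powr q) * Z r - Z r" by (simp add: Z_def algebra_simps)
    also have "\<dots> \<le> 1 / (p + 1) * Z r - Z r" using e(2) Z by (intro diff_right_mono mult_right_mono) auto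
    also have "\<dots> = - al * Z r" using p_pos by (simp add: al_def field_simps)
    finally show ?thesis .
  qed
  define L where "L r = Z r * W r powr al" for r
  have RR: "1 \<le> R" using R1 by (simp add: R_def)
  \<comment> \<open>A ball average relaxes towards the boundary value of its integrand at the rate
    \<open>w / W\<close>.\<close>
  have avg: "((\<lambda>r. flux w f r / W r) has_real_derivative w r / W r * (f r - flux w f r / W r)) (at r)"
    if r: "0 < r" and f: "continuous_on {0..r+1} f" for r f
  proof -
    have "((\<lambda>r. flux w f r / W r) has_real_derivative (w r * f r * W r - flux w f r * w r) / (W r * W r)) (at r)"
      by (rule DERIV_divide[OF flux_deriv[OF f r] W_deriv[OF r]]) (use W_pos[OF r] in auto)
    then show ?thesis using W_pos[OF r] by (simp add: field_simps)
  qed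
  have dA: "(A has_real_derivative w r / W r * (ppow q (v r) - A r)) (at r)"
    and dB: "(B has_real_derivative w r / W r * (ppow p (u r) - B r)) (at r)" if r: "0 < r" for r
    using avg[OF r pc(2)] avg[OF r pc(1)] by (simp_all add: A_def[abs_def] B_def[abs_def])
  have dL: "\<exists>D. (L has_real_derivative D) (at r) \<and> (R \<le> r \<longrightarrow> D \<le> 0)" if r: "0 < r" for r
  proof -
    let ?s = "p * A r powr (p - 1) * (ppow q (v r) - A r) + (ppow p (u r) - B r)"
    have "(Z has_real_derivative p * A r powr (p - 1) * (w r / W r * (ppow q (v r) - A r))
        + w r / W r * (ppow p (u r) - B r)) (at r)" unfolding Z_def[abs_def]
      by (intro DERIV_add dB[OF r] DERIV_chain2[OF has_real_derivative_powr dA[OF r]] Apos[OF r])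
    moreover have "((\<lambda>r. W r powr al) has_real_derivative al * W r powr (al - 1) * w r) (at r)"
      by (rule DERIV_chain2[OF has_real_derivative_powr[OF W_pos[OF r]] W_deriv[OF r]])
    ultimately have D: "(L has_real_derivative (p * A r powr (p - 1) * (w r / W r * (ppow q (v r) - A r))
        + w r / W r * (ppow p (u r) - B r)) * W r powr al + al * W r powr (al - 1) * w r * Z r) (at r)" (is "(_ has_real_derivative ?D) _")
      unfolding L_def[abs_def] by (rule DERIV_mult)
    have "W r powr (al - 1) = W r powr al / W r" using W_pos[OF r] by (simp add: powr_diff)
    moreover have "(P * (g / h * x) + g / h * y) * m + al * (m / h) * g * z = g / h * m * ((P * x + y) + al * z)"
      for P g h x y m z :: real by (simp add: add_divide_distrib diff_divide_distrib distrib_left distrib_right ac_simps)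
    ultimately have eq: "?D = w r / W r * W r powr al * (?s + al * Z r)" by (simp only:)
    have "?D \<le> 0" if "R \<le> r" unfolding eq
      using Zstep[OF that] w_pos[OF r] W_pos[OF r] by (intro mult_nonneg_nonpos) auto
    with D show ?thesis by blast
  qed
  have Lle: "L r \<le> L R" if r: "R \<le> r" for r
  proof (rule deriv_nonpos_imp_antimono_real[where f = L, OF r])
    show "\<exists>D. (L has_real_derivative D) (at x) \<and> D \<le> 0" if "R < x" for x
      using dL[of x] that RR by auto
    show "continuous_on {R..r} L"
    proof (intro continuous_at_imp_continuous_on ballI)
      fix x assume "x \<in> {R..r}"
      then have "0 < x" using RR by simp
      then obtain D where "(L has_real_derivative D) (at x)" using dL by blast
      then show "isCont L x" by (rule DERIV_isCont)
    qed
  qed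
  define K where "K = L R powr ((p + 1) / p)"
  have WAB: "W r * (A r * B r) \<le> K" if r: "R \<le> r" for r
  proof -
    have r0: "0 < r" using r RR by simp
    note AB = Apos[OF r0] Bpos[OF r0]
    have Z: "0 < Z r" "A r powr p \<le> Z r" "B r \<le> Z r" using Zpos[OF r0] AB by (auto simp: Z_def)
    have "A r = (A r powr p) powr (1 / p)" using AB p_pos by (simp add: powr_powr)
    also have "\<dots> \<le> Z r powr (1 / p)" using Z p_pos by (intro powr_mono2) auto
    finally have "A r * B r \<le> Z r powr (1 / p) * Z r" using Z AB by (intro mult_mono) auto
    also have "\<dots> = Z r powr ((p + 1) / p)" using Z p_pos by (simp add: add_divide_distrib powr_add)
    finally have "W r * (A r * B r) \<le> W r * Z r powr ((p + 1) / p)" using W_pos[OF r0] by (intro mult_left_mono) auto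
    also have "\<dots> = L r powr ((p + 1) / p)"
      using W_pos[OF r0] Z p_pos by (simp add: L_def powr_mult powr_powr al_def)
    also have "\<dots> \<le> K" unfolding K_def using Lle[OF r] Z p_pos by (intro powr_mono2) (auto simp: L_def)
    finally show ?thesis .
  qed
  have K0: "0 \<le> K" by (simp add: K_def)
  \<comment> \<open>One estimate for both boundary terms: \<open>f \<le> e' * H\<close> and
    \<open>W * (F * H) \<le> K\<close> give \<open>W * F * f \<le> e' * K\<close>.\<close>
  have vanish: "((\<lambda>r. W r * F r * f r) \<longlongrightarrow> 0) at_top"
    if nn: "\<And>r. 0 < r \<Longrightarrow> 0 \<le> F r \<and> 0 \<le> f r" and WFH: "\<And>r. R \<le> r \<Longrightarrow> W r * (F r * H r) \<le> K"
      and small: "\<And>e. 0 < e \<Longrightarrow> \<exists>S. \<forall>r\<ge>S. f r \<le> e * H r" for F f H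
  proof (rule order_tendstoI)
    fix a :: real assume a: "0 < a"
    define e' where "e' = a / (K + 1)"
    have e': "0 < e'" using a K0 by (simp add: e'_def)
    then obtain S where S: "\<And>r. S \<le> r \<Longrightarrow> f r \<le> e' * H r" using small by blast
    have "W r * F r * f r < a" if r: "max S R \<le> r" for r
    proof -
      have r0: "0 < r" using r RR by simp
      have "W r * F r * f r \<le> W r * F r * (e' * H r)"
        using S[of r] r W_pos[OF r0] nn[OF r0] by (intro mult_left_mono) auto
      also have "\<dots> = e' * (W r * (F r * H r))" by (simp add: algebra_simps)
      also have "\<dots> \<le> e' * K" using WFH[of r] r e' by (intro mult_left_mono) auto
      also have "\<dots> < a" using a K0 by (simp add: e'_def field_simps)
      finally show ?thesis .
    qed
    then show "\<forall>\<^sub>F r in at_top. W r * F r * f r < a" by (intro eventually_at_top_linorderI[of "max S R"])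
  next
    fix a :: real assume a: "a < 0"
    have "0 \<le> W r * F r * f r" if "1 \<le> r" for r
      using nn[of r] W_nonneg[of r] that by (intro mult_nonneg_nonneg) auto
    then show "\<forall>\<^sub>F r in at_top. a < W r * F r * f r"
      using a by (intro eventually_at_top_linorderI[of 1]) force
  qed
  have smallv: "\<exists>S. \<forall>r\<ge>S. v r \<le> d * B r" if d: "0 < d" for d
  proof -
    obtain S where "\<And>r. S \<le> r \<Longrightarrow> v r \<le> d * B r"
      by (rule eventually_small_average[OF s v0 C d, folded B_def]) (assumption | rule that)+
    then show ?thesis by blast
  qed
  have smallu: "\<exists>S. \<forall>r\<ge>S. u r \<le> d * A r" if d: "0 < d" for d
  proof -
    obtain S where "\<And>r. S \<le> r \<Longrightarrow> u r \<le> d * A r"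
      by (rule lane_emden.eventually_small_average[OF swap s' u0 C d, folded A_def]) (assumption | rule that)+
    then show ?thesis by blast
  qed
  have nn: "0 \<le> A r \<and> 0 \<le> v r" "0 \<le> B r \<and> 0 \<le> u r" if "0 < r" for r
    using Apos[OF that] Bpos[OF that] pos[of r] that by auto
  have WBA: "W r * (B r * A r) \<le> K" if "R \<le> r" for r
    using WAB[OF that] by (simp only: mult.commute[of "B r"])
  have flux: "W r * A r = flux_u v r" "W r * B r = flux_v u r" if "1 \<le> r" for r
    using W_pos[of r] that by (simp_all add: A_def B_def)
  have "\<forall>\<^sub>F r in at_top. W r * A r * v r = flux_u v r * v r"
      "\<forall>\<^sub>F r in at_top. W r * B r * u r = flux_v u r * u r"
    by (intro eventually_at_top_linorderI[of 1]; simp only: flux)+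
  then have X: "((\<lambda>r. flux_u v r * v r) \<longlongrightarrow> 0) at_top" and Y: "((\<lambda>r. flux_v u r * u r) \<longlongrightarrow> 0) at_top"
    using vanish[OF nn(1) WAB smallv] vanish[OF nn(2) WBA smallu] tendsto_cong by fast+
  have rigid by (rule rigidI[OF s init pos X Y])
  then show False using rigid_T_unbounded C by blast
qed

text \<open>\<open>p * q > 1\<close> forces one exponent to be at least 1, and the system may be
  swapped.\<close>

lemma no_vanishing_solution:
  assumes s: "psol \<xi> \<eta> u v" and init: "0 < \<xi>" "0 < \<eta>" and pos: "\<And>r. 0 \<le> r \<Longrightarrow> 0 < u r \<and> 0 < v r"
    and u0: "(u \<longlongrightarrow> 0) at_top" and v0: "(v \<longlongrightarrow> 0) at_top"
    and C: "\<And>r. 0 \<le> r \<Longrightarrow> T r \<le> C"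
  shows False
proof (cases "1 \<le> p")
  case True
  then show ?thesis using no_vanishing_solution_aux[OF s init pos u0 v0 C] by blast
next
  case False
  have "1 \<le> q"
  proof (rule ccontr)
    assume "\<not> 1 \<le> q"
    then have "p * q \<le> 1 * 1" using False p_pos q_pos by (intro mult_mono) auto
    then show False using pq by simp
  qed
  then show ?thesis
    using lane_emden.no_vanishing_solution_aux[OF swap lane_sol_swap[OF s] init(2,1) _ v0 u0 C] pos by blast
qed

end

section \<open>Finite energy\<close>

lemma two_sqrt_le:
  fixes c t :: real
  assumes "0 \<le> c" "0 < t"
  shows "2 * sqrt c \<le> t + c / t"
proof -
  have "0 \<le> (t - sqrt c)\<^sup>2" by simp
  also have "\<dots> = t\<^sup>2 - 2 * sqrt c * t + c" using assms by (simp add: power2_diff)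
  also have "t\<^sup>2 = t * t" by (rule power2_eq_square)
  finally have "2 * sqrt c * t \<le> t * t + c" by simp
  then have "2 * sqrt c \<le> (t * t + c) / t" using assms by (simp add: le_divide_eq)
  then show ?thesis using assms by (simp add: add_divide_distrib)
qed

context lane_emden
begin

definition gradient_energy :: "(real \<Rightarrow> real) \<Rightarrow> (real \<Rightarrow> real) \<Rightarrow> real \<Rightarrow> real" where
  "gradient_energy u v r = flux w (\<lambda>t. slope_u v t * slope_v u t) r"

definition power_energy :: "real \<Rightarrow> (real \<Rightarrow> real) \<Rightarrow> real \<Rightarrow> real" where
  "power_energy a u r = flux w (\<lambda>t. ppow a (u t)) r"

lemma gradient_energy_swap: "lane_emden.gradient_energy w q p v u = gradient_energy u v"
  unfolding gradient_energy_def[abs_def] lane_emden.gradient_energy_def[OF swap, abs_def] by (simp add: mult.commute)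

lemma grad_cont: "psol \<xi> \<eta> u v \<Longrightarrow>
    continuous_on {0..R} (\<lambda>t. slope_u v t * slope_v u t)"
  by (intro continuous_on_mult slope_cont psol_cont_source psol_cont_source')

lemma pow_cont: "psol \<xi> \<eta> u v \<Longrightarrow> 0 < a \<Longrightarrow> continuous_on {0..R} (\<lambda>t. ppow a (v t))"
  by (intro continuous_on_ppow psol_cont_v) auto

lemma flux_nonneg_mono:
  assumes "\<And>R. continuous_on {0..R} f" "\<And>t. 0 \<le> t \<Longrightarrow> 0 \<le> f t" "0 \<le> r" "r \<le> s"
  shows "flux w f r \<le> flux w f s"
proof (rule deriv_nonneg_imp_mono_real[where f = "flux w f", OF assms(4)])
  fix x assume "r < x"
  then show "\<exists>D. (flux w f has_real_derivative D) (at x) \<and> 0 \<le> D"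
    using flux_deriv[OF assms(1)[of "x+1"], of x] w_nonneg[of x] assms(2)[of x] assms(3)
    by (intro exI[of _ "w x * f x"]) auto
qed (rule continuous_on_subset[OF flux_cont[OF assms(1)[of s]]], use assms in auto)

lemma gradient_energy_mono:
  assumes s: "psol \<xi> \<eta> u v" and "0 \<le> r" "r \<le> t"
  shows "gradient_energy u v r \<le> gradient_energy u v t"
  unfolding gradient_energy_def
  by (rule flux_nonneg_mono[OF grad_cont[OF s]])
    (use assms in \<open>auto intro!: mult_nonneg_nonneg psol_source_nonneg[OF s] lane_emden.psol_source_nonneg[OF swap lane_sol_swap[OF s]]\<close>)

lemma power_energy_mono:
  assumes s: "psol \<xi> \<eta> u v" and "0 < a" "0 \<le> r" "r \<le> t"
  shows "power_energy a v r \<le> power_energy a v t"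
  unfolding power_energy_def by (rule flux_nonneg_mono[OF pow_cont[OF s]]) (use assms in auto)

lemma flux_zero: "flux w f 0 = 0" by (simp add: flux_def)

text \<open>Integration by parts, testing the equation of \<open>u\<close> with \<open>v\<close>:
  \<open>flux_u v\<close> is \<open>w x\<close>, with derivative \<open>w v^q\<close>, and
  \<open>v' = -y\<close>.\<close>

lemma energy_identity:
  assumes s: "psol \<xi> \<eta> u v" and pos: "\<And>r. 0 \<le> r \<Longrightarrow> 0 < v r" and r: "0 \<le> r"
  shows "flux_u v r * v r = power_energy (q + 1) v r - gradient_energy u v r"
proof -
  let ?f = "\<lambda>r. flux_u v r * v r - power_energy (q + 1) v r + gradient_energy u v r"
  have q1: "0 < q + 1" using q_pos by simp
  have D: "(?f has_real_derivative 0) (at x)" if x: "0 < x" for x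
  proof -
    let ?x = "slope_u v x" and ?y = "slope_v u x"
    have "(?f has_real_derivative (w x * ppow q (v x) * v x + - ?y * flux_u v x)
        - w x * ppow (q + 1) (v x) + w x * (?x * ?y)) (at x)"
      unfolding power_energy_def gradient_energy_def
      by (intro DERIV_add DERIV_diff DERIV_mult flux_deriv[OF psol_cont_source'[OF s, of "x+1"]] psol_deriv[OF s]
          flux_deriv[OF pow_cont[OF s q1, of "x+1"]] flux_deriv[OF grad_cont[OF s, of "x+1"]]) (use x in auto)
    moreover have "w x * ppow q (v x) * v x = w x * ppow (q + 1) (v x)"
      using pos[of x] x by (simp add: ppow_eq powr_add)
    moreover have "?y * flux_u v x = w x * (?x * ?y)"
      using flux_slope[of x "\<lambda>t. ppow q (v t)"] x by (metis less_imp_le mult.assoc mult.commute)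
    ultimately show ?thesis by simp
  qed
  have c: "continuous_on {0..r} ?f" unfolding power_energy_def gradient_energy_def
    by (intro continuous_on_add continuous_on_diff continuous_on_mult flux_cont psol_cont_source'[OF s]
        pow_cont[OF s q1] psol_cont_v[OF s] slope_cont psol_cont_source[OF s]) auto
  have "?f r \<le> ?f 0"
    by (rule deriv_nonpos_imp_antimono_real[where f = ?f, OF r c]) (use D in blast)
  moreover have "?f 0 \<le> ?f r"
    by (rule deriv_nonneg_imp_mono_real[where f = ?f, OF r c]) (use D in blast)
  ultimately show ?thesis by (simp add: flux_zero power_energy_def gradient_energy_def)
qed

lemma flux_v_nonneg: "psol \<xi> \<eta> u v \<Longrightarrow> (\<And>r. 0 \<le> r \<Longrightarrow> 0 < v r) \<Longrightarrow> 0 \<le> r \<Longrightarrow> 0 \<le> flux_u v r * v r"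
  by (intro mult_nonneg_nonneg flux_nonneg psol_cont_source') (auto simp: less_imp_le)

text \<open>If \<open>w x v \<ge> c\<close> near infinity, then \<open>w x y \<ge> - c (ln v)'\<close>, so \<open>ln v\<close> is bounded below.\<close>
lemma positive_limit_of_finite_gradient:
  assumes s: "psol \<xi> \<eta> u v" and pos: "\<And>r. 0 \<le> r \<Longrightarrow> 0 < v r"
    and J: "\<And>r. 0 \<le> r \<Longrightarrow> gradient_energy u v r \<le> C"
    and X: "\<not> ((\<lambda>r. flux_u v r * v r) \<longlongrightarrow> 0) at_top"
  shows "\<exists>l>0. \<forall>r\<ge>0. l \<le> v r"
proof -
  let ?X = "\<lambda>r. flux_u v r * v r"
  note X0 = flux_v_nonneg[OF s pos]
  have q1: "0 < q + 1" using q_pos by simp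
  have "\<exists>c>0. \<forall>R. \<exists>r\<ge>R. c \<le> ?X r"
  proof (rule ccontr)
    assume neg: "\<not> ?thesis"
    have "(?X \<longlongrightarrow> 0) at_top"
    proof (rule order_tendstoI)
      fix a :: real assume "0 < a"
      with neg obtain R where "\<And>r. R \<le> r \<Longrightarrow> ?X r < a" by (meson not_le)
      then show "\<forall>\<^sub>F r in at_top. ?X r < a" by (intro eventually_at_top_linorderI[of R])
    next
      fix a :: real assume "a < 0"
      then show "\<forall>\<^sub>F r in at_top. a < ?X r"
        using X0 by (intro eventually_at_top_linorderI[of 0]) force
    qed
    with X show False by blast
  qed
  then obtain c where c: "0 < c" "\<And>R. \<exists>r\<ge>R. c \<le> ?X r" by blast
  obtain R where R: "0 \<le> R" "\<And>r t. R \<le> r \<Longrightarrow> r \<le> t \<Longrightarrow> gradient_energy u v t - gradient_energy u v r < c / 2"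
    by (rule mono_bounded_tail[of "gradient_energy u v" C "c / 2"]) (use gradient_energy_mono[OF s] J c in auto)
  obtain a where a: "max R 1 \<le> a" "c \<le> ?X a" using c(2) by blast
  \<comment> \<open>From \<open>a\<close> on, the identity changes \<open>?X\<close> by a
    nonnegative power term minus a gradient term below \<open>c / 2\<close>, starting from at least
    \<open>c\<close>.\<close>
  have Xge: "c / 2 \<le> ?X r" if "a \<le> r" for r
    using energy_identity[OF s pos, of r] energy_identity[OF s pos, of a] power_energy_mono[OF s q1, of a r]
      R(2)[of a r] a that by auto
  let ?f = "\<lambda>r. gradient_energy u v r + c / 2 * ln (v r)"
  have f: "?f a \<le> ?f r" if r: "a \<le> r" for r
  proof (rule deriv_nonneg_imp_mono_real[where f = ?f, OF r])
    fix x assume x: "a < x"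
    then have x0: "0 < x" using a by simp
    let ?x = "slope_u v x" and ?y = "slope_v u x"
    have v: "0 < v x" using pos x0 by simp
    have "(?f has_real_derivative w x * (?x * ?y) + c / 2 * (1 / v x * - ?y)) (at x)"
      unfolding gradient_energy_def
      by (intro DERIV_add DERIV_cmult flux_deriv[OF grad_cont[OF s, of "x+1"]] DERIV_chain2[OF DERIV_ln_divide]
          psol_deriv[OF s]) (use x0 v in auto)
    moreover have "0 \<le> w x * (?x * ?y) + c / 2 * (1 / v x * - ?y)"
    proof -
      have "c / 2 * ?y \<le> ?X x * ?y" using Xge[of x] x x0 psol_source_nonneg[OF s, of x] by (intro mult_right_mono) auto
      also have "\<dots> = w x * (?x * ?y) * v x"
        by (simp add: flux_slope[of x "\<lambda>t. ppow q (v t)", OF less_imp_le[OF x0], symmetric] mult_ac)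
      finally show ?thesis using v by (simp add: field_simps)
    qed
    ultimately show "\<exists>D. (?f has_real_derivative D) (at x) \<and> 0 \<le> D" by blast
  next
    show "continuous_on {a..r} ?f" unfolding gradient_energy_def
    proof (intro continuous_on_add continuous_on_mult continuous_on_const continuous_on_ln psol_cont_v[OF s])
      show "continuous_on {a..r} (flux w (\<lambda>t. slope_u v t * slope_v u t))"
        by (rule continuous_on_subset[OF flux_cont[OF grad_cont[OF s, of r]]]) (use a in auto)
      show "\<forall>x\<in>{a..r}. v x \<noteq> 0"
      proof
        fix x assume "x \<in> {a..r}"
        then show "v x \<noteq> 0" using pos[of x] a by auto
      qed
    qed (use a in auto)
  qed
  \<comment> \<open>As \<open>gradient_energy\<close> lies between 0 and \<open>C\<close>,
    \<open>ln v\<close> can fall by at most \<open>2 * \<bar>C\<bar> / c\<close> after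
    \<open>a\<close>.\<close>
  define l where "l = v a * exp (- (2 * \<bar>C\<bar> / c))"
  have va: "0 < v a" using pos a by simp
  have l0: "0 < l" using va by (simp add: l_def)
  have lle: "l \<le> v a" using va c by (simp add: l_def)
  have "l \<le> v r" if r: "0 \<le> r" for r
  proof (cases "r \<le> a")
    case True
    then show ?thesis using psol_antimono[OF s r True] lle by simp
  next
    case False
    have "0 \<le> gradient_energy u v a" using gradient_energy_mono[OF s, of 0 a] a by (simp add: gradient_energy_def flux_zero)
    then have "c / 2 * ln (v a) \<le> \<bar>C\<bar> + c / 2 * ln (v r)" using f[of r] False J[OF r] by auto
    then have "ln (v a) - 2 * \<bar>C\<bar> / c \<le> ln (v r)" using c by (simp add: field_simps)
    then have "ln l \<le> ln (v r)" using va by (simp add: l_def ln_mult)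
    then show ?thesis using l0 pos[OF r] by simp
  qed
  with l0 show ?thesis by blast
qed

lemma finite_power_imp_vanishing_rate:
  assumes s: "psol \<xi> \<eta> u v" and r: "0 \<le> r"
  shows "W r * ppow (q + 1) (v r) \<le> power_energy (q + 1) v r"
  using flux_ge[OF pow_cont[OF s, of "q + 1" r], of "ppow (q + 1) (v r)"] psol_antimono[OF s] q_pos r
  by (simp add: power_energy_def mult.commute ppow_mono)

text \<open>
  With \<open>G = W\<^bsup>1/(2q+2)\<^esup>\<close>, the arithmetic-geometric mean inequality applied to
  \<open>W'/(W G)\<close> and \<open>c \<Theta> G\<close>, whose product is \<open>c\<close>, bounds the length of the half-line.
\<close>
lemma growth_contradiction:
  assumes s: "psol \<xi> \<eta> u v" and pos: "\<And>r. 0 \<le> r \<Longrightarrow> 0 < v r"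
    and l: "0 < l" "\<And>r. 0 \<le> r \<Longrightarrow> l \<le> u r"
    and C: "\<And>r. 0 \<le> r \<Longrightarrow> W r * ppow (q + 1) (v r) \<le> C"
  shows False
proof -
  define c where "c = l powr p"
  define b where "b = q + 1"
  define be where "be = 2 * b"
  define K where "K = C powr (1 / b)"
  define G where "G r = W r powr (1 / be)" for r
  have c: "0 < c" using l by (simp add: c_def)
  have b: "0 < b" "0 < be" using q_pos by (auto simp: b_def be_def)
  have Gpos: "0 < G r" if "0 < r" for r using W_pos[OF that] by (simp add: G_def)
  \<comment> \<open>The exponent of \<open>G\<close> is half of \<open>1 / b\<close>, so
    \<open>v * G * G\<close> is the \<open>b\<close>-th root of \<open>W * v powr b\<close>.\<close>
  have vG: "v r * G r * G r \<le> K" if r: "0 < r" for r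
  proof -
    have v: "0 < v r" using pos r by simp
    have "G r * G r = W r powr (1 / b)" by (simp add: G_def be_def flip: powr_add)
    moreover have "v r = (v r powr b) powr (1 / b)" using v b by (simp add: powr_powr)
    ultimately have "v r * G r * G r = (W r * v r powr b) powr (1 / b)"
      using W_pos[OF r] v by (simp add: powr_mult mult.assoc)
    also have "\<dots> \<le> K" unfolding K_def
      using C[of r] r v W_pos[OF r] b by (intro powr_mono2) (auto simp: ppow_eq b_def)
    finally show ?thesis .
  qed
  \<comment> \<open>With \<open>t = w / (W G)\<close>, \<open>be / G\<close> has derivative
    \<open>-t\<close>. The term \<open>v G\<close> contributes at most \<open>-c / t\<close> plus a
    positive term from the derivative of \<open>G\<close>, which \<open>K / G\<close> absorbs. By
    \<open>2 * sqrt c \<le> t + c / t\<close>, \<open>F\<close> is nonincreasing, yet it is at least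
    \<open>2 * sqrt c * r\<close>.\<close>
  define F where "F r = 2 * sqrt c * r + (be + K) * (1 / G r) + v r * G r" for r
  have dG: "(G has_real_derivative (1 / be) * G r * (w r / W r)) (at r)" if r: "0 < r" for r
  proof -
    have "(G has_real_derivative (1 / be * W r powr (1 / be - 1)) * w r) (at r)" unfolding G_def[abs_def]
      by (rule DERIV_chain2[OF has_real_derivative_powr[OF W_pos[OF r]] W_deriv[OF r]])
    moreover have "W r powr (1 / be - 1) = G r / W r" using W_pos[OF r] by (simp add: G_def powr_diff)
    ultimately show ?thesis by simp
  qed
  have dF: "\<exists>D. (F has_real_derivative D) (at r) \<and> D \<le> 0" if r: "0 < r" for r
  proof -
    let ?y = "slope_v u r" and ?g = "w r / W r"
    have g: "0 < ?g" using w_pos[OF r] W_pos[OF r] by simp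
    note G = Gpos[OF r]
    have dinv: "((\<lambda>r. 1 / G r) has_real_derivative - (1 / be) * (?g / G r)) (at r)"
    proof -
      have "((\<lambda>r. 1 / G r) has_real_derivative (0 * G r - 1 * ((1 / be) * G r * ?g)) / (G r * G r)) (at r)"
        by (rule DERIV_divide[OF DERIV_const dG[OF r]]) (use G in simp)
      then show ?thesis using G by (simp add: field_simps)
    qed
    have "(F has_real_derivative 2 * sqrt c * 1 + (be + K) * (- (1 / be) * (?g / G r))
        + (- ?y * G r + (1 / be) * G r * ?g * v r)) (at r)" (is "(F has_real_derivative ?D) _") unfolding F_def[abs_def]
      by (intro DERIV_add DERIV_cmult DERIV_ident DERIV_mult dinv dG psol_deriv[OF s] r)
    moreover have "?D \<le> 0"
    proof -
      define t where "t = ?g / G r"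
      have t: "0 < t" unfolding t_def by (intro divide_pos_pos g G)
      have "ppow p l \<le> ppow p (u r)" using l(2)[of r] r by (intro ppow_mono p_pos) auto
      then have "c * \<Theta> r \<le> ppow p (u r) * \<Theta> r"
        using Theta_pos[OF r] l by (intro mult_right_mono) (auto simp: c_def ppow_eq)
      also have "\<dots> \<le> ?y" using psol_slope_ge[OF s, of r] r by simp
      finally have "c * \<Theta> r * G r \<le> ?y * G r" using G by (intro mult_right_mono) auto
      moreover have "c * \<Theta> r * G r = c / t" using W_pos[OF r] w_pos[OF r] G by (simp add: t_def field_simps)
      ultimately have y: "c / t \<le> ?y * G r" by simp
      have "v r * G r * G r * (t / be) \<le> K * (t / be)" using vG[OF r] t b by (intro mult_right_mono) auto
      moreover have "v r * G r * G r * (t / be) = (1 / be) * G r * ?g * v r" using G by (simp add: t_def field_simps)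
      ultimately have v: "(1 / be) * G r * ?g * v r \<le> K * (t / be)" by simp
      have "(be + K) * (- (1 / be) * t) = - t - K * (t / be)" using b by (simp add: field_simps)
      then have "?D = 2 * sqrt c - t - K * (t / be) - ?y * G r + (1 / be) * G r * ?g * v r"
        unfolding t_def by simp
      also have "\<dots> \<le> 2 * sqrt c - t - c / t" using y v by simp
      also have "\<dots> \<le> 0" using two_sqrt_le[of c t] c t by simp
      finally show ?thesis .
    qed
    ultimately show ?thesis by blast
  qed
  have le: "F r \<le> F 1" if r: "1 \<le> r" for r
  proof (rule deriv_nonpos_imp_antimono_real[where f = F, OF r])
    show "continuous_on {1..r} F"
    proof (intro continuous_at_imp_continuous_on ballI)
      fix x assume "x \<in> {1..r}"
      then have "0 < x" by simp
      then obtain D where "(F has_real_derivative D) (at x)" using dF by blast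
      then show "isCont F x" by (rule DERIV_isCont)
    qed
  qed (use dF in auto)
  have K0: "0 \<le> K" by (simp add: K_def)
  have ge: "2 * sqrt c * r \<le> F r" if "1 \<le> r" for r
    using Gpos[of r] pos[of r] that K0 b by (auto simp: F_def intro!: add_nonneg_nonneg mult_nonneg_nonneg)
  define r where "r = max 1 (F 1 / (2 * sqrt c) + 1)"
  have "F 1 / (2 * sqrt c) + 1 \<le> r" "1 \<le> r" by (auto simp: r_def)
  then have "F 1 / (2 * sqrt c) < r" "1 \<le> r" by auto
  then show False using le[of r] ge[of r] c by (simp add: pos_divide_less_eq mult.commute)
qed

text \<open>Here \<open>w x y \<ge> c / t\<close> for \<open>t = w / W^2\<close>, which is the
  derivative of \<open>-1 / W\<close>. By the arithmetic-geometric mean inequality,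
  \<open>gradient_energy - 1 / W\<close> grows at least at the rate
  \<open>2 * sqrt c\<close>.\<close>

lemma gradient_growth_contradiction:
  assumes s: "psol \<xi> \<eta> u v"
    and l: "0 < l" "\<And>r. 0 \<le> r \<Longrightarrow> l \<le> u r" and m: "0 < m" "\<And>r. 0 \<le> r \<Longrightarrow> m \<le> v r"
    and C: "\<And>r. 0 \<le> r \<Longrightarrow> gradient_energy u v r \<le> C"
  shows False
proof -
  define c where "c = m powr q * l powr p"
  have c: "0 < c" using l m by (simp add: c_def)
  let ?f = "\<lambda>r. gradient_energy u v r - 1 / W r - 2 * sqrt c * r"
  have dF: "\<exists>D. (?f has_real_derivative D) (at r) \<and> 0 \<le> D" if r: "0 < r" for r
  proof -
    let ?x = "slope_u v r" and ?y = "slope_v u r"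
    have dinv: "((\<lambda>r. 1 / W r) has_real_derivative (0 * W r - 1 * w r) / (W r * W r)) (at r)"
      by (rule DERIV_divide[OF DERIV_const W_deriv[OF r]]) (use W_pos[OF r] in simp)
    have "(?f has_real_derivative w r * (?x * ?y) - (0 * W r - 1 * w r) / (W r * W r) - 2 * sqrt c * 1) (at r)"
      (is "(_ has_real_derivative ?D) _")
      unfolding gradient_energy_def
      by (intro DERIV_diff DERIV_cmult DERIV_ident dinv flux_deriv[OF grad_cont[OF s, of "r+1"]]) (use r in auto)
    moreover have "0 \<le> ?D"
    proof -
      define t where "t = w r / (W r * W r)"
      have t: "0 < t" using w_pos[OF r] W_pos[OF r] by (simp add: t_def)
      have "ppow p l \<le> ppow p (u r)" "ppow q m \<le> ppow q (v r)"
        using l(2)[of r] m(2)[of r] r by (auto intro!: ppow_mono p_pos q_pos)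
      then have "l powr p \<le> ppow p (u r)" "m powr q \<le> ppow q (v r)"
        using l m by (simp_all add: ppow_eq)
      then have "l powr p * \<Theta> r \<le> ppow p (u r) * \<Theta> r" "m powr q * \<Theta> r \<le> ppow q (v r) * \<Theta> r"
        using less_imp_le[OF Theta_pos[OF r]] by (blast intro: mult_right_mono)+
      then have "l powr p * \<Theta> r \<le> ?y" "m powr q * \<Theta> r \<le> ?x"
        using psol_slope_ge[OF s, of r] psol_slope_ge'[OF s, of r] r by auto
      then have "(m powr q * \<Theta> r) * (l powr p * \<Theta> r) \<le> ?x * ?y"
        using less_imp_le[OF Theta_pos[OF r]] lane_emden.psol_source_nonneg[OF swap lane_sol_swap[OF s], of r] r
        by (intro mult_mono mult_nonneg_nonneg) auto
      then have "w r * ((m powr q * \<Theta> r) * (l powr p * \<Theta> r)) \<le> w r * (?x * ?y)"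
        using w_pos[OF r] by (intro mult_left_mono) auto
      moreover have "w r * ((m powr q * \<Theta> r) * (l powr p * \<Theta> r)) = c / t"
        using w_pos[OF r] W_pos[OF r] by (simp add: t_def c_def field_simps)
      ultimately have "c / t \<le> w r * (?x * ?y)" by simp
      moreover have "?D = w r * (?x * ?y) + t - 2 * sqrt c" by (simp add: t_def)
      ultimately show ?thesis using two_sqrt_le[of c t] c t by simp
    qed
    ultimately show ?thesis by blast
  qed
  have le: "?f 1 \<le> ?f r" if r: "1 \<le> r" for r
  proof (rule deriv_nonneg_imp_mono_real[where f = ?f, OF r])
    show "continuous_on {1..r} ?f"
    proof (intro continuous_at_imp_continuous_on ballI)
      fix x assume "x \<in> {1..r}"
      then have "0 < x" by simp
      then obtain D where "(?f has_real_derivative D) (at x)" using dF by blast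
      then show "isCont ?f x" by (rule DERIV_isCont)
    qed
  qed (use dF in auto)
  define k where "k = 2 * sqrt c"
  have k: "0 < k" using c by (simp add: k_def)
  define M where "M = C - ?f 1"
  define r where "r = max 1 (M / k + 1)"
  have r1: "1 \<le> r" "M / k < r" by (auto simp: r_def less_max_iff_disj)
  then have "M < k * r" using k by (simp add: pos_divide_less_eq mult.commute)
  moreover have "0 \<le> 1 / W r" using W_nonneg[of r] r1 by simp
  ultimately show False using le[OF r1(1)] C[of r] r1(1) unfolding M_def k_def by linarith
qed

lemma power_energy_bounded_of_vanishing:
  assumes s: "psol \<xi> \<eta> u v" and pos: "\<And>r. 0 \<le> r \<Longrightarrow> 0 < v r"
    and J: "\<And>r. 0 \<le> r \<Longrightarrow> gradient_energy u v r \<le> C"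
    and X: "((\<lambda>r. flux_u v r * v r) \<longlongrightarrow> 0) at_top"
  shows "\<exists>C. \<forall>r\<ge>0. power_energy (q + 1) v r \<le> C"
proof -
  have q1: "0 < q + 1" using q_pos by simp
  have "\<forall>\<^sub>F r in at_top. flux_u v r * v r < 1" using X by (rule order_tendstoD) simp
  then obtain R where R: "\<And>r. R \<le> r \<Longrightarrow> flux_u v r * v r < 1"
    by (auto simp: eventually_at_top_linorder)
  have "power_energy (q + 1) v r \<le> 1 + C" if r: "0 \<le> r" for r
  proof -
    have "power_energy (q + 1) v r \<le> power_energy (q + 1) v (max R r)" by (rule power_energy_mono[OF s q1 r]) simp
    also have "\<dots> = flux_u v (max R r) * v (max R r) + gradient_energy u v (max R r)"
      using energy_identity[OF s pos, of "max R r"] r by simp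
    also have "\<dots> \<le> 1 + C"
      by (intro add_mono less_imp_le[OF R] J) (use r in auto)
    finally show ?thesis .
  qed
  then show ?thesis by blast
qed

lemma gradient_energy_le_power_energy:
  assumes s: "psol \<xi> \<eta> u v" and pos: "\<And>r. 0 \<le> r \<Longrightarrow> 0 < v r" and r: "0 \<le> r"
  shows "gradient_energy u v r \<le> power_energy (q + 1) v r"
  using energy_identity[OF s pos r] flux_v_nonneg[OF s pos r] by simp

text \<open>A boundary term that does not tend to 0 keeps its component away from 0. If exactly one
  tends to 0, its power energy is finite and \<open>growth_contradiction\<close> applies; if neither
  does, \<open>gradient_growth_contradiction\<close> applies. So both tend to 0 and
  \<open>rigidI\<close> concludes.\<close>

lemma finite_gradient_rigid:
  assumes s: "psol \<xi> \<eta> u v" and init: "0 < \<xi>" "0 < \<eta>" and pos: "\<And>r. 0 \<le> r \<Longrightarrow> 0 < u r \<and> 0 < v r"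
    and J: "\<And>r. 0 \<le> r \<Longrightarrow> gradient_energy u v r \<le> C"
  shows "rigid \<and> (\<exists>C. \<forall>r\<ge>0. power_energy (p + 1) u r \<le> C) \<and> (\<exists>C. \<forall>r\<ge>0. power_energy (q + 1) v r \<le> C)"
proof -
  note s' = lane_sol_swap[OF s]
  have pu: "\<And>r. 0 \<le> r \<Longrightarrow> 0 < u r" and pv: "\<And>r. 0 \<le> r \<Longrightarrow> 0 < v r" using pos by auto
  have J': "\<And>r. 0 \<le> r \<Longrightarrow> lane_emden.gradient_energy w q p v u r \<le> C" using J by (simp add: gradient_energy_swap)
  let ?X = "((\<lambda>r. flux_u v r * v r) \<longlongrightarrow> 0) at_top"
  let ?Y = "((\<lambda>r. flux_v u r * u r) \<longlongrightarrow> 0) at_top"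
  have lv: "\<exists>l>0. \<forall>r\<ge>0. l \<le> v r" if "\<not> ?X"
    by (rule positive_limit_of_finite_gradient[OF s pv J that])
  have lu: "\<exists>l>0. \<forall>r\<ge>0. l \<le> u r" if "\<not> ?Y"
    by (rule lane_emden.positive_limit_of_finite_gradient[OF swap s' pu J' that])
  have Iv: "\<exists>C. \<forall>r\<ge>0. power_energy (q + 1) v r \<le> C" if ?X
    by (rule power_energy_bounded_of_vanishing[OF s pv J that])
  have Iu: "\<exists>C. \<forall>r\<ge>0. power_energy (p + 1) u r \<le> C" if ?Y
    by (rule lane_emden.power_energy_bounded_of_vanishing[OF swap s' pu J' that])
  have n1: False if a: ?X "\<not> ?Y"
  proof -
    obtain C' where "\<And>r. 0 \<le> r \<Longrightarrow> power_energy (q + 1) v r \<le> C'" using Iv[OF a(1)] by blast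
    then have C': "\<And>r. 0 \<le> r \<Longrightarrow> W r * ppow (q + 1) (v r) \<le> C'"
      using order_trans[OF finite_power_imp_vanishing_rate[OF s]] by blast
    obtain l where "0 < l" "\<And>r. 0 \<le> r \<Longrightarrow> l \<le> u r" using lu[OF a(2)] by blast
    then show False using growth_contradiction[OF s pv _ _ C'] by blast
  qed
  have n2: False if a: ?Y "\<not> ?X"
  proof -
    obtain C' where "\<And>r. 0 \<le> r \<Longrightarrow> power_energy (p + 1) u r \<le> C'" using Iu[OF a(1)] by blast
    then have C': "\<And>r. 0 \<le> r \<Longrightarrow> W r * ppow (p + 1) (u r) \<le> C'"
      using order_trans[OF lane_emden.finite_power_imp_vanishing_rate[OF swap s']] by blast
    obtain l where "0 < l" "\<And>r. 0 \<le> r \<Longrightarrow> l \<le> v r" using lv[OF a(2)] by blast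
    then show False using lane_emden.growth_contradiction[OF swap s' pu _ _ C'] by blast
  qed
  have n3: False if a: "\<not> ?X" "\<not> ?Y"
  proof -
    obtain l where l: "0 < l" "\<And>r. 0 \<le> r \<Longrightarrow> l \<le> u r" using lu[OF a(2)] by blast
    obtain m where m: "0 < m" "\<And>r. 0 \<le> r \<Longrightarrow> m \<le> v r" using lv[OF a(1)] by blast
    show False using gradient_growth_contradiction[OF s l m J] by blast
  qed
  have X: ?X and Y: ?Y using n1 n2 n3 by blast+
  show ?thesis using rigidI[OF s init pos X Y] Iv[OF X] Iu[OF Y] by blast
qed

text \<open>Either power energy dominates the gradient energy, so the latter is finite in every
  case.\<close>

lemma finite_energy_rigid:
  assumes s: "psol \<xi> \<eta> u v" and init: "0 < \<xi>" "0 < \<eta>" and pos: "\<And>r. 0 \<le> r \<Longrightarrow> 0 < u r \<and> 0 < v r"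
    and fin: "(\<exists>C. \<forall>r\<ge>0. gradient_energy u v r \<le> C) \<or> (\<exists>C. \<forall>r\<ge>0. power_energy (p + 1) u r \<le> C) \<or> (\<exists>C. \<forall>r\<ge>0. power_energy (q + 1) v r \<le> C)"
  shows "rigid \<and> (\<exists>C. \<forall>r\<ge>0. gradient_energy u v r \<le> C) \<and> (\<exists>C. \<forall>r\<ge>0. power_energy (p + 1) u r \<le> C) \<and> (\<exists>C. \<forall>r\<ge>0. power_energy (q + 1) v r \<le> C)"
proof -
  have "gradient_energy u v r \<le> power_energy (q + 1) v r" "gradient_energy u v r \<le> power_energy (p + 1) u r" if "0 \<le> r" for r
    using gradient_energy_le_power_energy[OF s _ that] pos
      lane_emden.gradient_energy_le_power_energy[OF swap lane_sol_swap[OF s] _ that, unfolded gradient_energy_swap]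
    by blast+
  then have "\<exists>C. \<forall>r\<ge>0. gradient_energy u v r \<le> C" using fin by (elim disjE exE) (blast intro: order_trans)+
  then obtain C where C: "\<And>r. 0 \<le> r \<Longrightarrow> gradient_energy u v r \<le> C" by blast
  show ?thesis using finite_gradient_rigid[OF s init pos C] C by blast
qed

end

section \<open>Model manifolds\<close>

text \<open>Agreement is asked only off 0, since the two-sided \<open>deriv\<close> in the
  integrands carries no information at the end point. Monotone convergence over
  \<open>{0..k}\<close> yields integrability from bounded primitives.\<close>

lemma absolutely_integrable_iff_bounded:
  fixes f g :: "real \<Rightarrow> real"
  assumes c: "continuous_on {0..} f" and nn: "\<And>x. 0 \<le> x \<Longrightarrow> 0 \<le> f x"
    and eq: "\<And>x. 0 < x \<Longrightarrow> g x = f x"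
  shows "g absolutely_integrable_on {0<..} \<longleftrightarrow> (\<exists>C. \<forall>r\<ge>0. integral {0..r} f \<le> C)"
proof -
  have cR: "f integrable_on {0..r}" for r
    by (rule integrable_continuous_real[OF continuous_on_subset[OF c]]) auto
  have "g absolutely_integrable_on {0<..} \<longleftrightarrow> g integrable_on {0<..}"
    by (rule absolutely_integrable_on_iff_nonneg) (use nn eq in auto)
  also have "\<dots> \<longleftrightarrow> f integrable_on {0<..}" by (rule integrable_cong) (use eq in auto)
  also have "\<dots> \<longleftrightarrow> f integrable_on {0..}"
  proof (rule integrable_spike_set_eq)
    have "({0<..} - {0..} \<union> ({0..} - {0<..})) = {0::real}" by auto
    then show "negligible ({0<..} - {0..} \<union> ({0..} - {0<..}) :: real set)" by simp
  qed
  also have "\<dots> \<longleftrightarrow> (\<exists>C. \<forall>r\<ge>0. integral {0..r} f \<le> C)"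
  proof
    assume i: "f integrable_on {0..}"
    have "integral {0..r} f \<le> integral {0..} f" for r
      by (rule integral_subset_le) (use cR i nn in auto)
    then show "\<exists>C. \<forall>r\<ge>0. integral {0..r} f \<le> C" by blast
  next
    assume "\<exists>C. \<forall>r\<ge>0. integral {0..r} f \<le> C"
    then obtain C where C: "\<And>r. 0 \<le> r \<Longrightarrow> integral {0..r} f \<le> C" by blast
    let ?F = "\<lambda>(k::nat) x. if x \<in> {0..real k} then f x else 0"
    have h: "(?F k has_integral integral {0..real k} f) {0..}" for k
      using integrable_integral[OF cR[of "real k"]] by (subst has_integral_restrict) auto
    have "f integrable_on {0..} \<and> (\<lambda>k. integral {0..} (?F k)) \<longlonglongrightarrow> integral {0..} f"
    proof (rule monotone_convergence_increasing)
      show "?F k integrable_on {0..}" for k using h by blast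
      show "?F k x \<le> ?F (Suc k) x" if "x \<in> {0..}" for k x using nn[of x] that by auto
      show "(\<lambda>k. ?F k x) \<longlonglongrightarrow> f x" if "x \<in> {0..}" for x
      proof (rule tendsto_eventually)
        obtain N where "x \<le> real N" using real_arch_simple by blast
        then show "\<forall>\<^sub>F k in sequentially. ?F k x = f x"
          using that by (intro eventually_sequentiallyI[of N]) auto
      qed
      have "\<bar>integral {0..} (?F k)\<bar> \<le> C" for k
      proof -
        have "0 \<le> integral {0..real k} f" by (rule integral_nonneg[OF cR]) (use nn in auto)
        then show ?thesis using C[of "real k"] integral_unique[OF h[of k]] by simp
      qed
      then show "bounded (range (\<lambda>k. integral {0..} (?F k)))" unfolding bounded_iff by auto
    qed
    then show "f integrable_on {0..}" by blast
  qed
  finally show ?thesis .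
qed

lemma integral_deriv_at:
  fixes w :: "real \<Rightarrow> real"
  assumes "continuous_on {0..} w" "0 < r"
  shows "((\<lambda>r. integral {0..r} w) has_real_derivative w r) (at r)"
proof -
  have "continuous_on {0..r+1} w" by (rule continuous_on_subset[OF assms(1)]) auto
  then have "((\<lambda>r. integral {0..r} w) has_real_derivative w r) (at r within {0..r+1})"
    by (rule integral_has_real_derivative) (use assms in auto)
  moreover have "at r within {0..r+1} = at r" by (rule at_within_interior) (use assms in auto)
  ultimately show ?thesis by simp
qed

text \<open>\<open>V' = \<theta> W\<^sup>\<theta>\<^sup>-\<^sup>1 w\<close> is nondecreasing, hence \<open>V'' \<ge> 0\<close>.\<close>
lemma convex_power_of_integral:
  fixes w w' :: "real \<Rightarrow> real"
  assumes c: "continuous_on {0..} w" and pos: "\<And>r. 0 < r \<Longrightarrow> 0 < w r"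
    and d: "\<And>r. 0 < r \<Longrightarrow> (w has_real_derivative w' r) (at r)"
    and th: "0 < \<theta>" and conv: "convex_on {0..} (\<lambda>r. integral {0..r} w powr \<theta>)" and r: "0 < r"
  shows "(1 - \<theta>) * (w r)\<^sup>2 \<le> integral {0..r} w * w' r"
proof -
  define W where "W r = integral {0..r} w" for r
  have dW: "(W has_real_derivative w r) (at r)" if "0 < r" for r
    unfolding W_def[abs_def] by (rule integral_deriv_at[OF c that])
  have Wpos: "0 < W r" if r: "0 < r" for r
  proof -
    have "W 0 < W r"
    proof (rule DERIV_pos_imp_increasing_open[OF r])
      show "continuous_on {0..r} W" unfolding W_def
        by (intro indefinite_integral_continuous_1 integrable_continuous_real continuous_on_subset[OF c]) auto
    qed (use dW pos in blast)
    then show ?thesis by (simp add: W_def)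
  qed
  \<comment> \<open>Here \<open>V\<close> names the derivative of the convex function; adding the
    tangent inequalities at two points shows that it is monotone.\<close>
  define V where "V r = \<theta> * W r powr (\<theta> - 1) * w r" for r
  have dV: "((\<lambda>r. W r powr \<theta>) has_real_derivative V r) (at r)" if "0 < r" for r
    unfolding V_def by (rule DERIV_chain2[OF has_real_derivative_powr[OF Wpos[OF that]] dW[OF that]])
  have tangent: "V x * (y - x) \<le> W y powr \<theta> - W x powr \<theta>" if "0 < x" "0 < y" for x y
  proof (rule convex_on_imp_above_tangent[where A = "{0..}"])
    show "convex_on {0..} (\<lambda>r. W r powr \<theta>)" using conv by (simp add: W_def)
    show "((\<lambda>r. W r powr \<theta>) has_real_derivative V x) (at x within {0..})"
      using dV[OF that(1)] by (rule has_field_derivative_at_within)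
  qed (use that in auto)
  have "mono_on {0<..} V"
  proof (rule mono_onI)
    fix x y :: real assume xy: "x \<in> {0<..}" "y \<in> {0<..}" "x \<le> y"
    have "V x * (y - x) \<le> V y * (y - x)"
      using tangent[of x y] tangent[of y x] xy by (simp add: algebra_simps)
    then show "V x \<le> V y" using xy by (cases "x = y") (auto simp: mult_le_cancel_right)
  qed
  moreover have "(V has_real_derivative \<theta> * (((\<theta> - 1) * W r powr (\<theta> - 1 - 1) * w r) * w r + w' r * W r powr (\<theta> - 1))) (at r)"
  proof -
    have "((\<lambda>r. \<theta> * (W r powr (\<theta> - 1) * w r)) has_real_derivative
        \<theta> * (((\<theta> - 1) * W r powr (\<theta> - 1 - 1) * w r) * w r + w' r * W r powr (\<theta> - 1))) (at r)"
      by (intro DERIV_cmult DERIV_mult d r DERIV_chain2[OF has_real_derivative_powr[OF Wpos[OF r]] dW[OF r]])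
    then show ?thesis by (simp add: V_def[abs_def] mult.assoc)
  qed
  ultimately have "0 \<le> \<theta> * (((\<theta> - 1) * W r powr (\<theta> - 1 - 1) * w r) * w r + w' r * W r powr (\<theta> - 1))"
    by (rule mono_on_imp_deriv_nonneg) (use r in \<open>auto simp: interior_open\<close>)
  then have "0 \<le> ((\<theta> - 1) * W r powr (\<theta> - 1 - 1) * w r) * w r + w' r * W r powr (\<theta> - 1)"
    using th by (simp add: zero_le_mult_iff)
  also have "\<dots> = W r powr (\<theta> - 1 - 1) * (W r * w' r - (1 - \<theta>) * (w r)\<^sup>2)"
  proof -
    have "W r powr (\<theta> - 1) = W r powr (\<theta> - 1 - 1) * W r"
      using powr_add[of "W r" "\<theta> - 1 - 1" 1] Wpos[OF r] by simp
    then show ?thesis by (simp only: power2_eq_square) (simp add: algebra_simps)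
  qed
  finally show ?thesis using Wpos[OF r] by (simp add: zero_le_mult_iff W_def)
qed

text \<open>Integrating \<open>(w u')' = - w v^q\<close> from 0, where \<open>w\<close> vanishes,
  recovers the slope. The one-sided derivative \<open>f\<close> replaces \<open>deriv u\<close>,
  which is reliable only in the interior; the conditions on \<open>I\<close> cover both
  \<open>{0..}\<close> and \<open>{0..R}\<close>.\<close>

lemma CP_component:
  fixes w w' :: "real \<Rightarrow> real"
  assumes w: "continuous_on {0..} w" "w 0 = 0" "\<And>r. 0 < r \<Longrightarrow> 0 < w r"
      "\<And>r. 0 < r \<Longrightarrow> (w has_real_derivative w' r) (at r)"
    and q: "0 < q"
    and I: "{0..R} \<subseteq> I" "{0<..<R} \<subseteq> interior I" "I \<subseteq> {0..}"
    and u: "C1_on u I" "C1_on (deriv u) (interior I)" "(u has_real_derivative 0) (at 0 within I)"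
    and eq: "\<And>r. r \<in> interior I \<Longrightarrow> deriv (\<lambda>s. w s * deriv u s) r + w r * (\<bar>v r\<bar> powr (q - 1) * v r) = 0"
    and v: "\<And>r. r \<in> {0..R} \<Longrightarrow> 0 \<le> v r"
    and r: "r \<in> {0..R}"
  shows "(u has_real_derivative - slope w (\<lambda>t. ppow q (v t)) r) (at r within {0..R})"
proof (cases "r = 0")
  case True
  then show ?thesis using DERIV_subset[OF u(3) I(1)] w(2) by (simp add: slope_def)
next
  case False
  then have r0: "0 < r" "r \<le> R" using r by auto
  obtain f where f: "\<And>x. x \<in> I \<Longrightarrow> (u has_real_derivative f x) (at x within I)" "continuous_on I f"
    using u(1) unfolding C1_on_def by blast
  have fd: "deriv u x = f x" if "x \<in> interior I" for x
    using f(1)[of x] that at_within_interior[OF that] interior_subset by (intro DERIV_imp_deriv) auto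
  have "((\<lambda>x. - (w x * ppow q (v x))) has_integral w r * f r - w 0 * f 0) {0..r}"
  proof (rule fundamental_theorem_of_calculus_interior)
    show "continuous_on {0..r} (\<lambda>x. w x * f x)"
      by (intro continuous_on_mult continuous_on_subset[OF w(1)] continuous_on_subset[OF f(2)]) (use I r0 in auto)
    fix x assume x: "x \<in> {0<..<r}"
    then have xi: "x \<in> interior I" and x0: "0 < x" and xR: "x \<in> {0..R}" using I(2) r0 by auto
    obtain g where "(deriv u has_real_derivative g x) (at x within interior I)"
      using u(2) xi unfolding C1_on_def by blast
    then have "(deriv u has_real_derivative g x) (at x)" using xi at_within_open[of x "interior I"] by simp
    from DERIV_mult[OF w(4)[OF x0] this]
    have "((\<lambda>s. w s * deriv u s) has_real_derivative deriv (\<lambda>s. w s * deriv u s) x) (at x)"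
      by (metis DERIV_imp_deriv)
    moreover have "\<bar>v x\<bar> powr (q - 1) * v x = ppow q (v x)"
    proof (cases "v x = 0")
      case False
      then have "0 < v x" using v[OF xR] by simp
      then show ?thesis using powr_add[of "v x" "q - 1" 1] by (simp add: ppow_eq)
    qed (use q in \<open>simp add: ppow_def\<close>)
    ultimately have "((\<lambda>s. w s * deriv u s) has_real_derivative - (w x * ppow q (v x))) (at x)"
      using eq[OF xi] by (simp add: add_eq_0_iff)
    moreover have "\<forall>\<^sub>F s in nhds x. w s * deriv u s = w s * f s"
      using eventually_nhds_in_open[OF open_interior xi] by eventually_elim (simp add: fd)
    ultimately have "((\<lambda>s. w s * f s) has_real_derivative - (w x * ppow q (v x))) (at x)"
      using DERIV_cong_ev[OF refl, of "\<lambda>s. w s * deriv u s" "\<lambda>s. w s * f s" x] by blast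
    then show "((\<lambda>s. w s * f s) has_vector_derivative - (w x * ppow q (v x))) (at x)"
      by (simp add: has_real_derivative_iff_has_vector_derivative)
  qed (use r0 in simp)
  then have "w r * f r = - flux w (\<lambda>t. ppow q (v t)) r"
    unfolding flux_def using w(2) by (metis diff_zero integral_neg integral_unique mult_zero_left)
  then have "f r = - slope w (\<lambda>t. ppow q (v t)) r" using w(3)[OF r0(1)] by (simp add: slope_def field_simps)
  then show ?thesis using DERIV_subset[OF f(1) I(1), of r] I(1) r by auto
qed

section \<open>The weight of a model manifold\<close>

locale lane_emden_model =
  fixes \<psi> :: "real \<Rightarrow> real" and p q :: real and n :: nat
  assumes n3: "n \<ge> 3" and model: "model_function \<psi>" and pos_p: "p > 0" and pos_q: "q > 0"
    and hyperbola: "1 / (p + 1) + 1 / (q + 1) \<le> (real n - 2) / real n"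
    and convex_V: "convex_on {0..} (V_fun n \<psi> p q)"
begin

abbreviation wt :: "real \<Rightarrow> real" where "wt \<equiv> \<lambda>s. \<psi> s ^ (n - 1)"
abbreviation wt' :: "real \<Rightarrow> real" where "wt' \<equiv> \<lambda>r. real (n - 1) * (\<psi> r ^ (n - 1 - 1) * deriv \<psi> r)"

lemma psi_pos: "0 < r \<Longrightarrow> 0 < \<psi> r" and psi_zero: "\<psi> 0 = 0"
  and psi_deriv_zero: "(\<psi> has_real_derivative 1) (at 0 within {0..})"
  using model by (auto simp: model_function_def)

lemma psi_cont: "continuous_on {0..} \<psi>"
proof -
  obtain f where "\<And>x. x \<in> {0..} \<Longrightarrow> (\<psi> has_real_derivative f x) (at x within {0..})"
    using model unfolding model_function_def C1_on_def by blast
  then show ?thesis by (intro DERIV_continuous_on) auto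
qed

lemma iterated_differentiable: "0 < r \<Longrightarrow> (deriv ^^ k) \<psi> differentiable (at r)"
  using model unfolding model_function_def differentiable_on_def
  by (metis at_within_open greaterThan_iff open_greaterThan)

lemma psi_deriv: "0 < r \<Longrightarrow> (\<psi> has_real_derivative deriv \<psi> r) (at r)"
  using iterated_differentiable[of r 0] by (simp add: DERIV_deriv_iff_real_differentiable)

lemma deriv_psi_cont: "continuous_on {0<..} (deriv \<psi>)"
proof (intro continuous_at_imp_continuous_on ballI)
  fix r :: real assume "r \<in> {0<..}"
  then have "deriv \<psi> differentiable (at r)" using iterated_differentiable[of r 1] by simp
  then show "isCont (deriv \<psi>) r" by (rule differentiable_imp_continuous_within)
qed

lemma wt_cont: "continuous_on {0..} wt" by (intro continuous_on_power psi_cont)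
lemma wt_zero: "wt 0 = 0" using n3 psi_zero by simp
lemma wt_pos: "0 < r \<Longrightarrow> 0 < wt r" using psi_pos by simp
lemma wt_deriv: "0 < r \<Longrightarrow> (wt has_real_derivative wt' r) (at r)"
  using DERIV_power[OF psi_deriv, of r "n - 1"] by (simp add: mult.commute mult.left_commute)

lemma wt'_cont: "continuous_on {0<..} wt'"
  by (intro continuous_on_mult continuous_on_const continuous_on_power deriv_psi_cont
      continuous_on_subset[OF psi_cont]) auto

text \<open>Identifies the exponent of \<open>V_fun\<close> with \<open>(1 - sigma) / 2\<close>;
  twice its complement to 1 is the coefficient \<open>1 + sigma\<close> in
  \<open>key\<close>.\<close>

lemma exponent: "(p * q - 1) / (2 * (p + 1) * (q + 1)) = (1 - (1 / (p + 1) + 1 / (q + 1))) / 2"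
proof -
  have "(1 - (1 / a + 1 / b)) / 2 = (a * b - a - b) / (2 * a * b)" if "a \<noteq> 0" "b \<noteq> 0" for a b :: real
    using that by (simp add: field_simps)
  from this[of "p + 1" "q + 1"] show ?thesis using pos_p pos_q by (simp add: algebra_simps)
qed

lemma hyperbola': "2 / real n \<le> 1 - (1 / (p + 1) + 1 / (q + 1))"
  using hyperbola n3 by (simp add: diff_divide_distrib)

lemma pq_gt_1: "1 < p * q"
proof -
  have "0 < 1 - (1 / (p + 1) + 1 / (q + 1))" using less_le_trans[OF _ hyperbola', of 0] n3 by simp
  then have "0 < (p * q - 1) / (2 * (p + 1) * (q + 1))" unfolding exponent by simp
  moreover have "0 < 2 * (p + 1) * (q + 1)" using pos_p pos_q by (intro mult_pos_pos) auto
  ultimately show ?thesis using pos_less_divide_eq[of "2 * (p + 1) * (q + 1)" 0 "p * q - 1"] by simp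
qed

sublocale lane_emden wt wt' p q
proof
  fix r :: real assume r: "0 < r"
  let ?t = "(p * q - 1) / (2 * (p + 1) * (q + 1))"
  have t: "0 < ?t" using pq_gt_1 pos_p pos_q by simp
  have conv: "convex_on {0..} (\<lambda>r. integral {0..r} wt powr ?t)"
    using convex_V unfolding V_fun_def[abs_def] vol_def .
  have "(1 - ?t) * (wt r)\<^sup>2 \<le> integral {0..r} wt * wt' r"
    by (rule convex_power_of_integral[OF wt_cont wt_pos wt_deriv t conv r])
  moreover have "2 * (1 - ?t) = 1 + 1 / (p + 1) + 1 / (q + 1)" unfolding exponent by (simp add: field_simps)
  then have "(1 + 1 / (p + 1) + 1 / (q + 1)) * (wt r)\<^sup>2 = 2 * ((1 - ?t) * (wt r)\<^sup>2)" by (metis mult.assoc)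
  ultimately show "(1 + 1 / (p + 1) + 1 / (q + 1)) * (wt r)\<^sup>2 \<le> 2 * integral {0..r} wt * wt' r"
    unfolding mult.assoc[of 2 "integral {0..r} wt"] by linarith
qed (use wt_cont wt_zero wt_pos wt_deriv pos_p pos_q pq_gt_1 in auto)

end

section \<open>Euclidean rigidity and the Cauchy problem\<close>

text \<open>The identity map works: \<open>\<psi> (norm x) = norm x\<close> cancels the division by
  \<open>norm x\<close>, and the radial and tangential parts add up to the inner product.\<close>

lemma flat_isometry:
  assumes "\<And>r. 0 \<le> r \<Longrightarrow> \<psi> r = r"
  shows "riemannian_isometric (model_metric \<psi> :: 'a::euclidean_space \<Rightarrow> 'a \<Rightarrow> 'a \<Rightarrow> real) flat_metric"
proof -
  have "v \<bullet> w = model_metric \<psi> x v w" for x v w :: 'a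
  proof (cases "x = 0")
    case False
    define e where "e = x /\<^sub>R norm x"
    have e: "e \<bullet> e = 1" using False by (simp add: e_def dot_square_norm field_simps power2_eq_square)
    have "(norm x)\<^sup>2 * ((a /\<^sub>R norm x) \<bullet> (b /\<^sub>R norm x)) = a \<bullet> b" for a b :: 'a
      using False by (simp add: power2_eq_square field_simps)
    then have "model_metric \<psi> x v w = (v \<bullet> e) * (w \<bullet> e) + (v - (v \<bullet> e) *\<^sub>R e) \<bullet> (w - (w \<bullet> e) *\<^sub>R e)"
      using False assms[of "norm x"] by (simp add: model_metric_def Let_def flip: e_def)
    also have "\<dots> = v \<bullet> w"
      using e by (simp add: inner_diff_left inner_diff_right inner_commute[of e w])
    finally show ?thesis by simp
  qed (simp add: model_metric_def)
  then show ?thesis unfolding riemannian_isometric_def flat_metric_def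
    by (intro exI[of _ id] exI[of _ "\<lambda>_. id"]) (auto simp: id_def intro: bij_id[unfolded id_def])
qed

context lane_emden
begin

lemma rigid_Theta:
  assumes rigid and r: "0 < r"
  shows "\<Theta> r = (1 - sigma) / 2 * r"
proof -
  let ?f = "\<lambda>r. \<Theta> r - (1 - sigma) / 2 * r"
  have D: "(?f has_real_derivative 0) (at x)" if x: "0 < x" for x
  proof -
    have "(?f has_real_derivative (1 - sigma) / 2 - (1 - sigma) / 2 * 1) (at x)"
      by (intro DERIV_diff DERIV_cmult DERIV_ident rigid_Theta_deriv[OF assms(1) x])
    then show ?thesis by simp
  qed
  have c: "continuous_on {0..r} ?f"
    by (intro continuous_on_diff continuous_on_mult continuous_on_const continuous_on_id Theta_cont)
  have "?f r \<le> ?f 0"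
    by (rule deriv_nonpos_imp_antimono_real[where f = ?f, OF _ c]) (use r D in auto)
  moreover have "?f 0 \<le> ?f r"
    by (rule deriv_nonneg_imp_mono_real[where f = ?f, OF _ c]) (use r D in auto)
  ultimately show ?thesis by simp
qed

text \<open>With \<open>th = (1 - sigma) / 2\<close>, rigidity gives \<open>W = th r w\<close> and
  \<open>W w' = (1 - th) w^2\<close>, so \<open>w\<close> solves
  \<open>w' = (1 / th - 1) w / r\<close>.\<close>

lemma rigid_weight:
  assumes rigid
  shows "\<exists>c. \<forall>r>0. w r = c * r powr (2 / (1 - sigma) - 1)"
proof -
  define th where "th = (1 - sigma) / 2"
  have th: "0 < th" using sigma_bounds by (simp add: th_def)
  let ?f = "\<lambda>r. w r * r powr (1 - 1 / th)"
  have "\<exists>c. \<forall>r\<in>{0<..}. ?f r = c"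
  proof (rule has_field_derivative_zero_constant)
    fix r :: real assume "r \<in> {0<..}"
    then have r: "0 < r" by simp
    have "W r * w' r = (1 - th) * (w r * w r)"
    proof -
      have a: "1 + x = 2 * (1 - (1 - x) / 2)" for x :: real by (simp add: field_simps)
      have "2 * (W r * w' r) = (1 + sigma) * (w r * w r)"
        using assms r unfolding rigid_def by (simp add: power2_eq_square add.assoc)
      also have "\<dots> = 2 * (1 - th) * (w r * w r)" unfolding th_def by (subst a) (rule refl)
      finally show ?thesis by (simp add: algebra_simps)
    qed
    moreover have "W r = th * r * w r" using rigid_Theta[OF assms r] w_pos[OF r] by (simp add: th_def field_simps)
    ultimately have "th * r * w' r = (1 - th) * w r" using w_pos[OF r] by simp
    then have w': "w' r = (1 / th - 1) * w r / r" using th r by (simp add: field_simps)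
    have "(?f has_real_derivative w' r * r powr (1 - 1 / th) + ((1 - 1 / th) * r powr (1 - 1 / th - 1)) * w r) (at r)"
      by (intro DERIV_mult w_deriv r has_real_derivative_powr)
    moreover have "w' r * r powr (1 - 1 / th) + ((1 - 1 / th) * r powr (1 - 1 / th - 1)) * w r = 0"
    proof -
      have pd: "r powr (1 - 1 / th - 1) = r powr (1 - 1 / th) / r"
        unfolding powr_diff[of r "1 - 1 / th" 1] using r by simp
      have "(k - 1) * x / y * m + ((1 - k) * (m / y)) * x = 0" for k m x y :: real
        by (simp add: algebra_simps diff_divide_distrib)
      then show ?thesis unfolding pd w' .
    qed
    ultimately show "(?f has_real_derivative 0) (at r within {0<..})"
      by (auto intro: has_field_derivative_at_within)
  qed simp
  then obtain c where c: "\<And>r. 0 < r \<Longrightarrow> ?f r = c" by auto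
  have "w r = c * r powr (2 / (1 - sigma) - 1)" if r: "0 < r" for r
  proof -
    have "r powr (1 - 1 / th) * r powr (1 / th - 1) = 1" using r by (simp flip: powr_add)
    then have "w r = ?f r * r powr (1 / th - 1)" by (simp add: mult.assoc)
    also have "\<dots> = c * r powr (1 / th - 1)" by (simp only: c[OF r])
    also have "1 / th = 2 / (1 - sigma)" by (simp add: th_def)
    finally show ?thesis .
  qed
  then show ?thesis by blast
qed

lemma psol_C1:
  assumes s: "psol \<xi> \<eta> u v" and wc: "continuous_on {0<..} w'"
  shows "C1_on u {0..}" "C1_on (deriv u) {0<..}" "(u has_real_derivative 0) (at 0 within {0..})"
    and "\<And>r. 0 < r \<Longrightarrow> deriv u r = - slope_u v r"
    and "\<And>r. 0 < r \<Longrightarrow> deriv (\<lambda>s. w s * deriv u s) r = - (w r * ppow q (v r))"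
proof -
  let ?x = "slope_u v"
  note cs = psol_cont_source'[OF s]
  have xc: "continuous_on {0..} ?x" by (rule continuous_on_atLeast) (rule slope_cont[OF cs])
  show "C1_on u {0..}" unfolding C1_on_def
    by (intro exI[of _ "\<lambda>r. - ?x r"] conjI ballI continuous_on_minus xc) (use s in \<open>auto simp: lane_sol_def\<close>)
  show d: "deriv u r = - ?x r" if "0 < r" for r using psol_deriv'[OF s that] by (rule DERIV_imp_deriv)
  have ev: "\<forall>\<^sub>F s in nhds r. deriv u s = - ?x s" if "0 < r" for r
    using eventually_nhds_in_open[OF open_greaterThan, of r 0] that by (auto elim!: eventually_mono simp: d)
  show "C1_on (deriv u) {0<..}" unfolding C1_on_def
  proof (intro exI[of _ "\<lambda>r. - (ppow q (v r) - w' r / w r * ?x r)"] conjI ballI)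
    fix r :: real assume "r \<in> {0<..}"
    then have r: "0 < r" by simp
    have "((\<lambda>s. - ?x s) has_real_derivative - (ppow q (v r) - w' r / w r * ?x r)) (at r)"
      by (rule DERIV_minus[OF slope_deriv[OF cs[of "r+1"]]]) (use r in auto)
    then have "(deriv u has_real_derivative - (ppow q (v r) - w' r / w r * ?x r)) (at r)"
      using DERIV_cong_ev[OF refl ev[OF r] refl] by blast
    then show "(deriv u has_real_derivative - (ppow q (v r) - w' r / w r * ?x r)) (at r within {0<..})"
      by (rule has_field_derivative_at_within)
  next
    have "continuous_on {0<..} (\<lambda>r. ppow q (v r))"
      by (rule continuous_on_ppow[OF q_pos continuous_on_subset[OF lane_emden.lane_sol_cont[OF swap lane_sol_swap[OF s]]]]) auto
    moreover have "continuous_on {0<..} w" "continuous_on {0<..} ?x"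
      by (auto intro: continuous_on_subset[OF w_cont] continuous_on_subset[OF xc])
    moreover have "\<forall>r\<in>{0<..}. w r \<noteq> 0" using w_pos by force
    ultimately show "continuous_on {0<..} (\<lambda>r. - (ppow q (v r) - w' r / w r * ?x r))"
      by (intro continuous_on_minus continuous_on_diff continuous_on_mult continuous_on_divide wc)
  qed
  show "(u has_real_derivative 0) (at 0 within {0..})"
    using s slope_zero[of "\<lambda>t. ppow q (v t)"] by (force simp: lane_sol_def)
  show "deriv (\<lambda>s. w s * deriv u s) r = - (w r * ppow q (v r))" if r: "0 < r" for r
  proof (rule DERIV_imp_deriv)
    have D: "((\<lambda>s. - flux_u v s) has_real_derivative - (w r * ppow q (v r))) (at r)"
      by (rule DERIV_minus[OF flux_deriv[OF cs[of "r+1"]]]) (use r in auto)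
    have ev2: "\<forall>\<^sub>F s in nhds r. w s * deriv u s = - flux_u v s"
      using eventually_nhds_in_open[OF open_greaterThan, of r 0] r
      by (auto elim!: eventually_mono simp: d flux_slope)
    show "((\<lambda>s. w s * deriv u s) has_real_derivative - (w r * ppow q (v r))) (at r)"
      using DERIV_cong_ev[OF refl ev2 refl] D by blast
  qed
qed

end

context lane_emden_model
begin

text \<open>The power law reads \<open>(\<psi> r / r) ^ (n - 1) = c * r powr (- e)\<close>, with
  \<open>e \<ge> 0\<close> by the condition on the exponents. Since \<open>\<psi>\<close> has
  derivative 1 at the pole, the left side tends to 1 there, which forces \<open>e = 0\<close> and
  \<open>c = 1\<close>; \<open>e = 0\<close> is the critical hyperbola.\<close>

lemma rigid_euclidean:
  assumes rigid
  shows "\<And>r. 0 \<le> r \<Longrightarrow> \<psi> r = r" and "1 / (p + 1) + 1 / (q + 1) = (real n - 2) / real n"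
proof -
  define e where "e = real n - 2 / (1 - sigma)"
  obtain c where c: "\<And>r. 0 < r \<Longrightarrow> wt r = c * r powr (2 / (1 - sigma) - 1)" using rigid_weight[OF assms] by blast
  have e0: "0 \<le> e" using hyperbola' n3 sigma_bounds by (simp add: e_def field_simps)
  have quot: "(\<psi> r / r) ^ (n - 1) = c * r powr (- e)" if r: "0 < r" for r
  proof -
    have "r ^ (n - 1) = r powr (real n - 1)" using r n3 by (simp add: of_nat_diff flip: powr_realpow)
    then have "(\<psi> r / r) ^ (n - 1) = c * (r powr (2 / (1 - sigma) - 1) / r powr (real n - 1))"
      using c[OF r] by (simp add: power_divide)
    also have "r powr (2 / (1 - sigma) - 1) / r powr (real n - 1) = r powr (- e)"
      unfolding powr_diff[symmetric] by (simp add: e_def)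
    finally show ?thesis .
  qed
  have "((\<lambda>r. \<psi> r / r) \<longlongrightarrow> 1) (at_right 0)"
    using psi_deriv_zero psi_zero unfolding has_field_derivative_iff at_within_Ici_at_right by simp
  then have "((\<lambda>r. (\<psi> r / r) ^ (n - 1)) \<longlongrightarrow> 1 ^ (n - 1)) (at_right 0)" by (rule tendsto_power)
  moreover have ev: "\<forall>\<^sub>F r in at_right 0. (\<psi> r / r) ^ (n - 1) = c * r powr (- e)"
    using quot by (auto simp: eventually_at_right_less eventually_at_filter)
  ultimately have lim: "((\<lambda>r. c * r powr (- e)) \<longlongrightarrow> 1) (at_right 0)"
    using tendsto_cong[OF ev, of 1] by simp
  have e: "e = 0"
  proof (rule ccontr)
    assume "e \<noteq> 0"
    then have e1: "0 < e" using e0 by simp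
    have "((\<lambda>r. r powr e) \<longlongrightarrow> 0) (at_right 0)"
      using tendsto_powr'[OF tendsto_ident_at[of 0 "{0<..}"] tendsto_const[of e]] e1
      by (auto simp: eventually_at_filter)
    from tendsto_mult[OF lim this] have "((\<lambda>r. c * r powr (- e) * r powr e) \<longlongrightarrow> 0) (at_right 0)" by simp
    moreover have "\<forall>\<^sub>F r in at_right 0. c * r powr (- e) * r powr e = c"
      by (auto simp: eventually_at_filter mult.assoc simp flip: powr_add)
    ultimately have "((\<lambda>r. c) \<longlongrightarrow> 0) (at_right (0::real))" using tendsto_cong by fast
    then have "c = 0" by (simp add: tendsto_const_iff)
    then show False using c[of 1] psi_pos[of 1] by simp
  qed
  then have "\<forall>\<^sub>F r in at_right 0. c * r powr (- e) = c" by (auto simp: eventually_at_filter)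
  then have "((\<lambda>r. c) \<longlongrightarrow> 1) (at_right (0::real))" using lim tendsto_cong by fast
  then have c1: "c = 1" by (simp add: tendsto_const_iff)
  show "\<psi> r = r" if "0 \<le> r" for r
  proof (cases "r = 0")
    case False
    then have r: "0 < r" using that by simp
    have "(\<psi> r / r) ^ (n - 1) = 1 ^ (n - 1)" using quot[OF r] e c1 r by simp
    then have "\<psi> r / r = 1" by (rule power_eq_imp_eq_base) (use r psi_pos[OF r] n3 in auto)
    then show ?thesis using r by simp
  qed (simp add: psi_zero)
  show "1 / (p + 1) + 1 / (q + 1) = (real n - 2) / real n"
  proof -
    have "real n * (1 - sigma) = 2" using e sigma_bounds by (simp add: e_def field_simps)
    then show ?thesis using n3 by (simp add: field_simps)
  qed
qed

section \<open>From the Cauchy problem to the truncated system and back\<close>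

lemma CP_imp_lane_sol:
  assumes cp: "CP_solution n \<psi> p q I \<xi> \<eta> u v"
    and I: "{0..R} \<subseteq> I" "{0<..<R} \<subseteq> interior I" "I \<subseteq> {0..}"
    and nn: "\<And>r. r \<in> {0..R} \<Longrightarrow> 0 \<le> u r \<and> 0 \<le> v r"
  shows "lane_sol wt p q {0..R} \<xi> \<eta> u v"
proof -
  have "(u has_real_derivative - slope_u v r) (at r within {0..R})" if "r \<in> {0..R}" for r
    by (rule CP_component[OF wt_cont wt_zero wt_pos wt_deriv pos_q I _ _ _ _ _ that])
      (use cp nn in \<open>auto simp: CP_solution_def\<close>)
  moreover have "(v has_real_derivative - slope_v u r) (at r within {0..R})" if "r \<in> {0..R}" for r
    by (rule CP_component[OF wt_cont wt_zero wt_pos wt_deriv pos_p I _ _ _ _ _ that])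
      (use cp nn in \<open>auto simp: CP_solution_def\<close>)
  ultimately show ?thesis using cp by (auto simp: lane_sol_def CP_solution_def)
qed

lemma lane_sol_atLeastI:
  assumes "\<And>R. 0 < R \<Longrightarrow> lane_sol wt p q {0..R} \<xi> \<eta> u v"
  shows "psol \<xi> \<eta> u v"
proof -
  have "at r within {0..r+1} = at r within {0..}" if "0 \<le> r" for r :: real
    by (rule at_within_nhd[of _ "{..<r+1}"]) (use that in auto)
  moreover have "r \<in> {0..r+1}" if "0 \<le> r" for r :: real using that by simp
  ultimately show ?thesis
    using assms[of 1] assms[of "_ + 1"] unfolding lane_sol_def by (metis add_nonneg_pos atLeast_iff zero_less_one)
qed

lemma abs_powr_eq_ppow: "0 < x \<Longrightarrow> \<bar>x\<bar> powr (a - 1) * x = ppow a x"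
  using powr_add[of x "a - 1" 1] by (simp add: ppow_eq)

lemma globally_positive_iff:
  "globally_positive_solution n \<psi> p q \<xi> \<eta> u v \<longleftrightarrow> psol \<xi> \<eta> u v \<and> (\<forall>r\<ge>0. 0 < u r \<and> 0 < v r)"
proof
  assume g: "globally_positive_solution n \<psi> p q \<xi> \<eta> u v"
  then have cp: "CP_solution n \<psi> p q {0..} \<xi> \<eta> u v" and pos: "\<forall>r\<ge>0. 0 < u r \<and> 0 < v r"
    by (auto simp: globally_positive_solution_def)
  have "psol \<xi> \<eta> u v"
    by (intro lane_sol_atLeastI CP_imp_lane_sol[OF cp]) (use pos in \<open>auto simp: less_imp_le\<close>)
  with pos show "psol \<xi> \<eta> u v \<and> (\<forall>r\<ge>0. 0 < u r \<and> 0 < v r)" by blast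
next
  assume "psol \<xi> \<eta> u v \<and> (\<forall>r\<ge>0. 0 < u r \<and> 0 < v r)"
  then have s: "psol \<xi> \<eta> u v" and pos: "\<And>r. 0 \<le> r \<Longrightarrow> 0 < u r \<and> 0 < v r" by auto
  note C = psol_C1[OF s wt'_cont] and D = lane_emden.psol_C1[OF swap lane_sol_swap[OF s] wt'_cont]
  have "CP_solution n \<psi> p q {0..} \<xi> \<eta> u v"
    unfolding CP_solution_def interior_real_atLeast
  proof (intro conjI ballI)
    fix r :: real assume "r \<in> {0<..}"
    then have r: "0 < r" by simp
    show "deriv (\<lambda>s. wt s * deriv u s) r + wt r * (\<bar>v r\<bar> powr (q - 1) * v r) = 0"
      using C(5)[OF r] abs_powr_eq_ppow[of "v r" q] pos[of r] r by simp
    show "deriv (\<lambda>s. wt s * deriv v s) r + wt r * (\<bar>u r\<bar> powr (p - 1) * u r) = 0"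
      using D(5)[OF r] abs_powr_eq_ppow[of "u r" p] pos[of r] r by simp
  qed (use C(1-3) D(1-3) psol_init[OF s] in auto)
  with pos show "globally_positive_solution n \<psi> p q \<xi> \<eta> u v"
    by (auto simp: globally_positive_solution_def)
qed

lemma no_common_zero_CP:
  assumes init: "0 < \<xi>" "0 < \<eta>" and R: "0 < R"
    and cp: "CP_solution n \<psi> p q {0..R} \<xi> \<eta> u v"
    and pos: "\<And>r. 0 < r \<Longrightarrow> r < R \<Longrightarrow> 0 < u r \<and> 0 < v r" and zero: "u R = 0" "v R = 0"
  shows False
proof -
  have i: "u 0 = \<xi>" "v 0 = \<eta>" using cp by (auto simp: CP_solution_def)
  have "0 \<le> u r \<and> 0 \<le> v r" if "r \<in> {0..R}" for r
    using pos[of r] i init zero that by (cases "r = 0"; cases "r = R") (auto simp: less_imp_le)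
  then have s: "lane_sol wt p q {0..R} \<xi> \<eta> u v"
    by (intro CP_imp_lane_sol[OF cp]) auto
  show False by (rule no_common_zero[OF s init R pos zero])
qed

section \<open>Finite integrals as bounded primitives, and the two alternatives for
  \<open>\<Theta>\<close>\<close>

lemma T_eq: "vol n \<psi> r = W r" "Theta n \<psi> r = \<Theta> r"
  by (simp_all add: vol_def Theta_def)

lemma Theta_integrable_iff:
  "Theta n \<psi> absolutely_integrable_on {0<..} \<longleftrightarrow> (\<exists>C. \<forall>r\<ge>0. T r \<le> C)"
  by (rule absolutely_integrable_iff_bounded, rule continuous_on_atLeast, rule Theta_cont,
      erule Theta_nonneg, rule T_eq(2))

lemma finite_gradient_iff:
  assumes s: "psol \<xi> \<eta> u v"
  shows "finite_gradient_integral n \<psi> u v \<longleftrightarrow> (\<exists>C. \<forall>r\<ge>0. gradient_energy u v r \<le> C)"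
  unfolding finite_gradient_integral_def gradient_energy_def flux_def
proof (rule absolutely_integrable_iff_bounded)
  show "continuous_on {0..} (\<lambda>t. wt t * (slope_u v t * slope_v u t))"
    by (rule continuous_on_atLeast) (rule wf_cont[OF grad_cont[OF s]])
  show "0 \<le> wt x * (slope_u v x * slope_v u x)" if "0 \<le> x" for x
    by (intro mult_nonneg_nonneg w_nonneg that psol_source_nonneg[OF s]
        lane_emden.psol_source_nonneg[OF swap lane_sol_swap[OF s]])
  show "deriv u x * deriv v x * wt x = wt x * (slope_u v x * slope_v u x)"
    if "0 < x" for x
    using psol_C1(4)[OF s wt'_cont that] lane_emden.psol_C1(4)[OF swap lane_sol_swap[OF s] wt'_cont that]
    by simp
qed

lemma finite_power_iff:
  assumes c: "\<And>R. continuous_on {0..R} (\<lambda>t. ppow a (v t))" and pos: "\<And>r. 0 \<le> r \<Longrightarrow> 0 < v r"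
  shows "finite_power_integral n \<psi> a v \<longleftrightarrow> (\<exists>C. \<forall>r\<ge>0. power_energy a v r \<le> C)"
  unfolding finite_power_integral_def power_energy_def flux_def
proof (rule absolutely_integrable_iff_bounded)
  show "continuous_on {0..} (\<lambda>t. wt t * ppow a (v t))"
    by (rule continuous_on_atLeast) (rule wf_cont[OF c])
  show "0 \<le> wt x * ppow a (v x)" if "0 \<le> x" for x using w_nonneg[OF that] by simp
  show "v x powr a * wt x = wt x * ppow a (v x)" if "0 < x" for x
    using pos[of x] that by (simp add: ppow_eq less_imp_le)
qed

lemma rigidity:
  assumes init: "0 < \<xi>" "0 < \<eta>" and g: "globally_positive_solution n \<psi> p q \<xi> \<eta> u v"
    and fin: "finite_gradient_integral n \<psi> u v \<or> finite_power_integral n \<psi> (p + 1) u \<or> finite_power_integral n \<psi> (q + 1) v"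
  shows "(\<forall>r\<ge>0. \<psi> r = r) \<and> 1 / (p + 1) + 1 / (q + 1) = (real n - 2) / real n \<and>
    finite_gradient_integral n \<psi> u v \<and> finite_power_integral n \<psi> (p + 1) u \<and> finite_power_integral n \<psi> (q + 1) v"
proof -
  have s: "psol \<xi> \<eta> u v" and pos: "\<And>r. 0 \<le> r \<Longrightarrow> 0 < u r \<and> 0 < v r"
    using g unfolding globally_positive_iff by auto
  have pu: "\<And>r. 0 \<le> r \<Longrightarrow> 0 < u r" and pv: "\<And>r. 0 \<le> r \<Longrightarrow> 0 < v r" using pos by auto
  have p1: "0 < p + 1" "0 < q + 1" using pos_p pos_q by auto
  have iu: "finite_power_integral n \<psi> (p + 1) u \<longleftrightarrow> (\<exists>C. \<forall>r\<ge>0. power_energy (p + 1) u r \<le> C)"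
    by (rule finite_power_iff[OF lane_emden.pow_cont[OF swap lane_sol_swap[OF s] p1(1)] pu])
  have iv: "finite_power_integral n \<psi> (q + 1) v \<longleftrightarrow> (\<exists>C. \<forall>r\<ge>0. power_energy (q + 1) v r \<le> C)"
    by (rule finite_power_iff[OF pow_cont[OF s p1(2)] pv])
  note iffs = finite_gradient_iff[OF s] iu iv
  show ?thesis
    using finite_energy_rigid[OF s init pos fin[unfolded iffs]] rigid_euclidean unfolding iffs by blast
qed

text \<open>A positive limit of either component would bound \<open>T\<close>, by
  \<open>T_bounded_of_positive_limit\<close>.\<close>

lemma vanishing_of_unbounded:
  assumes s: "psol \<xi> \<eta> u v" and pos: "\<And>r. 0 \<le> r \<Longrightarrow> 0 < u r \<and> 0 < v r"
    and T: "\<not> (\<exists>C. \<forall>r\<ge>0. T r \<le> C)"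
  shows "(u \<longlongrightarrow> 0) at_top \<and> (v \<longlongrightarrow> 0) at_top"
proof -
  obtain l where l: "(u \<longlongrightarrow> l) at_top" "\<And>r. 0 \<le> r \<Longrightarrow> l \<le> u r" "0 \<le> l"
    by (rule antimono_bounded_tendsto[of u 0]) (use pos psol_antimono'[OF s] in \<open>auto simp: less_imp_le\<close>)
  obtain m where m: "(v \<longlongrightarrow> m) at_top" "\<And>r. 0 \<le> r \<Longrightarrow> m \<le> v r" "0 \<le> m"
    by (rule antimono_bounded_tendsto[of v 0]) (use pos psol_antimono[OF s] in \<open>auto simp: less_imp_le\<close>)
  have "l = 0"
  proof (rule ccontr)
    assume "l \<noteq> 0"
    then have "0 < l" using l(3) by simp
    then have "T r \<le> \<eta> / l powr p" if "0 \<le> r" for r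
      by (intro T_bounded_of_positive_limit[OF s _ _ l(2) that]) (use pos in auto)
    then show False using T by blast
  qed
  moreover have "m = 0"
  proof (rule ccontr)
    assume "m \<noteq> 0"
    then have "0 < m" using m(3) by simp
    then have "T r \<le> \<xi> / m powr q" if "0 \<le> r" for r
      by (intro lane_emden.T_bounded_of_positive_limit[OF swap lane_sol_swap[OF s] _ _ m(2) that]) (use pos in auto)
    then show False using T by blast
  qed
  ultimately show ?thesis using l(1) m(1) by simp
qed

lemma tends_to_positiveI:
  assumes "\<And>r s. 0 \<le> r \<Longrightarrow> r \<le> s \<Longrightarrow> u s \<le> u r" "\<And>r. 0 \<le> r \<Longrightarrow> 0 < u r" "\<not> (u \<longlongrightarrow> 0) at_top"
  shows "tends_to_positive u"
proof -
  obtain l where l: "(u \<longlongrightarrow> l) at_top" "0 \<le> l"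
    by (rule antimono_bounded_tendsto[of u 0]) (use assms in \<open>auto simp: less_imp_le\<close>)
  then have "l \<noteq> 0" using assms(3) by auto
  then show ?thesis using l unfolding tends_to_positive_def by (intro exI[of _ l]) auto
qed

lemma admits_positive_iff_solution: "admits_positive \<xi> \<eta> \<longleftrightarrow> (\<exists>u v. globally_positive_solution n \<psi> p q \<xi> \<eta> u v)"
  unfolding admits_positive_def globally_positive_iff ..

lemma not_tendsto_zero:
  assumes "0 < d" "\<And>r::real. 1 \<le> r \<Longrightarrow> d \<le> (u r :: real)"
  shows "\<not> (u \<longlongrightarrow> 0) at_top"
proof
  assume "(u \<longlongrightarrow> 0) at_top"
  then have "d \<le> 0"
    by (rule tendsto_lowerbound) (use assms in \<open>auto intro: eventually_at_top_linorderI[of 1]\<close>)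
  with assms(1) show False by simp
qed

text \<open>For \<open>\<eta> > m \<xi>\<close>, comparison with the positive solution at
  \<open>m \<xi>\<close> gives \<open>v \<ge> \<eta> - m \<xi>\<close>, although \<open>v\<close>
  must tend to 0. So the admissible interval is a single point.\<close>

lemma nonintegrable_case:
  assumes T: "\<not> Theta n \<psi> absolutely_integrable_on {0<..}"
  shows "\<exists>eta. increasing_bijection eta \<and>
    (\<forall>\<xi>>0.
      (\<forall>\<eta>>0. (\<exists>u v. globally_positive_solution n \<psi> p q \<xi> \<eta> u v) \<longleftrightarrow> \<eta> = eta \<xi>) \<and>
      (\<forall>u v. globally_positive_solution n \<psi> p q \<xi> (eta \<xi>) u v \<longrightarrow>
        (u \<longlongrightarrow> 0) at_top \<and> (v \<longlongrightarrow> 0) at_top))"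
proof -
  note T' = T[unfolded Theta_integrable_iff]
  show ?thesis
  proof (rule global_solutions_structure)
    fix m M
    assume m: "increasing_bijection m" and mM: "\<And>\<xi>. 0 < \<xi> \<Longrightarrow> 0 < m \<xi> \<and> m \<xi> \<le> M \<xi>"
      and G: "\<And>\<xi> \<eta>. 0 < \<xi> \<Longrightarrow> 0 < \<eta> \<Longrightarrow> admits_positive \<xi> \<eta> \<longleftrightarrow> m \<xi> \<le> \<eta> \<and> \<eta> \<le> M \<xi>"
    have eq: "\<eta> = m \<xi>" if x: "0 < \<xi>" and y: "0 < \<eta>" and g: "admits_positive \<xi> \<eta>" for \<xi> \<eta>
    proof (rule ccontr)
      assume "\<eta> \<noteq> m \<xi>"
      then have lt: "m \<xi> < \<eta>" using G[OF x y] g by simp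
      obtain u v where s: "psol \<xi> \<eta> u v" and pos: "\<And>r. 0 \<le> r \<Longrightarrow> 0 < u r \<and> 0 < v r"
        using g unfolding admits_positive_def by blast
      have "admits_positive \<xi> (m \<xi>)" using G[OF x, of "m \<xi>"] mM[OF x] by simp
      then obtain u' v' where s': "psol \<xi> (m \<xi>) u' v'" and pos': "\<And>r. 0 \<le> r \<Longrightarrow> 0 < u' r \<and> 0 < v' r"
        unfolding admits_positive_def by blast
      have "\<eta> - m \<xi> \<le> v r" if "1 \<le> r" for r
        using psol_compare(2)[OF s s' order_refl lt, of r] pos'[of r] that by auto
      then have "\<not> (v \<longlongrightarrow> 0) at_top" using lt by (intro not_tendsto_zero[of "\<eta> - m \<xi>"]) auto
      then show False using vanishing_of_unbounded[OF s pos T'] by blast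
    qed
    show ?thesis
    proof (intro exI[of _ m] conjI allI impI m)
      fix \<xi> \<eta> :: real assume x: "0 < \<xi>" "0 < \<eta>"
      show "(\<exists>u v. globally_positive_solution n \<psi> p q \<xi> \<eta> u v) \<longleftrightarrow> \<eta> = m \<xi>"
        unfolding admits_positive_iff_solution[symmetric] using eq[OF x] G[OF x] mM[OF x(1)] by auto
    next
      fix \<xi> :: real and u v assume "globally_positive_solution n \<psi> p q \<xi> (m \<xi>) u v"
      then show "(u \<longlongrightarrow> 0) at_top" "(v \<longlongrightarrow> 0) at_top"
        using vanishing_of_unbounded[OF _ _ T'] unfolding globally_positive_iff by blast+
    qed
  qed
qed

text \<open>If the thresholds coincided, a solution there would have both limits zero, which
  \<open>no_vanishing_solution\<close> excludes. Their gap bounds \<open>v\<close> from below along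
  the solution at \<open>M \<xi>\<close>, so \<open>lower_bound_bounded\<close> bounds the gap
  uniformly in \<open>\<xi>\<close>.\<close>

lemma integrable_case:
  assumes T: "Theta n \<psi> absolutely_integrable_on {0<..}"
  shows "\<exists>eta_m eta_M. increasing_bijection eta_m \<and> increasing_bijection eta_M \<and>
    (\<forall>\<xi>>0. eta_m \<xi> < eta_M \<xi>) \<and>
    Limsup at_top (\<lambda>\<xi>. ereal (eta_M \<xi> - eta_m \<xi>)) < \<infinity> \<and>
    (\<forall>\<xi>>0. \<forall>\<eta>>0.
      ((\<exists>u v. globally_positive_solution n \<psi> p q \<xi> \<eta> u v) \<longleftrightarrow>
        eta_m \<xi> \<le> \<eta> \<and> \<eta> \<le> eta_M \<xi>) \<and>
      (\<forall>u v. globally_positive_solution n \<psi> p q \<xi> \<eta> u v \<longrightarrow>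
        (\<eta> = eta_m \<xi> \<longrightarrow> tends_to_positive u \<and> (v \<longlongrightarrow> 0) at_top) \<and>
        (eta_m \<xi> < \<eta> \<and> \<eta> < eta_M \<xi> \<longrightarrow> tends_to_positive u \<and> tends_to_positive v) \<and>
        (\<eta> = eta_M \<xi> \<longrightarrow> (u \<longlongrightarrow> 0) at_top \<and> tends_to_positive v)))"
proof -
  obtain C where C: "\<And>r. 0 \<le> r \<Longrightarrow> T r \<le> C" using T[unfolded Theta_integrable_iff] by blast
  show ?thesis
  proof (rule global_solutions_structure)
    fix m M
    assume m: "increasing_bijection m" and M: "increasing_bijection M"
      and mM: "\<And>\<xi>. 0 < \<xi> \<Longrightarrow> 0 < m \<xi> \<and> m \<xi> \<le> M \<xi>"
      and G: "\<And>\<xi> \<eta>. 0 < \<xi> \<Longrightarrow> 0 < \<eta> \<Longrightarrow> admits_positive \<xi> \<eta> \<longleftrightarrow> m \<xi> \<le> \<eta> \<and> \<eta> \<le> M \<xi>"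
      and at_m: "\<And>\<xi> u v. 0 < \<xi> \<Longrightarrow> psol \<xi> (m \<xi>) u v \<Longrightarrow> (\<And>r. 0 \<le> r \<Longrightarrow> 0 < u r \<and> 0 < v r) \<Longrightarrow> (v \<longlongrightarrow> 0) at_top"
      and at_M: "\<And>\<xi> u v. 0 < \<xi> \<Longrightarrow> psol \<xi> (M \<xi>) u v \<Longrightarrow> (\<And>r. 0 \<le> r \<Longrightarrow> 0 < u r \<and> 0 < v r) \<Longrightarrow> (u \<longlongrightarrow> 0) at_top"
    have Gm: "\<exists>u v. psol \<xi> (m \<xi>) u v \<and> (\<forall>r\<ge>0. 0 < u r \<and> 0 < v r)" if "0 < \<xi>" for \<xi>
      using G[OF that, of "m \<xi>"] mM[OF that] unfolding admits_positive_def by simp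
    have GM: "\<exists>u v. psol \<xi> (M \<xi>) u v \<and> (\<forall>r\<ge>0. 0 < u r \<and> 0 < v r)" if "0 < \<xi>" for \<xi>
      using G[OF that, of "M \<xi>"] mM[OF that] unfolding admits_positive_def by simp
    have lt: "m \<xi> < M \<xi>" if x: "0 < \<xi>" for \<xi>
    proof (rule ccontr)
      assume "\<not> m \<xi> < M \<xi>"
      then have e: "m \<xi> = M \<xi>" using mM[OF x] by simp
      obtain u v where s: "psol \<xi> (m \<xi>) u v" and pos: "\<And>r. 0 \<le> r \<Longrightarrow> 0 < u r \<and> 0 < v r" using Gm[OF x] by blast
      show False
        using no_vanishing_solution[OF s x _ pos at_M[OF x s[unfolded e] pos] at_m[OF x s pos] C] mM[OF x] by blast
    qed
    have gap: "M \<xi> - m \<xi> \<le> v r" if x: "0 < \<xi>" and s: "psol \<xi> (M \<xi>) u v" and r: "0 \<le> r" for \<xi> u v r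
    proof -
      obtain u' v' where s': "psol \<xi> (m \<xi>) u' v'" and pos': "\<And>r. 0 \<le> r \<Longrightarrow> 0 < u' r \<and> 0 < v' r" using Gm[OF x] by blast
      show ?thesis using psol_compare(2)[OF s s' order_refl lt[OF x] r] pos'[OF r] by simp
    qed
    obtain K where K: "\<And>\<xi> \<eta> u v d. psol \<xi> \<eta> u v \<Longrightarrow> \<forall>r\<ge>0. 0 < u r \<and> 0 < v r \<Longrightarrow> \<forall>r\<ge>0. d \<le> v r \<Longrightarrow> d \<le> K"
      using lower_bound_bounded by blast
    have "M \<xi> - m \<xi> \<le> K" if x: "0 < \<xi>" for \<xi>
      using GM[OF x] K gap[OF x] by blast
    then have "\<forall>\<^sub>F \<xi> in at_top. ereal (M \<xi> - m \<xi>) \<le> ereal K"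
      by (intro eventually_at_top_linorderI[of 1]) auto
    then have lim: "Limsup at_top (\<lambda>\<xi>. ereal (M \<xi> - m \<xi>)) < \<infinity>"
      using Limsup_bounded[of "\<lambda>\<xi>. ereal (M \<xi> - m \<xi>)" "ereal K" at_top] by (auto intro: le_less_trans)
    show ?thesis
    proof (rule exI[of _ m], rule exI[of _ M], intro conjI allI impI m M lim lt)
      fix \<xi> \<eta> :: real assume x: "0 < \<xi>" "0 < \<eta>"
      show "(\<exists>u v. globally_positive_solution n \<psi> p q \<xi> \<eta> u v) \<longleftrightarrow> m \<xi> \<le> \<eta> \<and> \<eta> \<le> M \<xi>"
        using admits_positive_iff_solution G[OF x] by simp
      fix u v assume g: "globally_positive_solution n \<psi> p q \<xi> \<eta> u v"
      then have s: "psol \<xi> \<eta> u v" and pos: "\<And>r. 0 \<le> r \<Longrightarrow> 0 < u r \<and> 0 < v r"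
        unfolding globally_positive_iff by auto
      note not_both = no_vanishing_solution[OF s x pos _ _ C]
      have tu: "tends_to_positive u" if "\<not> (u \<longlongrightarrow> 0) at_top"
        by (rule tends_to_positiveI[OF psol_antimono'[OF s] _ that]) (use pos in auto)
      have tv: "tends_to_positive v" if "\<not> (v \<longlongrightarrow> 0) at_top"
        by (rule tends_to_positiveI[OF psol_antimono[OF s] _ that]) (use pos in auto)
      show "(v \<longlongrightarrow> 0) at_top" if e: "\<eta> = m \<xi>" using at_m[OF x(1) s[unfolded e] pos] .
      then show "tends_to_positive u" if "\<eta> = m \<xi>" using tu not_both that by blast
      show "(u \<longlongrightarrow> 0) at_top" if e: "\<eta> = M \<xi>" using at_M[OF x(1) s[unfolded e] pos] .
      then show "tends_to_positive v" if "\<eta> = M \<xi>" using tv not_both that by blast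
      show "tends_to_positive v" if b: "m \<xi> < \<eta> \<and> \<eta> < M \<xi>"
      proof (rule tv, rule not_tendsto_zero[of "\<eta> - m \<xi>"])
        obtain u' v' where s': "psol \<xi> (m \<xi>) u' v'" and pos': "\<And>r. 0 \<le> r \<Longrightarrow> 0 < u' r \<and> 0 < v' r"
          using Gm[OF x(1)] by blast
        show "\<eta> - m \<xi> \<le> v r" if "1 \<le> r" for r
          using psol_compare(2)[OF s s' order_refl _, of r] pos'[of r] that b by auto
      qed (use b in simp)
      show "tends_to_positive u" if b: "m \<xi> < \<eta> \<and> \<eta> < M \<xi>"
      proof -
        obtain u' v' where s': "psol \<xi> (M \<xi>) u' v'" and pos': "\<And>r. 0 \<le> r \<Longrightarrow> 0 < u' r \<and> 0 < v' r"
          using GM[OF x(1)] by blast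
        \<comment> \<open>The data share \<open>\<xi>\<close>, so \<open>psol_compare\<close> leaves
          no gap in \<open>u\<close>; the strict comparison supplies one from radius 1 on.\<close>
        obtain d where d: "0 < d" "\<And>r. 1 \<le> r \<Longrightarrow> u' r + d \<le> u r"
          by (rule psol_strict_compare[OF s' s order_refl x(2) conjunct2[OF b]]) (rule that)
        have "d \<le> u r" if "1 \<le> r" for r using d(2)[OF that] pos'[of r] that by auto
        then show ?thesis by (intro tu not_tendsto_zero[OF d(1)])
      qed
    qed
  qed
qed

end

theorem corollary1p5:
  fixes \<psi> :: "real \<Rightarrow> real" and p q :: real and n :: nat
  defines "n \<equiv> CARD('n::finite)"
  assumes "n \<ge> 3"
    and "model_function \<psi>"
    and "p > 0" and "q > 0"
    and "1 / (p + 1) + 1 / (q + 1) \<le> (real n - 2) / real n"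
    and "convex_on {0..} (V_fun n \<psi> p q)"
  shows
    "(\<not> Theta n \<psi> absolutely_integrable_on {0<..} \<longrightarrow>
        (\<exists>eta. increasing_bijection eta \<and>
          (\<forall>\<xi>>0.
            (\<forall>\<eta>>0. (\<exists>u v. globally_positive_solution n \<psi> p q \<xi> \<eta> u v) \<longleftrightarrow> \<eta> = eta \<xi>) \<and>
            (\<forall>u v. globally_positive_solution n \<psi> p q \<xi> (eta \<xi>) u v \<longrightarrow>
              (u \<longlongrightarrow> 0) at_top \<and> (v \<longlongrightarrow> 0) at_top)))) \<and>
     (Theta n \<psi> absolutely_integrable_on {0<..} \<longrightarrow>
        (\<exists>eta_m eta_M. increasing_bijection eta_m \<and> increasing_bijection eta_M \<and>
          (\<forall>\<xi>>0. eta_m \<xi> < eta_M \<xi>) \<and>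
          Limsup at_top (\<lambda>\<xi>. ereal (eta_M \<xi> - eta_m \<xi>)) < \<infinity> \<and>
          (\<forall>\<xi>>0. \<forall>\<eta>>0.
            ((\<exists>u v. globally_positive_solution n \<psi> p q \<xi> \<eta> u v) \<longleftrightarrow>
              eta_m \<xi> \<le> \<eta> \<and> \<eta> \<le> eta_M \<xi>) \<and>
            (\<forall>u v. globally_positive_solution n \<psi> p q \<xi> \<eta> u v \<longrightarrow>
              (\<eta> = eta_m \<xi> \<longrightarrow> tends_to_positive u \<and> (v \<longlongrightarrow> 0) at_top) \<and>
              (eta_m \<xi> < \<eta> \<and> \<eta> < eta_M \<xi> \<longrightarrow> tends_to_positive u \<and> tends_to_positive v) \<and>
              (\<eta> = eta_M \<xi> \<longrightarrow> (u \<longlongrightarrow> 0) at_top \<and> tends_to_positive v))))) \<and>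
     (\<forall>\<xi>>0. \<forall>\<eta>>0. \<forall>u v.
        globally_positive_solution n \<psi> p q \<xi> \<eta> u v \<and>
        (finite_gradient_integral n \<psi> u v \<or>
         finite_power_integral n \<psi> (p + 1) u \<or>
         finite_power_integral n \<psi> (q + 1) v) \<longrightarrow>
          riemannian_isometric
            (model_metric \<psi> :: real ^ 'n \<Rightarrow> real ^ 'n \<Rightarrow> real ^ 'n \<Rightarrow> real) flat_metric \<and>
          (\<forall>r\<ge>0. \<psi> r = r) \<and>
          1 / (p + 1) + 1 / (q + 1) = (real n - 2) / real n \<and>
          finite_gradient_integral n \<psi> u v \<and>
          finite_power_integral n \<psi> (p + 1) u \<and>
          finite_power_integral n \<psi> (q + 1) v) \<and>
     (\<forall>\<xi>>0. \<forall>\<eta>>0. \<forall>R>0.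
        \<not> (\<exists>u v. CP_solution n \<psi> p q {0..R} \<xi> \<eta> u v \<and>
             (\<forall>r. 0 < r \<and> r < R \<longrightarrow> u r > 0 \<and> v r > 0) \<and> u R = 0 \<and> v R = 0))"
proof -
  interpret lane_emden_model \<psi> p q n
    using assms(2-7) by unfold_locales
  show ?thesis
  proof (intro conjI)
    show "\<forall>\<xi>>0. \<forall>\<eta>>0. \<forall>u v.
        globally_positive_solution n \<psi> p q \<xi> \<eta> u v \<and>
        (finite_gradient_integral n \<psi> u v \<or>
         finite_power_integral n \<psi> (p + 1) u \<or>
         finite_power_integral n \<psi> (q + 1) v) \<longrightarrow>
          riemannian_isometric
            (model_metric \<psi> :: real ^ 'n \<Rightarrow> real ^ 'n \<Rightarrow> real ^ 'n \<Rightarrow> real) flat_metric \<and>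
          (\<forall>r\<ge>0. \<psi> r = r) \<and>
          1 / (p + 1) + 1 / (q + 1) = (real n - 2) / real n \<and>
          finite_gradient_integral n \<psi> u v \<and>
          finite_power_integral n \<psi> (p + 1) u \<and>
          finite_power_integral n \<psi> (q + 1) v"
      using rigidity flat_isometry by blast
  next
    show "\<forall>\<xi>>0. \<forall>\<eta>>0. \<forall>R>0. \<not> (\<exists>u v. CP_solution n \<psi> p q {0..R} \<xi> \<eta> u v \<and>
        (\<forall>r. 0 < r \<and> r < R \<longrightarrow> u r > 0 \<and> v r > 0) \<and> u R = 0 \<and> v R = 0)"
      using no_common_zero_CP by blast
  qed (intro impI nonintegrable_case integrable_case; assumption)+
qed

end
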